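(* Let $(\mathcal H, \langle \cdot, \cdot \rangle_{\mathcal H})$ and $(\mathcal V, \langle \cdot, \cdot \rangle_{\mathcal V})$ be any real separable Hilbert spaces, let $k\ge 2$ be an integer and let $q\in(1,\infty)$. Then the norms $\|\cdot\|_{\mathcal G(k,q)(\mathcal V)}$ and $\|\cdot\|_{\mathcal D(k,q)(\mathcal V)}$ are equivalent. More precisely, for all $F\in\mathcal S_{\mathcal V}$, $$2^{\frac1q-1}\,\|F\|_{\mathcal G(k,q)(\mathcal V)}\le \|F\|_{\mathcal D(k,q)(\mathcal V)}\le \tau_{k,q}\,\|F\|_{\mathcal G(k,q)(\mathcal V)},\qquad \tau_{k,q}:=\prod_{\ell=1}^{k-1}\left(1+\max\{d_{\ell,q},c_q\}\right),$$ where $$c_q:=\begin{cases}\sqrt{q-1} & \text{if } q\in[2,\infty),\\ \frac{\pi}{2} & \text{if } q\in(1,2),\end{cases}\qquad d_{\ell,q}:=\begin{cases}\sqrt{\ell!} & \text{if } q\in[2,\infty),\\ \sqrt{\ell!}\,(\overline q-1)^{\frac{\ell}{2}} & \text{if } q\in(1,2),\end{cases}\qquad \overline q:=\frac{q}{q-1}.$$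
   Context: Setting. An isonormal Gaussian process over a real separable Hilbert space $\mathcal H$ is a centered Gaussian family $W=\{W(h):h\in\mathcal H\}$ of real random variables on a probability space $(\Omega,\mathcal F,\mathbb P)$ with $\mathbb E[W(h)W(g)]=\langle h,g\rangle_{\mathcal H}$ for all $h,g\in\mathcal H$. Throughout such a $W$ is fixed and $\mathcal F$ is the $\sigma$-field generated by $\{W(h):h\in\mathcal H\}$. $\mathcal S$ is the set of random variables $F=f(W(h_1),\dots,W(h_m))$ with $m\ge1$, $h_1,\dots,h_m\in\mathcal H$ and $f\in C^\infty(\mathbb R^m)$ such that $f$ and all its partial derivatives have at most polynomial growth. For an integer $k\ge1$, the $k$-th Malliavin derivative of such $F$ is the $\mathcal H^{\otimes k}$-valued random variable $$D^kF:=\sum_{i_1,\dots,i_k=1}^m\frac{\partial^k f}{\partial x_{i_1}\cdots\partial x_{i_k}}(W(h_1),\dots,W(h_m))\,h_{i_1}\otimes\cdots\otimes h_{i_k}$$ (independent of the chosen representation). $\mathcal S_{\mathcal V}$ is the set of $\mathcal V$-valued random variables $F=\sum_{j=1}^J F_j v_j$ with $J\ge 1$, $F_j\in\mathcal S$, $v_j\in\mathcal V$; for such $F$, $D^kF:=\sum_{j=1}^J(D^kF_j)\otimes v_j$, which takes values in the Hilbert tensor product $\mathcal H^{\otimes k}\otimes\mathcal V$. For a real separable Hilbert space $\mathcal K$, $\|G\|_{L^q(\Omega;\mathcal K)}:=(\mathbb E[\|G\|_{\mathcal K}^q])^{1/q}$. The graph norm and the full Sobolev norm are $$\|F\|_{\mathcal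 G(k,q)(\mathcal V)}:=\|F\|_{L^q(\Omega;\mathcal V)}+\|D^kF\|_{L^q(\Omega;\mathcal H^{\otimes k}\otimes\mathcal V)},$$ $$\|F\|_{\mathcal D(k,q)(\mathcal V)}^q:=\|F\|_{L^q(\Omega;\mathcal V)}^q+\sum_{\ell=1}^k\|D^\ell F\|_{L^q(\Omega;\mathcal H^{\otimes\ell}\otimes\mathcal V)}^q.$$ *)

theory Defs
  imports "HOL-Probability.Probability"
begin

section \<open>Tensor products of real Hilbert spaces\<close>

text \<open>
  The order \<open>k\<close> of a tensor in \<open>H\<^bsup>\<otimes>k\<^esup> \<otimes> V\<close> is a term variable, so all orders live in one
  type \<open>('h, 'v) tensor\<close>, the (orthogonal) algebraic direct sum over \<open>k\<close> of the algebraic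
  tensor products \<open>H\<^bsup>\<otimes>k\<^esup> \<otimes> V\<close>. The tensor \<open>h\<^sub>1 \<otimes> ... \<otimes> h\<^sub>k \<otimes> v\<close> is realised as the multilinear map
  \<open>(g\<^sub>1, ..., g\<^sub>k) \<mapsto> \<langle>h\<^sub>1,g\<^sub>1\<rangle> ... \<langle>h\<^sub>k,g\<^sub>k\<rangle> v\<close>, and the inner product is the one of the Hilbert tensor
  product, \<open>\<langle>h\<^sub>1 \<otimes> ... \<otimes> h\<^sub>k \<otimes> v, g\<^sub>1 \<otimes> ... \<otimes> g\<^sub>k \<otimes> w\<rangle> = \<langle>h\<^sub>1,g\<^sub>1\<rangle> ... \<langle>h\<^sub>k,g\<^sub>k\<rangle> \<langle>v,w\<rangle>\<close>; see
  \<open>inner_tens\<close>. The Hilbert tensor product is the completion of this inner product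
  space. Malliavin derivatives of smooth random variables are finite sums of elementary
  tensors, so their norms in the completion are the norms of this type.
\<close>

definition tensor_kernel :: "'h::real_inner list \<Rightarrow> 'h list \<Rightarrow> real" where
  "tensor_kernel hs gs =
     (if length hs = length gs then \<Prod>p<length hs. hs ! p \<bullet> gs ! p else 0)"

definition tensor_sum ::
    "('h::real_inner list \<times> 'v::real_inner) list \<Rightarrow> 'h list \<Rightarrow> 'v" where
  "tensor_sum xs gs = (\<Sum>(hs, v)\<leftarrow>xs. tensor_kernel hs gs *\<^sub>R v)"

definition tensor_pairing ::
    "('h::real_inner list \<times> 'v::real_inner) list \<Rightarrow> ('h list \<Rightarrow> 'v) \<Rightarrow> real" where
  "tensor_pairing xs T = (\<Sum>(hs, v)\<leftarrow>xs. v \<bullet> T hs)"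

text \<open>The choice of representation is immaterial; see \<open>tensor_inner_sum\<close>.\<close>

definition tensor_inner ::
    "('h::real_inner list \<Rightarrow> 'v::real_inner) \<Rightarrow> ('h list \<Rightarrow> 'v) \<Rightarrow> real" where
  "tensor_inner S T = tensor_pairing (SOME xs. tensor_sum xs = S) T"

lemma tensor_kernel_commute: "tensor_kernel hs gs = tensor_kernel gs hs"
  by (auto simp: tensor_kernel_def inner_commute)

lemma tensor_sum_simps [simp]:
  "tensor_sum [] gs = 0"
  "tensor_sum (x # xs) gs = tensor_kernel (fst x) gs *\<^sub>R snd x + tensor_sum xs gs"
  "tensor_sum (xs @ ys) gs = tensor_sum xs gs + tensor_sum ys gs"
  by (simp_all add: tensor_sum_def case_prod_unfold)

lemma tensor_sum_scaleR:
  "tensor_sum (map (\<lambda>(hs, v). (hs, r *\<^sub>R v)) xs) gs = r *\<^sub>R tensor_sum xs gs"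
  by (induction xs) (auto simp: scaleR_add_right mult.commute)

lemma tensor_pairing_simps [simp]:
  "tensor_pairing [] T = 0"
  "tensor_pairing (x # xs) T = snd x \<bullet> T (fst x) + tensor_pairing xs T"
  by (simp_all add: tensor_pairing_def case_prod_unfold)

lemma tensor_pairing_add:
  "tensor_pairing xs (\<lambda>gs. S gs + T gs) = tensor_pairing xs S + tensor_pairing xs T"
  by (induction xs) (auto simp: inner_add_right)

lemma tensor_pairing_scaleR:
  "tensor_pairing xs (\<lambda>gs. r *\<^sub>R T gs) = r * tensor_pairing xs T"
  by (induction xs) (auto simp: distrib_left)

lemma tensor_pairing_zero: "tensor_pairing xs (\<lambda>gs. 0) = 0"
  by (induction xs) auto

lemma tensor_pairing_commute:
  "tensor_pairing xs (tensor_sum ys) = tensor_pairing ys (tensor_sum xs)"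
proof (induction xs)
  case Nil
  have "tensor_sum ([] :: ('a list \<times> 'b) list) = (\<lambda>_. 0)"
    by (simp add: fun_eq_iff)
  then show ?case by (simp add: tensor_pairing_zero)
next
  case (Cons x xs)
  have 1: "tensor_pairing ys (\<lambda>gs. tensor_kernel (fst x) gs *\<^sub>R snd x)
      = snd x \<bullet> tensor_sum ys (fst x)"
    by (induction ys)
       (auto simp: inner_add_right tensor_kernel_commute inner_commute)
  have "tensor_sum (x # xs)
      = (\<lambda>gs. tensor_kernel (fst x) gs *\<^sub>R snd x + tensor_sum xs gs)"
    by (simp add: fun_eq_iff)
  then show ?case using Cons.IH 1 by (simp add: tensor_pairing_add)
qed

lemma tensor_inner_sum:
  "tensor_inner (tensor_sum xs) (tensor_sum ys) = tensor_pairing xs (tensor_sum ys)"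
proof -
  have "tensor_sum (SOME zs. tensor_sum zs = tensor_sum xs) = tensor_sum xs"
    by (rule someI) (rule refl)
  then show ?thesis
    unfolding tensor_inner_def by (metis tensor_pairing_commute)
qed

lemma finite_parseval:
  fixes S :: "'h::real_inner set"
  assumes "finite S"
  shows "\<exists>E. finite E \<and> (\<forall>e\<in>E. \<forall>e'\<in>E. e \<bullet> e' = (if e = e' then 1 else 0)) \<and>
    (\<forall>x\<in>S. x = (\<Sum>e\<in>E. (x \<bullet> e) *\<^sub>R e))"
  using assms
proof (induction S)
  case empty
  show ?case by (intro exI[of _ "{}"]) auto
next
  case (insert z S)
  then obtain E where E: "finite E" "\<forall>e\<in>E. \<forall>e'\<in>E. e \<bullet> e' = (if e = e' then 1 else 0)"
    "\<forall>x\<in>S. x = (\<Sum>e\<in>E. (x \<bullet> e) *\<^sub>R e)" by blast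
  define y where "y = z - (\<Sum>e\<in>E. (z \<bullet> e) *\<^sub>R e)"
  have ye: "y \<bullet> e = 0" if "e \<in> E" for e
  proof -
    have "(\<Sum>e'\<in>E. (z \<bullet> e') *\<^sub>R e') \<bullet> e = (\<Sum>e'\<in>E. (z \<bullet> e') * (e' \<bullet> e))"
      by (simp add: inner_sum_left)
    also have "\<dots> = (\<Sum>e'\<in>E. if e' = e then z \<bullet> e else 0)"
      using E(2) that by (intro sum.cong) auto
    also have "\<dots> = z \<bullet> e" using that E(1) by simp
    finally show ?thesis by (simp add: y_def inner_diff_left)
  qed
  show ?case
  proof (cases "y = 0")
    case True
    then show ?thesis using E by (intro exI[of _ E]) (auto simp: y_def)
  next
    case False
    define u where "u = y /\<^sub>R norm y"
    have uu: "u \<bullet> u = 1" using False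
      by (simp add: u_def power2_norm_eq_inner[symmetric] power2_eq_square)
    have ue: "u \<bullet> e = 0" "e \<bullet> u = 0" if "e \<in> E" for e
      using ye[OF that] by (simp_all add: u_def inner_commute)
    have uE: "u \<notin> E" using ue uu by fastforce
    have yu: "y = norm y *\<^sub>R u" using False by (simp add: u_def)
    have "(\<Sum>e\<in>E. (z \<bullet> e) *\<^sub>R e) \<bullet> u = 0"
      using ue by (simp add: inner_sum_left)
    then have "z \<bullet> u = y \<bullet> u" by (simp add: y_def inner_diff_left)
    also have "\<dots> = norm y" using uu by (subst yu) simp
    finally have "z = (\<Sum>e\<in>insert u E. (z \<bullet> e) *\<^sub>R e)"
      using uE E(1) yu by (simp add: y_def)
    moreover have "x = (\<Sum>e\<in>insert u E. (x \<bullet> e) *\<^sub>R e)" if "x \<in> S" for x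
    proof -
      have x: "x = (\<Sum>e\<in>E. (x \<bullet> e) *\<^sub>R e)" using E(3) that by blast
      have "x \<bullet> u = 0" using ue by (subst x) (simp add: inner_sum_left)
      then show ?thesis using uE E(1) x by simp
    qed
    ultimately show ?thesis
      using E ue uu uE by (intro exI[of _ "insert u E"]) auto
  qed
qed

lemma schur_product_nonneg:
  fixes h :: "nat \<Rightarrow> 'h::real_inner" and M :: "nat \<Rightarrow> nat \<Rightarrow> real"
  assumes M: "\<And>c. 0 \<le> (\<Sum>i<n. \<Sum>j<n. c i * c j * M i j)"
  shows "0 \<le> (\<Sum>i<n. \<Sum>j<n. c i * c j * ((h i \<bullet> h j) * M i j))"
proof -
  obtain E where E: "finite E"
    and "\<forall>x\<in>h ` {..<n}. x = (\<Sum>e\<in>E. (x \<bullet> e) *\<^sub>R e)"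
    using finite_parseval[of "h ` {..<n}"] by auto
  then have h: "h i = (\<Sum>e\<in>E. (h i \<bullet> e) *\<^sub>R e)" if "i < n" for i
    using that by blast
  have hh: "h i \<bullet> h j = (\<Sum>e\<in>E. (h i \<bullet> e) * (h j \<bullet> e))" if "i < n" "j < n" for i j
  proof -
    have "h i \<bullet> h j = (\<Sum>e\<in>E. (h i \<bullet> e) *\<^sub>R e) \<bullet> h j" using h[OF that(1)] by simp
    also have "\<dots> = (\<Sum>e\<in>E. (h i \<bullet> e) * (e \<bullet> h j))" by (simp add: inner_sum_left)
    finally show ?thesis by (simp only: inner_commute[of _ "h j"])
  qed
  have "(\<Sum>i<n. \<Sum>j<n. c i * c j * ((h i \<bullet> h j) * M i j))
      = (\<Sum>i<n. \<Sum>j<n. \<Sum>e\<in>E. (c i * (h i \<bullet> e)) * (c j * (h j \<bullet> e)) * M i j)"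
    by (intro sum.cong refl) (simp add: hh sum_distrib_left sum_distrib_right mult_ac)
  also have "\<dots> = (\<Sum>i<n. \<Sum>e\<in>E. \<Sum>j<n. (c i * (h i \<bullet> e)) * (c j * (h j \<bullet> e)) * M i j)"
    by (intro sum.cong refl sum.swap)
  also have "\<dots> = (\<Sum>e\<in>E. \<Sum>i<n. \<Sum>j<n. (c i * (h i \<bullet> e)) * (c j * (h j \<bullet> e)) * M i j)"
    by (rule sum.swap)
  also have "\<dots> \<ge> 0" by (rule sum_nonneg) (rule M)
  finally show ?thesis .
qed

lemma tensor_gram_nonneg_aux:
  fixes hs :: "nat \<Rightarrow> 'h::real_inner list" and v :: "nat \<Rightarrow> 'v::real_inner"
  shows "0 \<le> (\<Sum>i<n. \<Sum>j<n. c i * c j * ((\<Prod>p<l. hs i ! p \<bullet> hs j ! p) * (v i \<bullet> v j)))"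
proof (induction l arbitrary: c)
  case 0
  have "(\<Sum>i<n. \<Sum>j<n. c i * c j * (v i \<bullet> v j))
      = (\<Sum>i<n. c i *\<^sub>R v i) \<bullet> (\<Sum>j<n. c j *\<^sub>R v j)"
    unfolding inner_sum_left
    by (intro sum.cong refl) (simp add: inner_sum_right sum_distrib_left mult_ac)
  then show ?case by simp
next
  case (Suc l)
  have "0 \<le> (\<Sum>i<n. \<Sum>j<n. c i * c j * ((hs i ! l \<bullet> hs j ! l) *
      ((\<Prod>p<l. hs i ! p \<bullet> hs j ! p) * (v i \<bullet> v j))))"
    by (rule schur_product_nonneg) (rule Suc.IH)
  then show ?case by (simp add: mult_ac)
qed

lemma tensor_gram_nonneg: "0 \<le> tensor_pairing xs (tensor_sum xs)"
proof -
  define n where "n = length xs"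
  define hs where "hs = (\<lambda>i. fst (xs ! i))"
  define v where "v = (\<lambda>i. snd (xs ! i))"
  define L where "L = (\<lambda>i. length (hs i)) ` {..<n}"
  let ?c = "\<lambda>l i. if length (hs i) = l then 1 else (0::real)"
  have "tensor_pairing xs (tensor_sum xs)
      = (\<Sum>i<n. v i \<bullet> (\<Sum>j<n. tensor_kernel (hs j) (hs i) *\<^sub>R v j))"
    by (simp add: tensor_pairing_def tensor_sum_def sum_list_sum_nth case_prod_unfold
        n_def hs_def v_def atLeast0LessThan)
  also have "\<dots> = (\<Sum>i<n. \<Sum>j<n. \<Sum>l\<in>L. ?c l i * ?c l j *
      ((\<Prod>p<l. hs i ! p \<bullet> hs j ! p) * (v i \<bullet> v j)))"
  proof -
    have "tensor_kernel (hs j) (hs i) * (v i \<bullet> v j) = (\<Sum>l\<in>L. ?c l i * ?c l j *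
      ((\<Prod>p<l. hs i ! p \<bullet> hs j ! p) * (v i \<bullet> v j)))" if "i < n" "j < n" for i j
    proof -
      have "(\<Sum>l\<in>L. ?c l i * ?c l j * ((\<Prod>p<l. hs i ! p \<bullet> hs j ! p) * (v i \<bullet> v j)))
          = (\<Sum>l\<in>L. if l = length (hs i) then tensor_kernel (hs j) (hs i) * (v i \<bullet> v j) else 0)"
        by (intro sum.cong refl) (auto simp: tensor_kernel_def inner_commute)
      also have "\<dots> = tensor_kernel (hs j) (hs i) * (v i \<bullet> v j)"
        using that by (simp add: L_def)
      finally show ?thesis by simp
    qed
    then show ?thesis by (simp add: inner_sum_right)
  qed
  also have "\<dots> = (\<Sum>i<n. \<Sum>l\<in>L. \<Sum>j<n. ?c l i * ?c l j *
      ((\<Prod>p<l. hs i ! p \<bullet> hs j ! p) * (v i \<bullet> v j)))"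
    by (intro sum.cong refl sum.swap)
  also have "\<dots> = (\<Sum>l\<in>L. \<Sum>i<n. \<Sum>j<n. ?c l i * ?c l j *
      ((\<Prod>p<l. hs i ! p \<bullet> hs j ! p) * (v i \<bullet> v j)))"
    by (rule sum.swap)
  also have "\<dots> \<ge> 0" by (rule sum_nonneg) (rule tensor_gram_nonneg_aux)
  finally show ?thesis .
qed

lemma tensor_gram_definite:
  assumes "tensor_pairing xs (tensor_sum xs) = 0"
  shows "tensor_sum xs gs = 0"
proof -
  define T where "T = tensor_sum xs"
  define a where "a = T gs \<bullet> T gs"
  define ys where "ys = [(gs, T gs)]"
  define b where "b = tensor_pairing ys (tensor_sum ys)"
  define r where "r = - a / (b + 1)"
  define zs where "zs = xs @ map (\<lambda>(hs, v). (hs, r *\<^sub>R v)) ys"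
  have b: "0 \<le> b" unfolding b_def by (rule tensor_gram_nonneg)
  have ap: "tensor_pairing (us @ ws) S = tensor_pairing us S + tensor_pairing ws S"
    for us ws and S :: "'a list \<Rightarrow> 'b" by (simp add: tensor_pairing_def)
  have sc: "tensor_pairing (map (\<lambda>(hs, v). (hs, r *\<^sub>R v)) ys) S = r * tensor_pairing ys S"
    for S :: "'a list \<Rightarrow> 'b" by (simp add: ys_def)
  have zs: "tensor_sum zs = (\<lambda>hs. tensor_sum xs hs + r *\<^sub>R tensor_sum ys hs)"
    by (simp add: fun_eq_iff zs_def tensor_sum_scaleR)
  have a: "tensor_pairing ys (tensor_sum xs) = a"
    by (simp add: ys_def a_def T_def)
  have "tensor_pairing zs (tensor_sum zs) = 2 * r * a + r * r * b"
    using assms a unfolding zs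
    by (simp add: zs_def ap sc tensor_pairing_add tensor_pairing_scaleR b_def
        tensor_pairing_commute[of xs ys] algebra_simps)
  then have "0 \<le> 2 * r * a + r * r * b"
    using tensor_gram_nonneg[of zs] by simp
  also have "2 * r * a + r * r * b = - (a\<^sup>2 * (b + 2)) / (b + 1)\<^sup>2"
  proof -
    have rb: "r * (b + 1) = - a" using b by (simp add: r_def)
    have "(2 * r * a + r * r * b) * (b + 1)\<^sup>2
        = 2 * a * (b + 1) * (r * (b + 1)) + b * (r * (b + 1))\<^sup>2"
      by (simp add: power2_eq_square algebra_simps)
    also have "\<dots> = - (a\<^sup>2 * (b + 2))"
      unfolding rb by (simp add: power2_eq_square algebra_simps)
    finally show ?thesis using b by (intro iffD2[OF eq_divide_eq]) simp
  qed
  finally have "a\<^sup>2 * (b + 2) \<le> 0" using b by (simp add: divide_le_0_iff zero_le_divide_iff)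
  moreover have "0 \<le> a\<^sup>2 * (b + 2)" using b by simp
  ultimately have "a = 0" using b by simp
  then show ?thesis by (simp add: a_def T_def)
qed

typedef (overloaded) ('h, 'v) tensor =
  "range (tensor_sum :: ('h::real_inner list \<times> 'v::real_inner) list \<Rightarrow> 'h list \<Rightarrow> 'v)"
  by blast

setup_lifting type_definition_tensor

lift_definition tens :: "'h::real_inner list \<Rightarrow> 'v::real_inner \<Rightarrow> ('h, 'v) tensor"
  is "\<lambda>hs v gs. tensor_kernel hs gs *\<^sub>R v"
proof -
  fix hs :: "'h list" and v :: 'v
  show "(\<lambda>gs. tensor_kernel hs gs *\<^sub>R v) \<in> range tensor_sum"
    by (intro range_eqI[of _ _ "[(hs, v)]"]) (simp add: fun_eq_iff)
qed

instantiation tensor :: (real_inner, real_inner) real_inner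
begin

lift_definition zero_tensor :: "('a, 'b) tensor" is "\<lambda>_. 0"
  by (rule range_eqI[of _ _ "[]"]) (simp add: fun_eq_iff)

lift_definition plus_tensor :: "('a, 'b) tensor \<Rightarrow> ('a, 'b) tensor \<Rightarrow> ('a, 'b) tensor"
  is "\<lambda>S T gs. S gs + T gs"
proof -
  fix S T :: "'a list \<Rightarrow> 'b"
  assume "S \<in> range tensor_sum" "T \<in> range tensor_sum"
  then obtain xs ys where "S = tensor_sum xs" "T = tensor_sum ys" by blast
  then show "(\<lambda>gs. S gs + T gs) \<in> range tensor_sum"
    by (intro range_eqI[of _ _ "xs @ ys"]) (simp add: fun_eq_iff)
qed

lift_definition scaleR_tensor :: "real \<Rightarrow> ('a, 'b) tensor \<Rightarrow> ('a, 'b) tensor"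
  is "\<lambda>r T gs. r *\<^sub>R T gs"
proof -
  fix r and T :: "'a list \<Rightarrow> 'b"
  assume "T \<in> range tensor_sum"
  then obtain xs where "T = tensor_sum xs" by blast
  then show "(\<lambda>gs. r *\<^sub>R T gs) \<in> range tensor_sum"
    by (intro range_eqI[of _ _ "map (\<lambda>(hs, v). (hs, r *\<^sub>R v)) xs"])
       (simp add: fun_eq_iff tensor_sum_scaleR)
qed

definition uminus_tensor :: "('a, 'b) tensor \<Rightarrow> ('a, 'b) tensor" where
  "uminus_tensor T = (- 1) *\<^sub>R T"

definition minus_tensor :: "('a, 'b) tensor \<Rightarrow> ('a, 'b) tensor \<Rightarrow> ('a, 'b) tensor" where
  "minus_tensor S T = S + - T"

lift_definition inner_tensor :: "('a, 'b) tensor \<Rightarrow> ('a, 'b) tensor \<Rightarrow> real"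
  is tensor_inner .

definition norm_tensor :: "('a, 'b) tensor \<Rightarrow> real" where
  "norm_tensor T = sqrt (T \<bullet> T)"

definition sgn_tensor :: "('a, 'b) tensor \<Rightarrow> ('a, 'b) tensor" where
  "sgn_tensor T = inverse (norm T) *\<^sub>R T"

definition dist_tensor :: "('a, 'b) tensor \<Rightarrow> ('a, 'b) tensor \<Rightarrow> real" where
  "dist_tensor S T = norm (S - T)"

definition uniformity_tensor :: "(('a, 'b) tensor \<times> ('a, 'b) tensor) filter" where
  "uniformity_tensor = (INF e\<in>{0<..}. principal {(x, y). dist x y < e})"

definition open_tensor :: "('a, 'b) tensor set \<Rightarrow> bool" where
  "open_tensor U \<longleftrightarrow> (\<forall>x\<in>U. \<forall>\<^sub>F (x', y) in uniformity. x' = x \<longrightarrow> y \<in> U)"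

instance
proof
  fix R S T :: "('a, 'b) tensor" and r s :: real
  show "R + S + T = R + (S + T)" by transfer (simp add: add.assoc)
  show "S + T = T + S" by transfer (simp add: add.commute)
  show "0 + T = T" by transfer simp
  show "- T + T = 0" unfolding uminus_tensor_def by transfer simp
  show "S - T = S + - T" by (rule minus_tensor_def)
  show "r *\<^sub>R (S + T) = r *\<^sub>R S + r *\<^sub>R T" by transfer (simp add: scaleR_add_right)
  show "(r + s) *\<^sub>R T = r *\<^sub>R T + s *\<^sub>R T" by transfer (simp add: scaleR_add_left)
  show "r *\<^sub>R s *\<^sub>R T = (r * s) *\<^sub>R T" by transfer simp
  show "1 *\<^sub>R T = T" by transfer simp
  show "dist S T = norm (S - T)" by (rule dist_tensor_def)
  show "sgn T = inverse (norm T) *\<^sub>R T" by (rule sgn_tensor_def)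
  show "(uniformity :: (('a, 'b) tensor \<times> ('a, 'b) tensor) filter)
      = (INF e\<in>{0<..}. principal {(x, y). dist x y < e})"
    by (rule uniformity_tensor_def)
  show "open U \<longleftrightarrow> (\<forall>x\<in>U. \<forall>\<^sub>F (x', y) in uniformity. x' = x \<longrightarrow> y \<in> U)"
    for U :: "('a, 'b) tensor set"
    by (rule open_tensor_def)
  show "norm T = sqrt (T \<bullet> T)" by (rule norm_tensor_def)
  show comm: "S \<bullet> T = T \<bullet> S" for S T :: "('a, 'b) tensor"
    by transfer (auto simp: tensor_inner_sum intro: tensor_pairing_commute)
  have "R \<bullet> (S + T) = R \<bullet> S + R \<bullet> T"
    by transfer (auto simp: tensor_inner_def tensor_pairing_add)
  then show "(S + T) \<bullet> R = S \<bullet> R + T \<bullet> R" by (simp add: comm)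
  have "S \<bullet> (r *\<^sub>R T) = r * (S \<bullet> T)"
    by transfer (auto simp: tensor_inner_def tensor_pairing_scaleR)
  then show "(r *\<^sub>R T) \<bullet> S = r * (T \<bullet> S)" by (simp add: comm)
  show "0 \<le> T \<bullet> T"
    by transfer (auto simp: tensor_inner_sum tensor_gram_nonneg)
  show "T \<bullet> T = 0 \<longleftrightarrow> T = 0"
  proof
    show "T \<bullet> T = 0 \<Longrightarrow> T = 0"
      by transfer (auto simp: tensor_inner_sum fun_eq_iff dest: tensor_gram_definite)
    show "T = 0 \<Longrightarrow> T \<bullet> T = 0"
      by transfer (auto simp: tensor_inner_def tensor_pairing_zero)
  qed
qed

end

lemma inner_tens:
  "tens hs v \<bullet> tens gs w =
     (if length hs = length gs then (\<Prod>p<length hs. hs ! p \<bullet> gs ! p) * (v \<bullet> w) else 0)"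
proof -
  have single: "(\<lambda>gs. tensor_kernel hs gs *\<^sub>R v) = tensor_sum [(hs, v)]"
    for hs :: "'a list" and v :: 'b
    by (simp add: fun_eq_iff)
  have "tens hs v \<bullet> tens gs w = tensor_kernel gs hs * (v \<bullet> w)"
    by transfer (simp add: single tensor_inner_sum)
  then show ?thesis by (auto simp: tensor_kernel_def inner_commute)
qed


section \<open>Isonormal Gaussian processes\<close>

definition (in prob_space) centered_gaussian :: "('a \<Rightarrow> real) \<Rightarrow> bool" where
  "centered_gaussian X \<longleftrightarrow> random_variable borel X \<and>
     ((AE \<omega> in M. X \<omega> = 0) \<or> (\<exists>\<sigma>>0. distributed M lborel X (normal_density 0 \<sigma>)))"

locale isonormal_process = prob_space M
  for M :: "'a measure" +
  fixes W :: "'h::{real_inner, polish_space} \<Rightarrow> 'a \<Rightarrow> real"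
  assumes gaussian_family:
      "finite A \<Longrightarrow> centered_gaussian (\<lambda>\<omega>. \<Sum>h\<in>A. c h * W h \<omega>)"
    and covariance: "expectation (\<lambda>\<omega>. W h \<omega> * W g \<omega>) = h \<bullet> g"
    and generated:
      "sets M = sigma_sets (space M) {W h -` B \<inter> space M | h B. B \<in> sets borel}"


section \<open>Smooth random variables and their Malliavin derivatives\<close>

text \<open>
  A function on \<open>\<real>\<^sup>m\<close> is a function of \<open>x :: nat \<Rightarrow> real\<close> depending on \<open>x 0, ..., x (m - 1)\<close> only.
  For such functions, continuity in the product topology of \<open>nat \<Rightarrow> real\<close> is continuity
  on \<open>\<real>\<^sup>m\<close>.
\<close>

definition pdiff :: "nat \<Rightarrow> ((nat \<Rightarrow> real) \<Rightarrow> real) \<Rightarrow> (nat \<Rightarrow> real) \<Rightarrow> real" where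
  "pdiff i f x = deriv (\<lambda>t. f (x(i := t))) (x i)"

definition pdiffs :: "nat list \<Rightarrow> ((nat \<Rightarrow> real) \<Rightarrow> real) \<Rightarrow> (nat \<Rightarrow> real) \<Rightarrow> real" where
  "pdiffs is f = foldr pdiff is f"

definition depends_on_first :: "nat \<Rightarrow> ((nat \<Rightarrow> real) \<Rightarrow> real) \<Rightarrow> bool" where
  "depends_on_first m f \<longleftrightarrow> (\<forall>x y. (\<forall>i<m. x i = y i) \<longrightarrow> f x = f y)"

definition poly_growth :: "nat \<Rightarrow> ((nat \<Rightarrow> real) \<Rightarrow> real) \<Rightarrow> bool" where
  "poly_growth m f \<longleftrightarrow> (\<exists>C N. \<forall>x. \<bar>f x\<bar> \<le> C * (1 + L2_set x {..<m}) ^ N)"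

text \<open>
  \<open>C\<^sup>\<infinity>\<close> means that the partial derivatives of all orders exist and are continuous. The
  constants in the growth condition may depend on the derivative. The case \<open>is = []\<close> is
  the condition on \<open>f\<close> itself.
\<close>

definition smooth_poly_growth :: "nat \<Rightarrow> ((nat \<Rightarrow> real) \<Rightarrow> real) \<Rightarrow> bool" where
  "smooth_poly_growth m f \<longleftrightarrow> depends_on_first m f \<and>
     (\<forall>is. set is \<subseteq> {..<m} \<longrightarrow>
        continuous_on UNIV (pdiffs is f) \<and>
        (\<forall>i<m. \<forall>x. (\<lambda>t. pdiffs is f (x(i := t))) differentiable (at (x i))) \<and>
        poly_growth m (pdiffs is f))"

definition cyl_derivative ::
    "('h::real_inner \<Rightarrow> 'a \<Rightarrow> real) \<Rightarrow> nat \<Rightarrow> (nat \<Rightarrow> 'h) \<Rightarrow> ((nat \<Rightarrow> real) \<Rightarrow> real) \<Rightarrow>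
     'v::real_inner \<Rightarrow> nat \<Rightarrow> 'a \<Rightarrow> ('h, 'v) tensor" where
  "cyl_derivative W m h f v k \<omega> =
     (\<Sum>is\<in>{is. length is = k \<and> set is \<subseteq> {..<m}}.
        pdiffs is f (\<lambda>i. W (h i) \<omega>) *\<^sub>R tens (map h is) v)"

text \<open>
  \<open>smooth_with_derivatives M W F D\<close>: \<open>F\<close> is a smooth \<open>V\<close>-valued random variable and \<open>D k\<close>,
  for \<open>k \<ge> 1\<close>, is its \<open>k\<close>-th Malliavin derivative, computed from some representation
  \<open>F = \<Sum>\<^sub>j f\<^sub>j(W(h\<^sub>j\<^sub>0), ..., W(h\<^sub>j\<^sub>,\<^sub>m\<^sub>j\<^sub>-\<^sub>1)) v\<^sub>j\<close>. A statement about all such \<open>D\<close> covers every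
  representation of \<open>F\<close>.
\<close>

definition smooth_with_derivatives ::
    "'a measure \<Rightarrow> ('h::real_inner \<Rightarrow> 'a \<Rightarrow> real) \<Rightarrow> ('a \<Rightarrow> 'v::real_inner) \<Rightarrow>
     (nat \<Rightarrow> 'a \<Rightarrow> ('h, 'v) tensor) \<Rightarrow> bool" where
  "smooth_with_derivatives M W F D \<longleftrightarrow>
     (\<exists>(J::nat) m h f v. J \<ge> 1 \<and>
        (\<forall>j<J. m j \<ge> 1 \<and> smooth_poly_growth (m j) (f j)) \<and>
        (\<forall>\<omega>\<in>space M. F \<omega> = (\<Sum>j<J. f j (\<lambda>i. W (h j i) \<omega>) *\<^sub>R v j)) \<and>
        (\<forall>k\<ge>1. \<forall>\<omega>\<in>space M. D k \<omega> = (\<Sum>j<J. cyl_derivative W (m j) (h j) (f j) (v j) k \<omega>)))"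


section \<open>Norms and constants\<close>

definition Lq_norm :: "'a measure \<Rightarrow> real \<Rightarrow> ('a \<Rightarrow> 'b::real_normed_vector) \<Rightarrow> real" where
  "Lq_norm M q G = (\<integral>\<omega>. norm (G \<omega>) powr q \<partial>M) powr (1 / q)"

definition graph_norm ::
    "'a measure \<Rightarrow> nat \<Rightarrow> real \<Rightarrow> ('a \<Rightarrow> 'v::real_inner) \<Rightarrow>
     (nat \<Rightarrow> 'a \<Rightarrow> ('h::real_inner, 'v) tensor) \<Rightarrow> real" where
  "graph_norm M k q F D = Lq_norm M q F + Lq_norm M q (D k)"

definition sobolev_norm ::
    "'a measure \<Rightarrow> nat \<Rightarrow> real \<Rightarrow> ('a \<Rightarrow> 'v::real_inner) \<Rightarrow>
     (nat \<Rightarrow> 'a \<Rightarrow> ('h::real_inner, 'v) tensor) \<Rightarrow> real" where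
  "sobolev_norm M k q F D =
     (Lq_norm M q F powr q + (\<Sum>l=1..k. Lq_norm M q (D l) powr q)) powr (1 / q)"

definition c_const :: "real \<Rightarrow> real" where
  "c_const q = (if q \<ge> 2 then sqrt (q - 1) else pi / 2)"

definition conj_exponent :: "real \<Rightarrow> real" where
  "conj_exponent q = q / (q - 1)"

definition d_const :: "nat \<Rightarrow> real \<Rightarrow> real" where
  "d_const l q = (if q \<ge> 2 then sqrt (fact l)
     else sqrt (fact l) * (conj_exponent q - 1) powr (real l / 2))"

definition tau_const :: "nat \<Rightarrow> real \<Rightarrow> real" where
  "tau_const k q = (\<Prod>l=1..k-1. 1 + max (d_const l q) (c_const q))"

end

theory Submission
  imports Defs
begin

text \<open>
  The derivatives of order strictly between \<open>0\<close> and \<open>k\<close> are interpolated one order at a time. For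
  \<open>1 \<le> l < k\<close>, split \<open>D\<^sup>l F\<close> into its expectation and the remainder. The remainder satisfies the
  Poincare inequality \<open>\<parallel>D\<^sup>l F - E D\<^sup>l F\<parallel>\<^sub>q \<le> c\<^sub>q \<parallel>D\<^bsup>l+1\<^esup> F\<parallel>\<^sub>q\<close> (\<open>poincare\<close>), and the expectation is controlled
  by \<open>F\<close> itself, \<open>\<bar>E D\<^sup>l F\<bar> \<le> d\<^sub>l\<^sub>,\<^sub>q \<parallel>F\<parallel>\<^sub>q\<close> (\<open>expectation_derivative_bound\<close>). Hence
  \<open>\<parallel>D\<^sup>l F\<parallel>\<^sub>q \<le> c\<^sub>q \<parallel>D\<^bsup>l+1\<^esup> F\<parallel>\<^sub>q + d\<^sub>l\<^sub>,\<^sub>q \<parallel>F\<parallel>\<^sub>q\<close>, and each use of this inequality costs one factor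
  \<open>1 + max {d\<^sub>l\<^sub>,\<^sub>q, c\<^sub>q}\<close> of \<open>\<tau>\<close> (\<open>interpolation_chain\<close>). The lower bound is convexity of \<open>t \<mapsto> t\<^sup>q\<close>.

  All estimates are made on Gaussian space. A representation of \<open>F\<close> involves finitely many vectors of
  \<open>H\<close> and \<open>V\<close>. In orthonormal bases \<open>e\<^sub>0, ..., e\<^bsub>n-1\<^esub>\<close> and \<open>B\<close> of their spans, the variables \<open>W(e\<^sub>k)\<close> are
  independent standard normal and the coordinates of \<open>F\<close> and of its derivatives are the functions
  \<open>u b is\<close> of these variables, where \<open>u b (i # is) = \<partial>\<^sub>i (u b is)\<close>. The norm of \<open>D\<^sup>l F\<close> is the Euclidean norm
  of the family \<open>u b is\<close> with \<open>is\<close> of length \<open>l\<close> (\<open>smooth_on_gaussian_space\<close>). It therefore suffices to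
  bound Euclidean norms of families of functions, with constants that depend neither on the number of
  variables nor on the size of the family.

  For the Poincare inequality, let \<open>x\<close> and \<open>y\<close> be independent standard Gaussian vectors. The vector
  \<open>x\<^sub>\<theta> = sin \<theta> x + cos \<theta> y\<close> and its derivative \<open>y\<^sub>\<theta> = cos \<theta> x - sin \<theta> y\<close> are again independent and standard,
  and \<open>f(x) - f(y)\<close> is the integral of \<open>\<nabla>f(x\<^sub>\<theta>) \<cdot> y\<^sub>\<theta>\<close> over \<open>0 \<le> \<theta> \<le> \<pi>/2\<close> (\<open>rotation_formula\<close>). This is tested
  against \<open>\<bar>z\<bar>\<^bsup>q-2\<^esup> z\<close> with \<open>z = f - E f\<close>. If \<open>q < 2\<close>, Hoelder's inequality applies, because given \<open>x\<close> the
  Gaussian vector \<open>\<nabla>f(x) \<cdot> y\<close> has a \<open>q\<close>-th moment of at most \<open>\<bar>\<nabla>f(x)\<bar>\<^sup>q\<close>; the factor \<open>\<pi>/2\<close> is the length of the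
  interval. If \<open>q \<ge> 2\<close>, integration by parts in \<open>y\<^sub>\<theta>\<close> moves a derivative onto the test function. It produces
  the factor \<open>cos \<theta>\<close>, with integral \<open>1\<close>, and the bound \<open>\<bar>\<nabla>(\<bar>z\<bar>\<^bsup>q-2\<^esup> z)\<bar> \<le> (q - 1) \<bar>z\<bar>\<^bsup>q-2\<^esup> \<bar>\<nabla>z\<bar>\<close> leads to \<open>\<surd>(q - 1)\<close>.

  For the expectation \<open>T = E D\<^sup>l F\<close>, duality gives \<open>\<bar>T\<bar>\<^sup>2 = E \<langle>F, I\<^sub>l(T)\<rangle>\<close>, where \<open>I\<^sub>l\<close> is the multiple
  Wiener integral, so that \<open>\<parallel>I\<^sub>l(T)\<parallel>\<^sub>p\<close> is needed for the conjugate exponent \<open>p\<close> if \<open>q < 2\<close>, and for \<open>p = 2\<close> if \<open>q \<ge> 2\<close>. Since \<open>I\<^sub>j\<close> is an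
  eigenfunction of the Ornstein-Uhlenbeck operator with eigenvalue \<open>-j\<close> and \<open>D I\<^sub>j = j I\<^bsub>j-1\<^esub>\<close>, an
  integration by parts in \<open>E \<bar>I\<^sub>j\<bar>\<^sup>p\<close> gives \<open>\<parallel>I\<^sub>j\<parallel>\<^sub>p \<le> \<surd>((p - 1) j) \<parallel>I\<^bsub>j-1\<^esub>\<parallel>\<^sub>p\<close> for \<open>p \<ge> 2\<close> (\<open>chaos_norm_step\<close>).
  Iterating this inequality yields \<open>\<surd>(l!) (p - 1)\<^bsup>l/2\<^esup> \<bar>T\<bar>\<close>, the bound that hypercontractivity would give.
\<close>

section \<open>The standard Gaussian measure on sequences\<close>

text \<open>
  The law of an infinite sequence of independent standard normal variables. Points are total
  functions, so that functions of finitely many coordinates, their partial derivatives and an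
  independent copy of the first \<open>n\<close> coordinates (the next \<open>n\<close>) live on one space.
\<close>

definition gauss :: "(nat \<Rightarrow> real) measure" where
  "gauss = (\<Pi>\<^sub>M i\<in>UNIV. std_normal_distribution)"

interpretation std_normal: real_distribution std_normal_distribution
  by (rule real_dist_normal_dist)

interpretation gauss_product: product_prob_space "\<lambda>_::nat. std_normal_distribution" UNIV
  by unfold_locales

interpretation gauss: prob_space gauss
  unfolding gauss_def by unfold_locales

lemma sets_gauss [measurable_cong, simp]: "sets gauss = sets borel"
proof -
  have "sets gauss = sets (\<Pi>\<^sub>M i\<in>(UNIV::nat set). (borel::real measure))"
    unfolding gauss_def by (intro sets_PiM_cong) auto
  then show ?thesis by (simp only: sets_PiM_equal_borel)
qed

lemma space_gauss [simp]: "space gauss = UNIV"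
  using sets_eq_imp_space_eq[OF sets_gauss] by simp

lemma borel_measurable_coordinate [measurable]:
  "(\<lambda>x::nat \<Rightarrow> real. x i) \<in> borel_measurable borel"
  by (intro borel_measurable_continuous_onI continuous_on_product_coordinates)

lemma gauss_component: "distr gauss borel (\<lambda>x. x i) = std_normal_distribution"
proof -
  have "distr gauss borel (\<lambda>x. x i) = distr gauss std_normal_distribution (\<lambda>x. x i)"
    by (rule distr_cong) auto
  then show ?thesis unfolding gauss_def using gauss_product.PiM_component[of i] by simp
qed

lemma borel_measurable_fun_upd:
  "(\<lambda>(t, x). x(i := t)) \<in> borel \<Otimes>\<^sub>M borel \<rightarrow>\<^sub>M (borel :: (nat \<Rightarrow> real) measure)"
proof (rule measurable_coordinatewise_then_product)
  fix j
  show "(\<lambda>p. (case p of (t, x) \<Rightarrow> x(i := t)) j) \<in> borel_measurable (borel \<Otimes>\<^sub>M (borel :: (nat \<Rightarrow> real) measure))"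
    by (cases "i = j") (auto simp: case_prod_unfold)
qed

text \<open>
  Replacing one coordinate by an independent normal variable does not change the law. This
  is how one-dimensional facts enter: they are applied in a single coordinate, by Fubini.
\<close>

lemma gauss_resample:
  "distr (std_normal_distribution \<Otimes>\<^sub>M gauss) gauss (\<lambda>(t, x). x(i := t)) = gauss"
proof -
  have "insert i UNIV = (UNIV :: nat set)" by simp
  then show ?thesis
    using distr_pair_PiM_eq_PiM[of UNIV "\<lambda>_. std_normal_distribution" i]
      std_normal.prob_space_axioms by (simp only: gauss_def)
qed

section \<open>Functions of polynomial growth\<close>

text \<open>
  Polynomial growth makes every expectation below finite, and dependence on the first \<open>n\<close>
  coordinates allows expectations to be transferred from one Gaussian vector to another.
\<close>

definition tame :: "nat \<Rightarrow> ((nat \<Rightarrow> real) \<Rightarrow> real) \<Rightarrow> bool" where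
  "tame n f \<longleftrightarrow> f \<in> borel_measurable borel \<and> depends_on_first n f \<and> poly_growth n f"

lemma tame_measurable: "tame n f \<Longrightarrow> f \<in> borel_measurable borel"
  by (simp add: tame_def)

lemma poly_growthI:
  assumes "\<And>x. \<bar>f x\<bar> \<le> C * (1 + L2_set x {..<n}) ^ N"
  shows "poly_growth n f"
  using assms unfolding poly_growth_def by blast

lemma poly_growthE:
  assumes "poly_growth n f"
  obtains C N where "C \<ge> 0" "\<And>x. \<bar>f x\<bar> \<le> C * (1 + L2_set x {..<n}) ^ N"
proof -
  obtain C N where C: "\<And>x. \<bar>f x\<bar> \<le> C * (1 + L2_set x {..<n}) ^ N"
    using assms unfolding poly_growth_def by blast
  have "0 \<le> \<bar>f (\<lambda>_. 0)\<bar>" by simp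
  also have "\<dots> \<le> C" using C[of "\<lambda>_. 0"] by (simp add: L2_set_def)
  finally show thesis using that C by blast
qed

lemma poly_growth_add:
  assumes "poly_growth n f" "poly_growth n g"
  shows "poly_growth n (\<lambda>x. f x + g x)"
proof -
  obtain C N where f: "C \<ge> 0" "\<And>x. \<bar>f x\<bar> \<le> C * (1 + L2_set x {..<n}) ^ N"
    using assms(1) by (rule poly_growthE) blast
  obtain C' N' where g: "C' \<ge> 0" "\<And>x. \<bar>g x\<bar> \<le> C' * (1 + L2_set x {..<n}) ^ N'"
    using assms(2) by (rule poly_growthE) blast
  have "\<bar>f x + g x\<bar> \<le> (C + C') * (1 + L2_set x {..<n}) ^ (max N N')" for x
  proof -
    have *: "(1 + L2_set x {..<n}) ^ k \<le> (1 + L2_set x {..<n}) ^ (max N N')" if "k \<le> max N N'" for k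
      using that by (intro power_increasing) auto
    have "\<bar>f x + g x\<bar> \<le> \<bar>f x\<bar> + \<bar>g x\<bar>" by simp
    also have "\<dots> \<le> C * (1 + L2_set x {..<n}) ^ N + C' * (1 + L2_set x {..<n}) ^ N'"
      by (intro add_mono f g)
    also have "\<dots> \<le> C * (1 + L2_set x {..<n}) ^ (max N N') + C' * (1 + L2_set x {..<n}) ^ (max N N')"
      using * f(1) g(1) by (intro add_mono mult_left_mono) auto
    finally show ?thesis by (simp add: algebra_simps)
  qed
  then show ?thesis by (rule poly_growthI)
qed

lemma poly_growth_mult:
  assumes "poly_growth n f" "poly_growth n g"
  shows "poly_growth n (\<lambda>x. f x * g x)"
proof -
  obtain C N where f: "C \<ge> 0" "\<And>x. \<bar>f x\<bar> \<le> C * (1 + L2_set x {..<n}) ^ N"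
    using assms(1) by (rule poly_growthE) blast
  obtain C' N' where g: "C' \<ge> 0" "\<And>x. \<bar>g x\<bar> \<le> C' * (1 + L2_set x {..<n}) ^ N'"
    using assms(2) by (rule poly_growthE) blast
  have "\<bar>f x * g x\<bar> \<le> (C * C') * (1 + L2_set x {..<n}) ^ (N + N')" for x
  proof -
    have "\<bar>f x * g x\<bar> \<le> (C * (1 + L2_set x {..<n}) ^ N) * (C' * (1 + L2_set x {..<n}) ^ N')"
      unfolding abs_mult using f g by (intro mult_mono) auto
    then show ?thesis by (simp add: algebra_simps power_add)
  qed
  then show ?thesis by (rule poly_growthI)
qed

lemma poly_growth_bound:
  assumes "poly_growth n f" "\<And>x. \<bar>g x\<bar> \<le> \<bar>f x\<bar>"
  shows "poly_growth n g"
  using assms unfolding poly_growth_def by (meson order_trans)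

lemma poly_growth_const: "poly_growth n (\<lambda>_. c)"
  by (rule poly_growthI[of _ "\<bar>c\<bar>" _ 0]) simp

lemma abs_coordinate_le_L2_set: "i < m \<Longrightarrow> \<bar>x i\<bar> \<le> 1 + L2_set x {..<m}" for x :: "nat \<Rightarrow> real"
proof -
  assume "i < m"
  then have "\<bar>x i\<bar> \<le> L2_set (\<lambda>i. \<bar>x i\<bar>) {..<m}"
    using member_le_L2_set[OF finite_lessThan, of i m "\<lambda>i. \<bar>x i\<bar>"] by simp
  also have "\<dots> = L2_set x {..<m}" by (simp add: L2_set_def)
  finally show ?thesis by simp
qed

lemma poly_growth_coordinate: "i < n \<Longrightarrow> poly_growth n (\<lambda>x. x i)"
  by (rule poly_growthI[of _ 1 _ 1]) (use abs_coordinate_le_L2_set in simp)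

lemma poly_growth_mono: 
  assumes "poly_growth m f" "m \<le> n" shows "poly_growth n f"
proof -
  obtain C N where f: "C \<ge> 0" "\<And>x. \<bar>f x\<bar> \<le> C * (1 + L2_set x {..<m}) ^ N"
    using assms(1) by (rule poly_growthE) blast
  have "L2_set x {..<m} \<le> L2_set x {..<n}" for x :: "nat \<Rightarrow> real"
    unfolding L2_set_def using assms(2) by (intro real_sqrt_le_mono sum_mono2) auto
  then have "C * (1 + L2_set x {..<m}) ^ N \<le> C * (1 + L2_set x {..<n}) ^ N" for x
    using f(1) by (intro mult_left_mono power_mono) auto
  then show ?thesis using f(2) by (meson poly_growthI order_trans)
qed

lemma poly_growth_powr:
  assumes "poly_growth n f" "p \<ge> 0"
  shows "poly_growth n (\<lambda>x. \<bar>f x\<bar> powr p)"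
proof -
  obtain C N where f: "C \<ge> 0" "\<And>x. \<bar>f x\<bar> \<le> C * (1 + L2_set x {..<n}) ^ N"
    using assms(1) by (rule poly_growthE) blast
  have "\<bar>\<bar>f x\<bar> powr p\<bar> \<le> C powr p * (1 + L2_set x {..<n}) ^ (N * nat \<lceil>p\<rceil>)" for x
  proof -
    have pos: "1 \<le> 1 + L2_set x {..<n}" by simp
    have "\<bar>f x\<bar> powr p \<le> (C * (1 + L2_set x {..<n}) ^ N) powr p"
      using f assms(2) by (intro powr_mono2) auto
    also have "\<dots> = C powr p * ((1 + L2_set x {..<n}) ^ N) powr p"
      using f(1) pos by (intro powr_mult)
    also have "\<dots> \<le> C powr p * ((1 + L2_set x {..<n}) ^ N) powr (real (nat \<lceil>p\<rceil>))"
      using assms(2) pos by (intro mult_left_mono powr_mono) (auto simp: one_le_power)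
    also have "((1 + L2_set x {..<n}) ^ N) powr (real (nat \<lceil>p\<rceil>)) = (1 + L2_set x {..<n}) ^ (N * nat \<lceil>p\<rceil>)"
      using pos by (subst powr_realpow) (auto simp: power_mult add_pos_nonneg)
    finally show ?thesis by simp
  qed
  then show ?thesis by (rule poly_growthI)
qed

lemma tame_mono: "tame m f \<Longrightarrow> m \<le> n \<Longrightarrow> tame n f"
  unfolding tame_def depends_on_first_def by (meson poly_growth_mono less_le_trans)

lemma tame_const [simp]: "tame n (\<lambda>_. c)"
  by (simp add: tame_def depends_on_first_def poly_growth_const)

lemma tame_coordinate [simp]: "i < n \<Longrightarrow> tame n (\<lambda>x. x i)"
  by (simp add: tame_def depends_on_first_def poly_growth_coordinate)

lemma tame_add: "tame n f \<Longrightarrow> tame n g \<Longrightarrow> tame n (\<lambda>x. f x + g x)"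
  unfolding tame_def depends_on_first_def by (auto intro!: poly_growth_add) metis

lemma tame_mult: "tame n f \<Longrightarrow> tame n g \<Longrightarrow> tame n (\<lambda>x. f x * g x)"
  unfolding tame_def depends_on_first_def by (auto intro!: poly_growth_mult) metis

lemma tame_cmult: "tame n f \<Longrightarrow> tame n (\<lambda>x. c * f x)"
  by (rule tame_mult) auto

lemma tame_uminus: "tame n f \<Longrightarrow> tame n (\<lambda>x. - f x)"
  using tame_cmult[of n f "-1"] by simp

lemma tame_diff: "tame n f \<Longrightarrow> tame n g \<Longrightarrow> tame n (\<lambda>x. f x - g x)"
  using tame_add[of n f "\<lambda>x. - g x"] tame_uminus[of n g] by simp

lemma tame_sum: "(\<And>i. i \<in> I \<Longrightarrow> tame n (f i)) \<Longrightarrow> tame n (\<lambda>x. \<Sum>i\<in>I. f i x)"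
  by (induction I rule: infinite_finite_induct) (auto intro: tame_add)

lemma tame_power: "tame n f \<Longrightarrow> tame n (\<lambda>x. f x ^ k)"
  by (induction k) (auto intro: tame_mult)

lemma tame_abs_powr: "tame n f \<Longrightarrow> p \<ge> 0 \<Longrightarrow> tame n (\<lambda>x. \<bar>f x\<bar> powr p)"
  unfolding tame_def depends_on_first_def by (auto intro!: poly_growth_powr) metis

lemma tame_powr: "tame n f \<Longrightarrow> p \<ge> 0 \<Longrightarrow> (\<And>x. f x \<ge> 0) \<Longrightarrow> tame n (\<lambda>x. f x powr p)"
  using tame_abs_powr[of n f p] by simp

text \<open>
  Negative powers of norms are not of polynomial growth; the products in which they occur
  below are, because they are dominated by tame functions.
\<close>

lemma tame_bound:
  assumes "tame n f" "g \<in> borel_measurable borel" "depends_on_first n g" "\<And>x. \<bar>g x\<bar> \<le> \<bar>f x\<bar>"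
  shows "tame n g"
  using assms unfolding tame_def by (meson poly_growth_bound)

lemma tame_L2_set:
  assumes "\<And>a. a \<in> A \<Longrightarrow> tame n (f a)"
  shows "tame n (\<lambda>x. L2_set (\<lambda>a. f a x) A)"
proof -
  have "L2_set (\<lambda>a. f a x) A = (\<Sum>a\<in>A. (f a x)\<^sup>2) powr (1/2)" for x
    unfolding L2_set_def by (rule powr_half_sqrt[symmetric]) (simp add: sum_nonneg)
  moreover have "tame n (\<lambda>x. (\<Sum>a\<in>A. (f a x)\<^sup>2) powr (1/2))"
    by (rule tame_powr[OF tame_sum[OF tame_power[OF assms]]]) (auto simp: sum_nonneg)
  ultimately show ?thesis by simp
qed

lemma integrable_std_normal_power: "integrable std_normal_distribution (\<lambda>t. \<bar>t\<bar> ^ k)"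
  using integrable_std_normal_moment_abs[of k]
  by (subst integrable_density) auto

lemma tame_integrable:
  assumes "tame n f" shows "integrable gauss f"
proof -
  obtain C N where f: "C \<ge> 0" "\<And>x. \<bar>f x\<bar> \<le> C * (1 + L2_set x {..<n}) ^ N"
    by (rule poly_growthE[of n f]) (use assms in \<open>auto simp: tame_def\<close>)
  have [measurable]: "f \<in> borel_measurable borel" using assms by (simp add: tame_def)
  have int: "integrable gauss (\<lambda>x. \<bar>x i\<bar> ^ N)" for i
  proof -
    have "integrable (distr gauss borel (\<lambda>x. x i)) (\<lambda>t. \<bar>t\<bar> ^ N)"
      unfolding gauss_component by (rule integrable_std_normal_power)
    then show ?thesis by (subst (asm) integrable_distr_eq) auto
  qed
  have bound: "(1 + L2_set x {..<n}) ^ N \<le> (real n + 1) ^ N * (1 + (\<Sum>i<n. \<bar>x i\<bar> ^ N))" for x :: "nat \<Rightarrow> real"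
  proof -
    define m where "m = Max (insert 1 ((\<lambda>i. \<bar>x i\<bar>) ` {..<n}))"
    have m: "1 \<le> m" "\<And>i. i < n \<Longrightarrow> \<bar>x i\<bar> \<le> m" unfolding m_def by auto
    have "1 + L2_set x {..<n} \<le> 1 + (\<Sum>i<n. \<bar>x i\<bar>)" by (simp add: L2_set_le_sum_abs)
    also have "\<dots> \<le> m + (\<Sum>i<n. m)" using m by (intro add_mono sum_mono) auto
    also have "\<dots> = (real n + 1) * m" by (simp add: algebra_simps)
    finally have "(1 + L2_set x {..<n}) ^ N \<le> ((real n + 1) * m) ^ N" by (intro power_mono) auto
    also have "\<dots> = (real n + 1) ^ N * m ^ N" by (simp add: power_mult_distrib)
    also have "m ^ N \<le> 1 + (\<Sum>i<n. \<bar>x i\<bar> ^ N)"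
    proof -
      have "m \<in> insert 1 ((\<lambda>i. \<bar>x i\<bar>) ` {..<n})" unfolding m_def by (intro Max_in) auto
      then consider "m = 1" | i where "i < n" "m = \<bar>x i\<bar>" by auto
      then show ?thesis
      proof cases
        case 1 then show ?thesis by (simp add: sum_nonneg)
      next
        case 2
        then have "m ^ N \<le> (\<Sum>i<n. \<bar>x i\<bar> ^ N)" 
          using member_le_sum[of i "{..<n}" "\<lambda>i. \<bar>x i\<bar> ^ N"] by simp
        then show ?thesis by simp
      qed
    qed
    finally show ?thesis by (simp add: mult_left_mono)
  qed
  show ?thesis
  proof (rule Bochner_Integration.integrable_bound)
    show "integrable gauss (\<lambda>x. C * ((real n + 1) ^ N * (1 + (\<Sum>i<n. \<bar>x i\<bar> ^ N))))"
      using int by (intro integrable_mult_right Bochner_Integration.integrable_add Bochner_Integration.integrable_sum) auto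
    have "\<bar>f x\<bar> \<le> \<bar>C * ((real n + 1) ^ N * (1 + (\<Sum>i<n. \<bar>x i\<bar> ^ N)))\<bar>" for x
      by (rule order_trans[OF order_trans[OF f(2) mult_left_mono[OF bound f(1)]] abs_ge_self])
    then show "AE x in gauss. norm (f x) \<le> norm (C * ((real n + 1) ^ N * (1 + (\<Sum>i<n. \<bar>x i\<bar> ^ N))))"
      by simp
  qed simp
qed

section \<open>Uniqueness of the standard Gaussian law\<close>

text \<open>
  If the weighted characteristic function of \<open>Z\<close> is a multiple of its characteristic function,
  then \<open>Z\<close> is independent of the weight, as far as expectations are concerned: the measure with density
  proportional to \<open>2 + a\<close> is positive, and by the uniqueness theorem \<open>Z\<close> has the same law under it.
\<close>

lemma (in prob_space) weighted_law_of_char: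
  fixes Z a :: "'a \<Rightarrow> real"
  assumes [measurable]: "random_variable borel Z" "random_variable borel a"
    and N: "real_distribution N" and Z: "distr M borel Z = N"
    and a: "\<And>\<omega>. \<omega> \<in> space M \<Longrightarrow> \<bar>a \<omega>\<bar> \<le> 1"
    and char: "\<And>t. (CLINT \<omega>|M. iexp (t * Z \<omega>) * a \<omega>) = char N t * of_real \<kappa>"
    and A: "A \<in> sets borel"
  shows "(\<integral>\<omega>. indicator A (Z \<omega>) * a \<omega> \<partial>M) = measure N A * \<kappa>"
proof -
  interpret N: real_distribution N by (rule N)
  have int_a: "integrable M a"
    by (rule integrable_const_bound[where B=1]) (use a in auto)
  have int_i: "integrable M (\<lambda>\<omega>. iexp (t * Z \<omega>) * complex_of_real (a \<omega>))" for t
    by (rule integrable_const_bound[where B=1]) (use a in \<open>auto simp: norm_mult\<close>)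
  have int_e: "integrable M (\<lambda>\<omega>. iexp (t * Z \<omega>))" for t
    by (rule integrable_const_bound[where B=1]) auto
  have charZ: "(CLINT \<omega>|M. iexp (t * Z \<omega>)) = char N t" for t
    unfolding Z[symmetric] char_def by (subst integral_distr) auto
  have Ea: "expectation a = \<kappa>"
  proof -
    have "of_real (expectation a) = (CLINT \<omega>|M. complex_of_real (a \<omega>))" by simp
    also have "\<dots> = of_real \<kappa>" using char[of 0] by (simp add: N.char_zero)
    finally show ?thesis by simp
  qed
  have \<kappa>: "\<kappa> \<ge> -1"
  proof -
    have "expectation (\<lambda>\<omega>. -1) \<le> expectation a"
    proof (rule integral_mono)
      show "- 1 \<le> a \<omega>" if "\<omega> \<in> space M" for \<omega> using a[OF that] by (simp add: abs_le_iff)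
    qed (use int_a in auto)
    then show ?thesis by (simp add: Ea prob_space)
  qed
  \<comment> \<open>The constant 2 keeps the normalising factor positive for every \<open>a \<ge> -1\<close>.\<close>
  define w where "w \<omega> = (2 + a \<omega>) / (2 + \<kappa>)" for \<omega>
  have [measurable]: "random_variable borel w" unfolding w_def by measurable
  have w0: "w \<omega> \<ge> 0" if "\<omega> \<in> space M" for \<omega>
    using a[OF that] \<kappa> by (auto simp: w_def abs_le_iff intro!: divide_nonneg_pos)
  have int_w: "integrable M w" unfolding w_def using int_a by auto
  have Ew: "expectation w = 1"
  proof -
    have "expectation w = expectation (\<lambda>\<omega>. 2 + a \<omega>) / (2 + \<kappa>)" unfolding w_def by simp
    also have "expectation (\<lambda>\<omega>. 2 + a \<omega>) = 2 + \<kappa>"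
      using int_a by (subst Bochner_Integration.integral_add) (auto simp: Ea prob_space)
    finally show ?thesis using \<kappa> by simp
  qed
  have nz: "2 + complex_of_real \<kappa> \<noteq> 0"
  proof -
    have "complex_of_real (2 + \<kappa>) \<noteq> 0" using \<kappa> by (simp only: of_real_eq_0_iff)
    then show ?thesis by simp
  qed
  define Q where "Q = density M w"
  have "prob_space Q"
  proof
    have "emeasure Q (space Q) = (\<integral>\<^sup>+\<omega>. w \<omega> \<partial>M)"
      unfolding Q_def by (subst emeasure_density) (auto intro!: nn_integral_cong)
    also have "\<dots> = 1" using int_w w0 Ew by (subst nn_integral_eq_integral) auto
    finally show "emeasure Q (space Q) = 1" .
  qed
  then interpret Q: prob_space Q .
  have ZQ[measurable]: "Z \<in> borel_measurable Q" by (simp add: Q_def)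
  interpret D: real_distribution "distr Q borel Z"
    by (rule Q.real_distribution_distr) measurable
  have "distr Q borel Z = N"
  proof (rule Levy_uniqueness)
    show "char (distr Q borel Z) = char N"
    proof
      fix t
      have "char (distr Q borel Z) t = (CLINT \<omega>|Q. iexp (t * Z \<omega>))"
        unfolding char_def by (subst integral_distr) auto
      also have "\<dots> = (CLINT \<omega>|M. w \<omega> *\<^sub>R iexp (t * Z \<omega>))"
        unfolding Q_def using w0 by (subst integral_density) auto
      also have "\<dots> = (CLINT \<omega>|M. (2 * iexp (t * Z \<omega>) + iexp (t * Z \<omega>) * of_real (a \<omega>)) / (2 + of_real \<kappa>))"
        by (intro Bochner_Integration.integral_cong refl) (simp add: w_def scaleR_conv_of_real field_simps)
      also have "\<dots> = (2 * char N t + char N t * of_real \<kappa>) / (2 + of_real \<kappa>)"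
        using int_e int_i by (simp add: charZ char del: of_real_mult)
      also have "\<dots> = char N t" using nz by (simp add: divide_eq_eq distrib_left mult.commute)
      finally show "char (distr Q borel Z) t = char N t" .
    qed
  qed (unfold_locales)
  then have "measure N A = measure (distr Q borel Z) A" by simp
  also have "\<dots> = (\<integral>\<omega>. indicator A (Z \<omega>) \<partial>Q)"
  proof -
    have "(\<integral>\<omega>. indicator A (Z \<omega>) \<partial>Q) = (\<integral>x. indicator A x \<partial>distr Q borel Z :: real)"
      using A by (subst integral_distr) auto
    then show ?thesis using A by simp
  qed
  also have "\<dots> = (\<integral>\<omega>. w \<omega> * indicator A (Z \<omega>) \<partial>M)"
    unfolding Q_def using w0 A by (subst integral_density) auto
  also have "\<dots> = (\<integral>\<omega>. (2 * indicator A (Z \<omega>) + indicator A (Z \<omega>) * a \<omega>) / (2 + \<kappa>) \<partial>M)"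
    by (intro Bochner_Integration.integral_cong refl) (simp add: w_def field_simps)
  also have "\<dots> = (2 * (\<integral>\<omega>. indicator A (Z \<omega>) \<partial>M) + (\<integral>\<omega>. indicator A (Z \<omega>) * a \<omega> \<partial>M)) / (2 + \<kappa>)"
  proof -
    have "integrable M (\<lambda>\<omega>. indicator A (Z \<omega>) :: real)"
      by (rule integrable_const_bound[where B=1]) (use A in auto)
    moreover have "integrable M (\<lambda>\<omega>. indicator A (Z \<omega>) * a \<omega>)"
      by (rule integrable_const_bound[where B=1]) (use A a in \<open>auto simp: indicator_def\<close>)
    ultimately show ?thesis by simp
  qed
  also have "(\<integral>\<omega>. indicator A (Z \<omega>) \<partial>M) = measure N A"
  proof -
    have "(\<integral>\<omega>. indicator A (Z \<omega>) \<partial>M) = (\<integral>x. indicator A x \<partial>distr M borel Z :: real)"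
      using A by (subst integral_distr) auto
    then show ?thesis using A Z by simp
  qed
  finally show ?thesis using \<kappa> by (simp add: field_simps)
qed

text \<open>
  The uniqueness theorem for characteristic functions in several variables, one variable at a
  time: at step \<open>m\<close> the first \<open>m\<close> exponentials have been replaced by indicators. The next one is replaced by
  applying the one-dimensional theorem with the real and imaginary parts of the rest as weights.
\<close>

lemma (in prob_space) gaussian_partial_law:
  fixes Z :: "nat \<Rightarrow> 'a \<Rightarrow> real"
  assumes Z[measurable]: "\<And>k. k < n \<Longrightarrow> random_variable borel (Z k)"
    and char: "\<And>c. (CLINT \<omega>|M. iexp (\<Sum>k<n. c k * Z k \<omega>)) = of_real (exp (- (\<Sum>k<n. (c k)\<^sup>2) / 2))"
    and A: "\<And>k. k < n \<Longrightarrow> A k \<in> sets borel" and "m \<le> n"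
  shows "(CLINT \<omega>|M. of_real (\<Prod>k<m. indicator (A k) (Z k \<omega>)) * iexp (\<Sum>k=m..<n. c k * Z k \<omega>))
     = of_real ((\<Prod>k<m. measure std_normal_distribution (A k)) * exp (- (\<Sum>k=m..<n. (c k)\<^sup>2) / 2))"
  using \<open>m \<le> n\<close>
proof (induction m arbitrary: c)
  case 0
  show ?case using char[of c] by (simp add: atLeast0LessThan)
next
  case (Suc m)
  then have m: "m < n" by simp
  define w where "w \<omega> = (\<Prod>k<m. indicator (A k) (Z k \<omega>) :: real)" for \<omega>
  define U where "U \<omega> = (\<Sum>k=Suc m..<n. c k * Z k \<omega>)" for \<omega>
  define P where "P = (\<Prod>k<m. measure std_normal_distribution (A k)) * exp (- (\<Sum>k=Suc m..<n. (c k)\<^sup>2) / 2)"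
  have [measurable]: "random_variable borel (Z m)" "random_variable borel w" "random_variable borel U"
    unfolding w_def U_def using m Z A by (auto intro!: borel_measurable_prod borel_measurable_sum)
  have w: "0 \<le> w \<omega>" "w \<omega> \<le> 1" for \<omega>
    unfolding w_def by (auto intro!: prod_nonneg prod_le_1)
  have split: "(\<Sum>k=m..<n. g k) = g m + (\<Sum>k=Suc m..<n. g k)" for g :: "nat \<Rightarrow> real"
    using m by (simp add: sum.atLeast_Suc_lessThan)
  have IH: "(CLINT \<omega>|M. of_real (w \<omega>) * iexp (t * Z m \<omega> + s * U \<omega>))
      = char std_normal_distribution t * of_real P" if "s\<^sup>2 = 1" for s t
  proof -
    define d where "d k = (if k = m then t else s * c k)" for k
    have "(\<Sum>k=Suc m..<n. d k * Z k \<omega>) = s * U \<omega>" for \<omega>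
      unfolding U_def sum_distrib_left by (intro sum.cong) (auto simp: d_def)
    moreover have "(\<Sum>k=Suc m..<n. (d k)\<^sup>2) = (\<Sum>k=Suc m..<n. (c k)\<^sup>2)"
      using that by (intro sum.cong) (auto simp: d_def power_mult_distrib)
    moreover have "exp (- (t\<^sup>2 + R) / 2) = exp (- (t\<^sup>2) / 2) * exp (- R / 2)" for R :: real
      by (simp add: exp_add[symmetric] field_simps)
    moreover have "d m = t" by (simp add: d_def)
    ultimately show ?thesis
      using Suc.IH[of d] m
      unfolding w_def[symmetric] split P_def char_std_normal_distribution
      by (simp add: mult_ac)
  qed
  have int: "integrable M (\<lambda>\<omega>. of_real (w \<omega>) * iexp (t * Z m \<omega> + s * U \<omega>))" for s t
    by (rule integrable_const_bound[where B=1]) (use w in \<open>auto simp: norm_mult\<close>)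
  have euler: "iexp y = of_real (cos y) + \<i> * of_real (sin y)" for y :: real
    by (simp add: cis_conv_exp[symmetric] complex_eq_iff)
  have e: "iexp (x + y) = iexp x * (of_real (cos y) + \<i> * of_real (sin y))" for x y :: real
    unfolding euler[of y, symmetric] by (simp add: exp_add distrib_left)
  \<comment> \<open>Averaging the induction hypothesis for the phases \<open>U\<close> and \<open>-U\<close> separates \<open>cos U\<close> from \<open>sin U\<close>.\<close>
  have cosU: "(CLINT \<omega>|M. iexp (t * Z m \<omega>) * of_real (w \<omega> * cos (U \<omega>)))
      = char std_normal_distribution t * of_real P" for t
  proof -
    have "(CLINT \<omega>|M. iexp (t * Z m \<omega>) * of_real (w \<omega> * cos (U \<omega>)))
      = (CLINT \<omega>|M. (of_real (w \<omega>) * iexp (t * Z m \<omega> + 1 * U \<omega>) + of_real (w \<omega>) * iexp (t * Z m \<omega> + (-1) * U \<omega>)) / 2)"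
      unfolding e by (intro Bochner_Integration.integral_cong refl) (simp add: field_simps)
    also have "\<dots> = char std_normal_distribution t * of_real P"
      using IH[of 1 t] IH[of "-1" t] int[of t 1] int[of t "-1"] by simp
    finally show ?thesis .
  qed
  have sinU: "(CLINT \<omega>|M. iexp (t * Z m \<omega>) * of_real (w \<omega> * sin (U \<omega>)))
      = char std_normal_distribution t * of_real 0" for t
  proof -
    have "(CLINT \<omega>|M. iexp (t * Z m \<omega>) * of_real (w \<omega> * sin (U \<omega>)))
      = (CLINT \<omega>|M. (of_real (w \<omega>) * iexp (t * Z m \<omega> + 1 * U \<omega>) - of_real (w \<omega>) * iexp (t * Z m \<omega> + (-1) * U \<omega>)) / (2 * \<i>))"
      unfolding e by (intro Bochner_Integration.integral_cong refl) (simp add: field_simps)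
    also have "\<dots> = char std_normal_distribution t * of_real 0"
      using IH[of 1 t] IH[of "-1" t] int[of t 1] int[of t "-1"] by simp
    finally show ?thesis .
  qed
  have Zlaw: "distr M borel (Z m) = std_normal_distribution"
  proof (rule Levy_uniqueness)
    show "real_distribution (distr M borel (Z m))" by (rule real_distribution_distr) measurable
    show "char (distr M borel (Z m)) = char std_normal_distribution"
    proof
      fix t
      have "char (distr M borel (Z m)) t = (CLINT \<omega>|M. iexp (t * Z m \<omega>))"
        unfolding char_def by (subst integral_distr) auto
      also have "\<dots> = (CLINT \<omega>|M. iexp (\<Sum>k<n. (if k = m then t else 0) * Z k \<omega>))"
        using m by (simp add: if_distrib[of "\<lambda>x. x * _"] cong: if_cong)
      also have "\<dots> = char std_normal_distribution t"
        unfolding char using m by (simp add: if_distrib[of "\<lambda>x. x\<^sup>2"] char_std_normal_distribution cong: if_cong)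
      finally show "char (distr M borel (Z m)) t = char std_normal_distribution t" .
    qed
  qed (rule real_dist_normal_dist)
  have cos_int: "(\<integral>\<omega>. indicator (A m) (Z m \<omega>) * (w \<omega> * cos (U \<omega>)) \<partial>M) = measure std_normal_distribution (A m) * P"
    using weighted_law_of_char[OF _ _ real_dist_normal_dist Zlaw _ cosU A[OF m]] w
    by (simp add: abs_mult mult_le_one)
  have sin_int: "(\<integral>\<omega>. indicator (A m) (Z m \<omega>) * (w \<omega> * sin (U \<omega>)) \<partial>M) = 0"
    using weighted_law_of_char[OF _ _ real_dist_normal_dist Zlaw _ sinU A[OF m]] w
    by (simp add: abs_mult mult_le_one)
  have i1: "integrable M (\<lambda>\<omega>. indicator (A m) (Z m \<omega>) * (w \<omega> * cos (U \<omega>)))"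
       "integrable M (\<lambda>\<omega>. indicator (A m) (Z m \<omega>) * (w \<omega> * sin (U \<omega>)))"
    using A[OF m] w by (auto intro!: integrable_const_bound[where B=1] simp: abs_mult mult_le_one indicator_def)
  have "(CLINT \<omega>|M. of_real (\<Prod>k<Suc m. indicator (A k) (Z k \<omega>)) * iexp (\<Sum>k=Suc m..<n. c k * Z k \<omega>))
    = (CLINT \<omega>|M. of_real (indicator (A m) (Z m \<omega>) * (w \<omega> * cos (U \<omega>))) 
         + \<i> * of_real (indicator (A m) (Z m \<omega>) * (w \<omega> * sin (U \<omega>))))"
    unfolding U_def[symmetric] euler prod.lessThan_Suc w_def[symmetric]
    by (intro Bochner_Integration.integral_cong refl) (simp add: algebra_simps)
  also have "\<dots> = of_real (measure std_normal_distribution (A m) * P)"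
    using i1 by (subst Bochner_Integration.integral_add) (auto simp: cos_int sin_int simp del: of_real_mult)
  finally show ?case by (simp add: P_def)
qed

lemma (in prob_space) gaussian_law:
  fixes Z :: "nat \<Rightarrow> 'a \<Rightarrow> real"
  assumes Z[measurable]: "\<And>k. k < n \<Longrightarrow> random_variable borel (Z k)"
    and char: "\<And>c. (CLINT \<omega>|M. iexp (\<Sum>k<n. c k * Z k \<omega>)) = of_real (exp (- (\<Sum>k<n. (c k)\<^sup>2) / 2))"
  shows "distr M (\<Pi>\<^sub>M k\<in>{..<n}. borel) (\<lambda>\<omega>. \<lambda>k\<in>{..<n}. Z k \<omega>) = (\<Pi>\<^sub>M k\<in>{..<n}. std_normal_distribution)"
proof -
  have meas[measurable]: "(\<lambda>\<omega>. \<lambda>k\<in>{..<n}. Z k \<omega>) \<in> M \<rightarrow>\<^sub>M (\<Pi>\<^sub>M k\<in>{..<n}. borel)"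
    using Z by (intro measurable_restrict) auto
  show ?thesis
  proof (rule gauss_product.PiM_eqI)
    show "sets (distr M (\<Pi>\<^sub>M k\<in>{..<n}. borel) (\<lambda>\<omega>. \<lambda>k\<in>{..<n}. Z k \<omega>)) = sets (\<Pi>\<^sub>M k\<in>{..<n}. std_normal_distribution)"
      unfolding sets_distr by (rule sets_PiM_cong) auto
    fix A :: "nat \<Rightarrow> real set"
    assume "\<And>i. i \<in> {..<n} \<Longrightarrow> A i \<in> sets std_normal_distribution"
    then have A: "\<And>i. i < n \<Longrightarrow> A i \<in> sets borel" by simp
    let ?S = "{\<omega>\<in>space M. \<forall>k<n. Z k \<omega> \<in> A k}"
    have sub: "{\<omega>\<in>space M. Z k \<omega> \<in> A k} \<in> events" if "k < n" for k
      using measurable_sets[OF Z[OF that] A[OF that]] by (simp add: vimage_def Int_def conj_commute)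
    have S: "?S \<in> events"
    proof -
      have "{\<omega>\<in>space M. \<forall>k\<in>{..<n}. Z k \<omega> \<in> A k} \<in> events"
      proof (rule sets.sets_Collect_finite_All)
        show "{\<omega>\<in>space M. Z k \<omega> \<in> A k} \<in> events" if "k \<in> {..<n}" for k
          using sub that by blast
      qed simp
      then show ?thesis by (simp only: Ball_def lessThan_iff)
    qed
    have "emeasure (distr M (\<Pi>\<^sub>M k\<in>{..<n}. borel) (\<lambda>\<omega>. \<lambda>k\<in>{..<n}. Z k \<omega>)) (Pi\<^sub>E {..<n} A) = emeasure M ?S"
    proof (subst emeasure_distr[OF meas])
      show "Pi\<^sub>E {..<n} A \<in> sets (\<Pi>\<^sub>M k\<in>{..<n}. borel)"
        using A by (intro sets_PiM_I_finite) auto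
      have "(\<lambda>\<omega>. \<lambda>k\<in>{..<n}. Z k \<omega>) -` Pi\<^sub>E {..<n} A \<inter> space M = ?S"
        by (simp add: set_eq_iff PiE_def Pi_def Ball_def conj_commute)
      then show "emeasure M ((\<lambda>\<omega>. \<lambda>k\<in>{..<n}. Z k \<omega>) -` Pi\<^sub>E {..<n} A \<inter> space M) = emeasure M ?S"
        by simp
    qed
    also have "\<dots> = ennreal (prob ?S)" by (rule emeasure_eq_measure)
    also have "prob ?S = (\<Prod>k<n. measure std_normal_distribution (A k))"
    proof -
      have ind: "(\<Prod>k<n. indicator (A k) (Z k \<omega>)) = (indicator ?S \<omega> :: real)" if "\<omega> \<in> space M" for \<omega>
      proof (cases "\<forall>k<n. Z k \<omega> \<in> A k")
        case False
        then obtain k where "k < n" "Z k \<omega> \<notin> A k" by blast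
        then have "(\<Prod>k<n. indicator (A k) (Z k \<omega>)) = (0 :: real)"
          by (intro prod_zero bexI[of _ k]) auto
        then show ?thesis using False by simp
      next
        case True
        then have "(\<Prod>k<n. indicator (A k) (Z k \<omega>)) = (1 :: real)"
          by (intro prod.neutral) auto
        then show ?thesis using True that by simp
      qed
      have "complex_of_real (prob ?S) = (CLINT \<omega>|M. of_real (indicator ?S \<omega>))"
      proof -
        have "(\<integral>\<omega>. indicator ?S \<omega> \<partial>M) = prob (?S \<inter> space M)"
          by (rule Bochner_Integration.integral_indicator)
        also have "?S \<inter> space M = ?S" by blast
        finally show ?thesis by (simp only: integral_complex_of_real)
      qed
      also have "\<dots> = (CLINT \<omega>|M. of_real (\<Prod>k<n. indicator (A k) (Z k \<omega>)))"
        using ind by (intro Bochner_Integration.integral_cong) auto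
      also have "\<dots> = of_real (\<Prod>k<n. measure std_normal_distribution (A k))"
      proof -
        have "(CLINT \<omega>|M. of_real (\<Prod>k<n. indicator (A k) (Z k \<omega>)) * iexp (\<Sum>k=n..<n. 0 * Z k \<omega>))
          = of_real ((\<Prod>k<n. measure std_normal_distribution (A k)) * exp (- (\<Sum>k=n..<n. 0\<^sup>2) / 2))"
          using Z char A order_refl by (rule gaussian_partial_law)
        then show ?thesis
          by (simp only: atLeastLessThan_empty[OF order_refl] sum.empty of_real_0 mult_zero_right
              exp_zero mult_1_right minus_zero div_0)
      qed
      finally show ?thesis by (simp only: of_real_eq_iff)
    qed
    also have "ennreal (\<Prod>k<n. measure std_normal_distribution (A k)) = (\<Prod>i\<in>{..<n}. emeasure std_normal_distribution (A i))"
      unfolding std_normal.emeasure_eq_measure by (rule prod_ennreal[symmetric]) simp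
    finally show "emeasure (distr M (\<Pi>\<^sub>M k\<in>{..<n}. borel) (\<lambda>\<omega>. \<lambda>k\<in>{..<n}. Z k \<omega>)) (Pi\<^sub>E {..<n} A)
       = (\<Prod>i\<in>{..<n}. emeasure std_normal_distribution (A i))" .
  qed simp
qed

section \<open>Integration with respect to the standard Gaussian measure\<close>

lemma gauss_integral_resample:
  fixes h :: "(nat \<Rightarrow> real) \<Rightarrow> 'b::{banach, second_countable_topology}"
  assumes "integrable gauss h"
  shows "(\<integral>x. h x \<partial>gauss) = (\<integral>x. (\<integral>t. h (x(i := t)) \<partial>std_normal_distribution) \<partial>gauss)"
proof -
  interpret P: pair_prob_space std_normal_distribution gauss ..
  have m: "(\<lambda>(t, x). x(i := t)) \<in> std_normal_distribution \<Otimes>\<^sub>M gauss \<rightarrow>\<^sub>M gauss"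
  proof -
    have "(\<lambda>(t, x). x(i := t)) \<in> borel \<Otimes>\<^sub>M borel \<rightarrow>\<^sub>M (borel :: (nat \<Rightarrow> real) measure)"
      by (rule borel_measurable_fun_upd)
    also have "(borel \<Otimes>\<^sub>M borel \<rightarrow>\<^sub>M (borel :: (nat \<Rightarrow> real) measure)) = std_normal_distribution \<Otimes>\<^sub>M gauss \<rightarrow>\<^sub>M gauss"
      by (intro measurable_cong_sets sets_pair_measure_cong) auto
    finally show ?thesis .
  qed
  have h: "h \<in> borel_measurable gauss" using assms by simp
  have "integrable (distr (std_normal_distribution \<Otimes>\<^sub>M gauss) gauss (\<lambda>(t, x). x(i := t))) h"
    using assms by (simp only: gauss_resample)
  then have int: "integrable (std_normal_distribution \<Otimes>\<^sub>M gauss) (\<lambda>(t, x). h (x(i := t)))"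
    using integrable_distr[OF m] by (simp add: case_prod_unfold)
  have "(\<integral>x. h x \<partial>gauss) = (\<integral>x. h x \<partial>distr (std_normal_distribution \<Otimes>\<^sub>M gauss) gauss (\<lambda>(t, x). x(i := t)))"
    by (simp only: gauss_resample)
  also have "\<dots> = (\<integral>p. (case p of (t, x) \<Rightarrow> h (x(i := t))) \<partial>(std_normal_distribution \<Otimes>\<^sub>M gauss))"
    by (subst integral_distr[OF m h]) (simp add: case_prod_unfold)
  also have "\<dots> = (\<integral>x. (\<integral>t. h (x(i := t)) \<partial>std_normal_distribution) \<partial>gauss)"
    using P.integral_snd[OF int] by simp
  finally show "(\<integral>x. h x \<partial>gauss) = (\<integral>x. (\<integral>t. h (x(i := t)) \<partial>std_normal_distribution) \<partial>gauss)" .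
qed

lemma gauss_char:
  "(CLINT x|gauss. iexp (\<Sum>k<n. c k * x k)) = of_real (exp (- (\<Sum>k<n. (c k)\<^sup>2) / 2))"
proof (induction n)
  case 0
  show ?case using gauss.prob_space by simp
next
  case (Suc n)
  let ?h = "\<lambda>x. iexp (\<Sum>k<Suc n. c k * x k) :: complex"
  have int: "integrable gauss ?h"
    by (rule gauss.integrable_const_bound[where B=1]) auto
  have upd: "?h (x(n := t)) = iexp (\<Sum>k<n. c k * x k) * iexp (c n * t)" for x t
    by (simp add: exp_add[symmetric] distrib_left mult_ac add.commute)
  have "(CLINT x|gauss. ?h x) = (CLINT x|gauss. (CLINT t|std_normal_distribution. ?h (x(n := t))))"
    by (rule gauss_integral_resample[OF int])
  also have "\<dots> = (CLINT x|gauss. iexp (\<Sum>k<n. c k * x k) * char std_normal_distribution (c n))"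
    unfolding upd char_def by simp
  also have "\<dots> = of_real (exp (- (\<Sum>k<n. (c k)\<^sup>2) / 2)) * of_real (exp (- ((c n)\<^sup>2) / 2))"
    unfolding char_std_normal_distribution integral_mult_left_zero Suc.IH by simp
  also have "\<dots> = of_real (exp (- (\<Sum>k<Suc n. (c k)\<^sup>2) / 2))"
  proof -
    have "exp (- (a + b) / 2) = exp (- a / 2) * exp (- b / 2)" for a b :: real
      by (simp add: exp_add[symmetric] field_simps)
    then show ?thesis by (simp only: sum.lessThan_Suc of_real_mult)
  qed
  finally show ?case .
qed

text \<open>
  The expectation of a function of finitely many Gaussian variables depends on their
  characteristic function only. All changes of variables below are instances: rotations, independent
  copies, and the passage from the process \<open>W\<close> to \<open>gauss\<close>.
\<close>

lemma (in prob_space)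
  fixes Z :: "nat \<Rightarrow> 'a \<Rightarrow> real" and f :: "(nat \<Rightarrow> real) \<Rightarrow> real"
  assumes Z: "\<And>k. k < n \<Longrightarrow> random_variable borel (Z k)"
    and f: "f \<in> borel_measurable borel" "depends_on_first n f"
  shows random_variable_depends_on_first: "random_variable borel (\<lambda>\<omega>. f (\<lambda>k. Z k \<omega>))"
    and gaussian_expectation:
      "(\<And>c. (CLINT \<omega>|M. iexp (\<Sum>k<n. c k * Z k \<omega>)) = of_real (exp (- (\<Sum>k<n. (c k)\<^sup>2) / 2))) \<Longrightarrow>
        (\<integral>\<omega>. f (\<lambda>k. Z k \<omega>) \<partial>M) = (\<integral>x. f x \<partial>gauss)"
proof -
  define r where "r y = (\<lambda>k. if k < n then y k else 0)" for y :: "nat \<Rightarrow> real"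
  have r: "r \<in> (\<Pi>\<^sub>M k\<in>{..<n}. borel) \<rightarrow>\<^sub>M (borel :: (nat \<Rightarrow> real) measure)"
  proof (rule measurable_coordinatewise_then_product)
    fix i
    show "(\<lambda>x. r x i) \<in> borel_measurable (\<Pi>\<^sub>M k\<in>{..<n}. borel)"
      by (cases "i < n") (auto simp: r_def)
  qed
  have fr: "(\<lambda>y. f (r y)) \<in> borel_measurable (\<Pi>\<^sub>M k\<in>{..<n}. borel)"
    using measurable_compose[OF r f(1)] .
  have f_r: "f (\<lambda>k. z k) = f (r (\<lambda>k\<in>{..<n}. z k))" for z
    by (rule f(2)[unfolded depends_on_first_def, rule_format]) (simp add: r_def)
  have meas: "(\<lambda>\<omega>. \<lambda>k\<in>{..<n}. Z k \<omega>) \<in> M \<rightarrow>\<^sub>M (\<Pi>\<^sub>M k\<in>{..<n}. borel)"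
    using Z by (intro measurable_restrict) auto
  have f_r': "(\<lambda>\<omega>. f (\<lambda>k. Z k \<omega>)) = (\<lambda>\<omega>. f (r (\<lambda>k\<in>{..<n}. Z k \<omega>)))"
    by (intro ext f_r)
  show "random_variable borel (\<lambda>\<omega>. f (\<lambda>k. Z k \<omega>))"
    using measurable_compose[OF meas fr] by (simp only: f_r'[symmetric])
  assume char: "\<And>c. (CLINT \<omega>|M. iexp (\<Sum>k<n. c k * Z k \<omega>)) = of_real (exp (- (\<Sum>k<n. (c k)\<^sup>2) / 2))"
  have meas': "(\<lambda>x. \<lambda>k\<in>{..<n}. x k) \<in> gauss \<rightarrow>\<^sub>M (\<Pi>\<^sub>M k\<in>{..<n}. borel)"
    by (intro measurable_restrict) auto
  have "(\<integral>\<omega>. f (\<lambda>k. Z k \<omega>) \<partial>M) = (\<integral>y. f (r y) \<partial>distr M (\<Pi>\<^sub>M k\<in>{..<n}. borel) (\<lambda>\<omega>. \<lambda>k\<in>{..<n}. Z k \<omega>))"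
    unfolding f_r' by (rule integral_distr[OF meas fr, symmetric])
  also have "distr M (\<Pi>\<^sub>M k\<in>{..<n}. borel) (\<lambda>\<omega>. \<lambda>k\<in>{..<n}. Z k \<omega>) = (\<Pi>\<^sub>M k\<in>{..<n}. std_normal_distribution)"
    by (rule gaussian_law[where Z=Z]) (fact Z, fact char)
  also have "\<dots> = distr gauss (\<Pi>\<^sub>M k\<in>{..<n}. borel) (\<lambda>x. \<lambda>k\<in>{..<n}. x k)"
  proof (rule gauss.gaussian_law[where Z="\<lambda>k x. x k", symmetric])
    show "(CLINT x|gauss. iexp (\<Sum>k<n. c k * x k)) = of_real (exp (- (\<Sum>k<n. (c k)\<^sup>2) / 2))" for c
      by (rule gauss_char)
  qed simp
  also have "(\<integral>y. f (r y) \<partial>\<dots>) = (\<integral>x. f (r (\<lambda>k\<in>{..<n}. x k)) \<partial>gauss)"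
    by (rule integral_distr[OF meas' fr])
  also have "\<dots> = (\<integral>x. f x \<partial>gauss)" by (simp only: f_r[symmetric])
  finally show "(\<integral>\<omega>. f (\<lambda>k. Z k \<omega>) \<partial>M) = (\<integral>x. f x \<partial>gauss)" .
qed

section \<open>Gaussian integration by parts\<close>

lemma integrable_std_normal_growth:
  fixes h :: "real \<Rightarrow> real"
  assumes "h \<in> borel_measurable borel" "\<And>t. \<bar>h t\<bar> \<le> C * (K + \<bar>t\<bar>) ^ N" "C \<ge> 0" "K \<ge> 0"
  shows "integrable std_normal_distribution h"
proof (rule Bochner_Integration.integrable_bound)
  show "integrable std_normal_distribution (\<lambda>t. C * (2 ^ N * (K ^ N + \<bar>t\<bar> ^ N)))"
    using integrable_std_normal_power by (intro integrable_mult_right Bochner_Integration.integrable_add) auto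
  show "h \<in> borel_measurable std_normal_distribution" using assms(1) by simp
  have "(K + \<bar>t\<bar>) ^ N \<le> 2 ^ N * (K ^ N + \<bar>t\<bar> ^ N)" for t
  proof -
    have "(K + \<bar>t\<bar>) ^ N \<le> (2 * max K \<bar>t\<bar>) ^ N" using assms(4) by (intro power_mono) auto
    also have "\<dots> = 2 ^ N * max K \<bar>t\<bar> ^ N" by (simp add: power_mult_distrib)
    also have "max K \<bar>t\<bar> ^ N \<le> K ^ N + \<bar>t\<bar> ^ N" using assms(4) by (auto simp: max_def)
    finally show ?thesis by simp
  qed
  then have "\<bar>h t\<bar> \<le> \<bar>C * (2 ^ N * (K ^ N + \<bar>t\<bar> ^ N))\<bar>" for t
    by (rule order_trans[OF order_trans[OF assms(2) mult_left_mono[OF _ assms(3)]] abs_ge_self])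
  then show "AE t in std_normal_distribution. norm (h t) \<le> norm (C * (2 ^ N * (K ^ N + \<bar>t\<bar> ^ N)))" by simp
qed

lemma std_normal_density_decay:
  fixes G :: "real \<Rightarrow> real"
  assumes G: "\<And>t. \<bar>G t\<bar> \<le> C * (K + \<bar>t\<bar>) ^ N" and "C \<ge> 0" "K \<ge> 0"
    and F: "filterlim (\<lambda>t::real. \<bar>t\<bar>) at_top F"
  shows "((\<lambda>t. G t * std_normal_density t) \<longlongrightarrow> 0) F"
proof (rule Lim_null_comparison)
  have "\<bar>G t * std_normal_density t\<bar> \<le> (C * exp (K + 1) / sqrt (2 * pi)) * ((K + \<bar>t\<bar>) ^ N / exp (K + \<bar>t\<bar>))" for t
  proof -
    have "0 \<le> (\<bar>t\<bar> - 1)\<^sup>2" by simp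
    then have "\<bar>t\<bar> - t\<^sup>2 / 2 \<le> 1" by (simp add: power2_eq_square field_simps)
    then have e: "exp (- t\<^sup>2 / 2) \<le> exp (K + 1) / exp (K + \<bar>t\<bar>)"
      by (simp add: exp_diff[symmetric])
    have "\<bar>G t * std_normal_density t\<bar> = \<bar>G t\<bar> * (exp (- t\<^sup>2 / 2) / sqrt (2 * pi))"
      by (simp add: abs_mult std_normal_density_def)
    also have "\<dots> \<le> (C * (K + \<bar>t\<bar>) ^ N) * (exp (K + 1) / exp (K + \<bar>t\<bar>) / sqrt (2 * pi))"
      using G e assms(2,3) by (intro mult_mono divide_right_mono) auto
    finally show ?thesis by (simp add: field_simps)
  qed
  then show "\<forall>\<^sub>F t in F. norm (G t * std_normal_density t) \<le> (C * exp (K + 1) / sqrt (2 * pi)) * ((K + \<bar>t\<bar>) ^ N / exp (K + \<bar>t\<bar>))"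
    by simp
  have "filterlim (\<lambda>t. K + \<bar>t\<bar>) at_top F"
    by (rule filterlim_tendsto_add_at_top[OF tendsto_const F])
  from filterlim_compose[OF tendsto_power_div_exp_0 this]
  show "((\<lambda>t. (C * exp (K + 1) / sqrt (2 * pi)) * ((K + \<bar>t\<bar>) ^ N / exp (K + \<bar>t\<bar>))) \<longlongrightarrow> 0) F"
    by (rule tendsto_mult_right_zero)
qed

text \<open>
  The derivative of the standard normal density \<open>\<phi>\<close> is \<open>-t \<phi>(t)\<close>, so that \<open>(G' - t G) \<phi>\<close> is the
  derivative of \<open>G \<phi>\<close>, which vanishes at both ends.
\<close>

lemma std_normal_integration_by_parts:
  fixes G G' :: "real \<Rightarrow> real"
  assumes deriv: "\<And>t. (G has_real_derivative G' t) (at t)"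
    and cont: "continuous_on UNIV G'"
    and G: "\<And>t. \<bar>G t\<bar> \<le> C * (K + \<bar>t\<bar>) ^ N" and G': "\<And>t. \<bar>G' t\<bar> \<le> C' * (K + \<bar>t\<bar>) ^ N'"
    and C: "C \<ge> 0" "C' \<ge> 0" "K \<ge> 0"
  shows "(\<integral>t. t * G t \<partial>std_normal_distribution) = (\<integral>t. G' t \<partial>std_normal_distribution)"
proof -
  have contG: "continuous_on UNIV G"
    using deriv by (meson DERIV_isCont continuous_at_imp_continuous_on)
  have [measurable]: "G \<in> borel_measurable borel" "G' \<in> borel_measurable borel"
    using contG cont by (auto intro: borel_measurable_continuous_onI)
  have tG: "\<bar>t * G t\<bar> \<le> C * (K + \<bar>t\<bar>) ^ Suc N" for t
  proof -
    have "\<bar>t * G t\<bar> \<le> (K + \<bar>t\<bar>) * (C * (K + \<bar>t\<bar>) ^ N)"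
      unfolding abs_mult using G C by (intro mult_mono) auto
    then show ?thesis by (simp add: mult_ac)
  qed
  have i1: "integrable std_normal_distribution (\<lambda>t. t * G t)"
    by (rule integrable_std_normal_growth[OF _ tG]) (use C in auto)
  have i2: "integrable std_normal_distribution G'"
    by (rule integrable_std_normal_growth[OF _ G']) (use C in auto)
  define f where "f t = std_normal_density t * (G' t - t * G t)" for t
  have "integrable std_normal_distribution (\<lambda>t. G' t - t * G t)" using i1 i2 by simp
  then have fint: "integrable lborel f"
    unfolding f_def by (subst (asm) integrable_density) auto
  have "(LBINT t=-\<infinity>..\<infinity>. f t) = 0 - 0"
  proof (rule interval_integral_FTC_integrable)
    show "((\<lambda>t. G t * std_normal_density t) has_vector_derivative f t) (at t)" for t
    proof -
      have "(std_normal_density has_real_derivative (- t * std_normal_density t)) (at t)"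
        unfolding std_normal_density_def by (auto intro!: derivative_eq_intros simp: field_simps)
      from DERIV_mult[OF deriv[of t] this]
      show ?thesis
        unfolding has_real_derivative_iff_has_vector_derivative[symmetric]
        by (rule DERIV_cong) (simp add: f_def algebra_simps)
    qed
    have "continuous_on UNIV f"
      unfolding f_def std_normal_density_def using cont contG by (intro continuous_intros) auto
    then show "isCont f t" for t by (simp add: continuous_on_eq_continuous_at)
    show "set_integrable lborel (einterval (- \<infinity>) \<infinity>) f"
      using fint by (simp add: einterval_eq_UNIV set_integrable_def)
    have "filterlim (\<lambda>t::real. \<bar>t\<bar>) at_top at_top" "filterlim (\<lambda>t::real. \<bar>t\<bar>) at_top at_bot"
      by (rule filterlim_abs_real, rule filterlim_at_infinity_imp_norm_at_top[of "\<lambda>t::real. t" at_bot, unfolded real_norm_def])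
         (rule filterlim_mono[OF filterlim_ident at_bot_le_at_infinity order_refl])
    from this[THEN std_normal_density_decay[OF G C(1,3)]]
    show "(((\<lambda>t. G t * std_normal_density t) \<circ> real_of_ereal) \<longlongrightarrow> 0) (at_right (-\<infinity>))"
         "(((\<lambda>t. G t * std_normal_density t) \<circ> real_of_ereal) \<longlongrightarrow> 0) (at_left \<infinity>)"
      by (simp_all only: ereal_tendsto_simps)
  qed simp
  then have "(LBINT t. f t) = 0"
    by (simp add: interval_lebesgue_integral_def einterval_eq_UNIV set_lebesgue_integral_def)
  also have "(LBINT t. f t) = (\<integral>t. G' t - t * G t \<partial>std_normal_distribution)"
    unfolding f_def by (subst integral_density) auto
  also have "\<dots> = (\<integral>t. G' t \<partial>std_normal_distribution) - (\<integral>t. t * G t \<partial>std_normal_distribution)"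
    using i1 i2 by simp
  finally show ?thesis by simp
qed

lemma poly_growth_line:
  assumes "poly_growth n f"
  obtains C N where "C \<ge> 0" "\<And>x t. \<bar>f (x(i := t))\<bar> \<le> C * (1 + (\<Sum>j<n. \<bar>x j\<bar>) + \<bar>t\<bar>) ^ N"
proof -
  obtain C N where f: "C \<ge> 0" "\<And>x. \<bar>f x\<bar> \<le> C * (1 + L2_set x {..<n}) ^ N"
    using assms by (rule poly_growthE) blast
  have "\<bar>f (x(i := t))\<bar> \<le> C * (1 + (\<Sum>j<n. \<bar>x j\<bar>) + \<bar>t\<bar>) ^ N" for x t
  proof -
    have "L2_set (x(i := t)) {..<n} \<le> (\<Sum>j<n. \<bar>(x(i := t)) j\<bar>)" by (rule L2_set_le_sum_abs)
    also have "\<dots> \<le> (\<Sum>j<n. \<bar>x j\<bar> + (if j = i then \<bar>t\<bar> else 0))" by (intro sum_mono) auto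
    also have "\<dots> \<le> (\<Sum>j<n. \<bar>x j\<bar>) + \<bar>t\<bar>" by (simp add: sum.distrib)
    finally have "(1 + L2_set (x(i := t)) {..<n}) ^ N \<le> (1 + (\<Sum>j<n. \<bar>x j\<bar>) + \<bar>t\<bar>) ^ N"
      by (intro power_mono) auto
    then show ?thesis using f by (meson mult_left_mono order_trans)
  qed
  then show thesis using that f(1) by blast
qed

text \<open>
  The hypotheses concern the lines parallel to one axis only, so that \<open>g\<close> may be merely
  measurable in the other coordinates.
\<close>

lemma gauss_integration_by_parts:
  assumes g: "tame n g" and g': "tame n g'" and "i < n"
    and deriv: "\<And>x t. ((\<lambda>t. g (x(i := t))) has_real_derivative g' (x(i := t))) (at t)"
    and cont: "\<And>x. continuous_on UNIV (\<lambda>t. g' (x(i := t)))"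
  shows "(\<integral>x. x i * g x \<partial>gauss) = (\<integral>x. g' x \<partial>gauss)"
proof -
  obtain C N where C: "C \<ge> 0" "\<And>x t. \<bar>g (x(i := t))\<bar> \<le> C * (1 + (\<Sum>j<n. \<bar>x j\<bar>) + \<bar>t\<bar>) ^ N"
    using poly_growth_line[of n g i] g unfolding tame_def by metis
  obtain C' N' where C': "C' \<ge> 0" "\<And>x t. \<bar>g' (x(i := t))\<bar> \<le> C' * (1 + (\<Sum>j<n. \<bar>x j\<bar>) + \<bar>t\<bar>) ^ N'"
    using poly_growth_line[of n g' i] g' unfolding tame_def by metis
  have "(\<integral>x. x i * g x \<partial>gauss) = (\<integral>x. (\<integral>t. t * g (x(i := t)) \<partial>std_normal_distribution) \<partial>gauss)"
    using gauss_integral_resample[OF tame_integrable[OF tame_mult[OF tame_coordinate[OF \<open>i < n\<close>] g]], of i] by simp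
  also have "\<dots> = (\<integral>x. (\<integral>t. g' (x(i := t)) \<partial>std_normal_distribution) \<partial>gauss)"
  proof (rule Bochner_Integration.integral_cong[OF refl])
    fix x :: "nat \<Rightarrow> real"
    show "(\<integral>t. t * g (x(i := t)) \<partial>std_normal_distribution) = (\<integral>t. g' (x(i := t)) \<partial>std_normal_distribution)"
      by (rule std_normal_integration_by_parts[OF deriv cont C(2) C'(2) C(1) C'(1)]) (simp add: sum_nonneg)
  qed
  also have "\<dots> = (\<integral>x. g' x \<partial>gauss)"
    by (rule gauss_integral_resample[OF tame_integrable[OF g'], symmetric])
  finally show ?thesis .
qed

section \<open>Hoelder and Minkowski inequalities\<close>

text \<open>
  Hoelder's inequality for nonnegative functions, with exponents \<open>1 / (1 - \<alpha>)\<close> and \<open>1 / \<alpha>\<close>.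
\<close>

lemma integral_powr_interpolation:
  fixes f g :: "'a \<Rightarrow> real"
  assumes f: "integrable M f" and g: "integrable M g"
    and f0: "\<And>x. f x \<ge> 0" and g0: "\<And>x. g x \<ge> 0" and \<alpha>: "0 < \<alpha>" "\<alpha> < 1"
  shows "(\<integral>x. f x powr (1 - \<alpha>) * g x powr \<alpha> \<partial>M) \<le> (\<integral>x. f x \<partial>M) powr (1 - \<alpha>) * (\<integral>x. g x \<partial>M) powr \<alpha>"
proof -
  have [measurable]: "f \<in> borel_measurable M" "g \<in> borel_measurable M" using f g by auto
  define A B where "A = (\<integral>x. f x \<partial>M)" and "B = (\<integral>x. g x \<partial>M)"
  have "A \<ge> 0" "B \<ge> 0" unfolding A_def B_def by (auto intro!: integral_nonneg_AE f0 g0)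
  consider "A = 0" | "B = 0" | "A > 0" "B > 0" using \<open>A \<ge> 0\<close> \<open>B \<ge> 0\<close> by linarith
  then show ?thesis
  proof cases
    case 1
    then have "AE x in M. f x = 0" 
      using integral_nonneg_eq_0_iff_AE[OF f] f0 unfolding A_def by auto
    then have "(\<integral>x. f x powr (1 - \<alpha>) * g x powr \<alpha> \<partial>M) = (\<integral>x. 0 \<partial>M)"
      by (intro integral_cong_AE) auto
    then show ?thesis by simp
  next
    case 2
    then have "AE x in M. g x = 0" 
      using integral_nonneg_eq_0_iff_AE[OF g] g0 unfolding B_def by auto
    then have "(\<integral>x. f x powr (1 - \<alpha>) * g x powr \<alpha> \<partial>M) = (\<integral>x. 0 \<partial>M)"
      by (intro integral_cong_AE) auto
    then show ?thesis by simp
  next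
    case 3
    have young: "f x powr (1 - \<alpha>) * g x powr \<alpha> \<le> A powr (1 - \<alpha>) * B powr \<alpha> * ((1 - \<alpha>) * (f x / A) + \<alpha> * (g x / B))" for x
    proof (cases "f x > 0 \<and> g x > 0")
      case True
      then have "(f x / A) powr (1 - \<alpha>) * (g x / B) powr \<alpha> \<le> (1 - \<alpha>) * (f x / A) + \<alpha> * (g x / B)"
        using 3 \<alpha> by (intro Youngs_inequality_0) auto
      then have "A powr (1 - \<alpha>) * B powr \<alpha> * ((f x / A) powr (1 - \<alpha>) * (g x / B) powr \<alpha>) 
          \<le> A powr (1 - \<alpha>) * B powr \<alpha> * ((1 - \<alpha>) * (f x / A) + \<alpha> * (g x / B))"
        by (intro mult_left_mono) auto
      also have "A powr (1 - \<alpha>) * B powr \<alpha> * ((f x / A) powr (1 - \<alpha>) * (g x / B) powr \<alpha>)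
          = (A powr (1 - \<alpha>) * (f x / A) powr (1 - \<alpha>)) * (B powr \<alpha> * (g x / B) powr \<alpha>)"
        by (simp only: mult_ac)
      also have "A powr (1 - \<alpha>) * (f x / A) powr (1 - \<alpha>) = f x powr (1 - \<alpha>)"
        using True 3 by (subst powr_mult[symmetric]) auto
      also have "B powr \<alpha> * (g x / B) powr \<alpha> = g x powr \<alpha>"
        using True 3 by (subst powr_mult[symmetric]) auto
      finally show ?thesis .
    next
      case False
      then have "f x = 0 \<or> g x = 0" using f0[of x] g0[of x] by linarith
      then have "f x powr (1 - \<alpha>) * g x powr \<alpha> = 0" by auto
      also have "0 \<le> A powr (1 - \<alpha>) * B powr \<alpha> * ((1 - \<alpha>) * (f x / A) + \<alpha> * (g x / B))"
        using f0[of x] g0[of x] 3 \<alpha> by (intro mult_nonneg_nonneg add_nonneg_nonneg divide_nonneg_pos) auto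
      finally show ?thesis .
    qed
    have int: "integrable M (\<lambda>x. A powr (1 - \<alpha>) * B powr \<alpha> * ((1 - \<alpha>) * (f x / A) + \<alpha> * (g x / B)))"
      using f g by (intro integrable_mult_right Bochner_Integration.integrable_add integrable_divide) auto
    have "(\<integral>x. f x powr (1 - \<alpha>) * g x powr \<alpha> \<partial>M) \<le> (\<integral>x. A powr (1 - \<alpha>) * B powr \<alpha> * ((1 - \<alpha>) * (f x / A) + \<alpha> * (g x / B)) \<partial>M)"
    proof (rule integral_mono[OF _ int])
      show "integrable M (\<lambda>x. f x powr (1 - \<alpha>) * g x powr \<alpha>)"
      proof (rule Bochner_Integration.integrable_bound[OF int])
        have "norm (f x powr (1 - \<alpha>) * g x powr \<alpha>)
            \<le> norm (A powr (1 - \<alpha>) * B powr \<alpha> * ((1 - \<alpha>) * (f x / A) + \<alpha> * (g x / B)))" for x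
        proof -
          have "norm (f x powr (1 - \<alpha>) * g x powr \<alpha>) = f x powr (1 - \<alpha>) * g x powr \<alpha>" by simp
          then show ?thesis using order_trans[OF young[of x] abs_ge_self] by (simp only: real_norm_def)
        qed
        then show "AE x in M. norm (f x powr (1 - \<alpha>) * g x powr \<alpha>)
            \<le> norm (A powr (1 - \<alpha>) * B powr \<alpha> * ((1 - \<alpha>) * (f x / A) + \<alpha> * (g x / B)))"
          by (rule AE_I2)
      qed measurable
    qed (rule young)
    also have "\<dots> = A powr (1 - \<alpha>) * B powr \<alpha> * ((1 - \<alpha>) * (A / A) + \<alpha> * (B / B))"
      using f g by (simp add: A_def B_def)
    also have "\<dots> = A powr (1 - \<alpha>) * B powr \<alpha>" using 3 by simp
    finally show ?thesis by (simp add: A_def B_def)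
  qed
qed

lemma powr_convex_nonneg:
  fixes a b :: real
  assumes "a \<ge> 0" "b \<ge> 0" "l > 0" "m > 0" "l + m = 1" "q \<ge> 1"
  shows "(l * a + m * b) powr q \<le> l * a powr q + m * b powr q"
proof -
  have small: "s powr q \<le> s" if "0 < s" "s < 1" for s
    using powr_mono'[of 1 q s] that assms(6) by simp
  consider "a = 0" | "b = 0" | "a > 0" "b > 0" using assms by linarith
  then show ?thesis
  proof cases
    case 1 
    then show ?thesis using assms small[of m] by (simp add: powr_mult mult_right_mono)
  next
    case 2
    then show ?thesis using assms small[of l] by (simp add: powr_mult mult_right_mono)
  next
    case 3
    have l: "l = 1 - m" using assms by simp
    then show ?thesis
      using convex_onD[OF powr_convex[OF assms(6)], of m a b] assms 3 by (simp add: l)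
  qed
qed

lemma powr_inverse_powr: "x \<ge> 0 \<Longrightarrow> q > 0 \<Longrightarrow> (x powr (1 / q)) powr q = (x::real)"
  by (simp add: powr_powr)

lemma powr_powr_inverse: "x \<ge> 0 \<Longrightarrow> q > 0 \<Longrightarrow> (x powr q) powr (1 / q) = (x::real)"
  by (simp add: powr_powr)

text \<open>
  Convexity of the power function applied to \<open>f / s\<close> and \<open>g / t\<close>, where \<open>s\<close> and \<open>t\<close> exceed the two
  norms by \<open>e / 2\<close>; strict excess avoids division by zero.
\<close>

lemma minkowski:
  fixes f g :: "'a \<Rightarrow> real"
  assumes f: "integrable M (\<lambda>x. f x powr q)" "\<And>x. f x \<ge> 0" 
    and g: "integrable M (\<lambda>x. g x powr q)" "\<And>x. g x \<ge> 0"
    and meas[measurable]: "f \<in> borel_measurable M" "g \<in> borel_measurable M" and q: "q \<ge> 1"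
  shows "(\<integral>x. (f x + g x) powr q \<partial>M) powr (1 / q)
    \<le> (\<integral>x. f x powr q \<partial>M) powr (1 / q) + (\<integral>x. g x powr q \<partial>M) powr (1 / q)"
proof (rule field_le_epsilon)
  fix e :: real assume "e > 0"
  define s where "s = (\<integral>x. f x powr q \<partial>M) powr (1 / q) + e / 2"
  define t where "t = (\<integral>x. g x powr q \<partial>M) powr (1 / q) + e / 2"
  have st: "s > 0" "t > 0" unfolding s_def t_def using \<open>e > 0\<close> by (auto intro: add_nonneg_pos)
  have conv: "(f x + g x) powr q \<le> (s + t) powr q * (s / (s + t) * (f x powr q / s powr q) + t / (s + t) * (g x powr q / t powr q))" for x
  proof -
    have "((f x + g x) / (s + t)) powr q = (s / (s + t) * (f x / s) + t / (s + t) * (g x / t)) powr q"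
      using st by (simp add: add_divide_distrib)
    also have "\<dots> \<le> s / (s + t) * (f x / s) powr q + t / (s + t) * (g x / t) powr q"
      using st f(2) g(2) q by (intro powr_convex_nonneg) (auto simp: add_divide_distrib[symmetric])
    finally have "(f x + g x) powr q / (s + t) powr q \<le> s / (s + t) * (f x powr q / s powr q) + t / (s + t) * (g x powr q / t powr q)"
      using st f(2) g(2) by (simp add: powr_divide add_nonneg_nonneg)
    then show ?thesis using st by (simp add: pos_divide_le_eq mult.commute)
  qed
  have int: "integrable M (\<lambda>x. (s + t) powr q * (s / (s + t) * (f x powr q / s powr q) + t / (s + t) * (g x powr q / t powr q)))"
    using f g by (intro integrable_mult_right Bochner_Integration.integrable_add integrable_divide) auto
  have "(\<integral>x. (f x + g x) powr q \<partial>M) \<le> (\<integral>x. (s + t) powr q * (s / (s + t) * (f x powr q / s powr q) + t / (s + t) * (g x powr q / t powr q)) \<partial>M)"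
  proof (rule integral_mono[OF _ int])
    show "integrable M (\<lambda>x. (f x + g x) powr q)"
    proof (rule Bochner_Integration.integrable_bound[OF int])
      have "norm ((f x + g x) powr q) \<le> norm ((s + t) powr q * (s / (s + t) * (f x powr q / s powr q) + t / (s + t) * (g x powr q / t powr q)))" for x
      proof -
        have "norm ((f x + g x) powr q) = (f x + g x) powr q" by simp
        then show ?thesis using order_trans[OF conv[of x] abs_ge_self] by (simp only: real_norm_def)
      qed
      then show "AE x in M. norm ((f x + g x) powr q) \<le> norm ((s + t) powr q * (s / (s + t) * (f x powr q / s powr q) + t / (s + t) * (g x powr q / t powr q)))"
        by (rule AE_I2)
    qed measurable
  qed (rule conv)
  also have "\<dots> = (s + t) powr q * (s / (s + t) * ((\<integral>x. f x powr q \<partial>M) / s powr q) + t / (s + t) * ((\<integral>x. g x powr q \<partial>M) / t powr q))"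
    using f g by simp
  also have "\<dots> \<le> (s + t) powr q * (s / (s + t) * 1 + t / (s + t) * 1)"
  proof -
    have *: "I / (I powr (1 / q) + e / 2) powr q \<le> 1" if "I \<ge> 0" for I
    proof -
      have "I = (I powr (1 / q)) powr q" using that q by (simp add: powr_powr)
      also have "\<dots> \<le> (I powr (1 / q) + e / 2) powr q" using \<open>e > 0\<close> q by (intro powr_mono2) auto
      finally have "I \<le> (I powr (1 / q) + e / 2) powr q" .
      moreover have "(I powr (1 / q) + e / 2) powr q > 0"
        using \<open>e > 0\<close> add_nonneg_pos[of "I powr (1 / q)" "e / 2"] by simp
      ultimately show ?thesis by (simp only: divide_le_eq_1_pos)
    qed
    have "(\<integral>x. f x powr q \<partial>M) / s powr q \<le> 1" "(\<integral>x. g x powr q \<partial>M) / t powr q \<le> 1"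
      unfolding s_def t_def by (rule *, simp)+
    then show ?thesis
      using st by (intro mult_left_mono add_mono) auto
  qed
  also have "\<dots> = (s + t) powr q" using st by (simp add: add_divide_distrib[symmetric])
  finally have "(\<integral>x. (f x + g x) powr q \<partial>M) powr (1 / q) \<le> ((s + t) powr q) powr (1 / q)"
    by (rule powr_mono2[rotated 2]) (use q in \<open>simp_all add: integral_nonneg_AE\<close>)
  also have "\<dots> = s + t" using st q by (simp add: powr_powr)
  finally show "(\<integral>x. (f x + g x) powr q \<partial>M) powr (1 / q)
      \<le> (\<integral>x. f x powr q \<partial>M) powr (1 / q) + (\<integral>x. g x powr q \<partial>M) powr (1 / q) + e"
    by (simp add: s_def t_def)
qed

section \<open>Continuously differentiable functions of finitely many coordinates\<close>

lemma tame_measurable_gauss: "tame n f \<Longrightarrow> f \<in> borel_measurable gauss"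
  unfolding measurable_cong_sets[OF sets_gauss refl] by (rule tame_measurable)

definition C1_partials ::
    "nat \<Rightarrow> ((nat \<Rightarrow> real) \<Rightarrow> real) \<Rightarrow> (nat \<Rightarrow> (nat \<Rightarrow> real) \<Rightarrow> real) \<Rightarrow> bool" where
  "C1_partials n f f' \<longleftrightarrow> tame n f \<and> continuous_on UNIV f \<and>
     (\<forall>i<n. tame n (f' i) \<and> continuous_on UNIV (f' i) \<and>
        (\<forall>x. ((\<lambda>t. f (x(i := t))) has_real_derivative f' i x) (at (x i))))"

lemma C1_partialsD:
  assumes "C1_partials n f f'"
  shows "tame n f" "continuous_on UNIV f"
    "i < n \<Longrightarrow> tame n (f' i)" "i < n \<Longrightarrow> continuous_on UNIV (f' i)"
    "i < n \<Longrightarrow> ((\<lambda>t. f (x(i := t))) has_real_derivative f' i (x(i := t))) (at t)"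
proof -
  show "tame n f" "continuous_on UNIV f"
    "i < n \<Longrightarrow> tame n (f' i)" "i < n \<Longrightarrow> continuous_on UNIV (f' i)"
    using assms by (auto simp: C1_partials_def)
  assume "i < n"
  then have "((\<lambda>s. f ((x(i := t))(i := s))) has_real_derivative f' i (x(i := t))) (at ((x(i := t)) i))"
    using assms unfolding C1_partials_def by blast
  then show "((\<lambda>t. f (x(i := t))) has_real_derivative f' i (x(i := t))) (at t)" by simp
qed

lemma C1_partials_diff_const:
  assumes "C1_partials n f f'" shows "C1_partials n (\<lambda>x. f x - c) f'"
  using assms unfolding C1_partials_def
  by (auto intro!: tame_diff continuous_intros derivative_eq_intros)

lemma continuous_on_fun_upd:
  assumes "continuous_on S f" "continuous_on S g"
  shows "continuous_on S (\<lambda>x. (f x)(i := g x) :: nat \<Rightarrow> real)"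
proof (rule continuous_on_coordinatewise_then_product)
  fix j
  show "continuous_on S (\<lambda>x. ((f x)(i := g x)) j)"
    using assms continuous_on_product_then_coordinatewise[OF assms(1), of j] by (cases "j = i") auto
qed

text \<open>
  The chain rule along a curve. The coordinates are released one at a time; each step is the
  two-variable criterion for differentiability, which needs continuity of the new partial derivative only.
\<close>

lemma C1_partials_chain:
  assumes f: "C1_partials n f f'"
    and y: "\<And>i t. i < n \<Longrightarrow> ((\<lambda>t. y t i) has_real_derivative y' t i) (at t)"
  shows "((\<lambda>t. f (y t)) has_real_derivative (\<Sum>i<n. f' i (y s) * y' s i)) (at s)"
proof -
  \<comment> \<open>The coordinates below \<open>k\<close> follow the curve, the others stay at their value at \<open>s\<close>.\<close>
  define z where "z k t = (\<lambda>i. if i < k then y t i else y s i)" for k t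
  have cont_y: "continuous_on UNIV (\<lambda>t. y t i)" if "i < n" for i
    using y[OF that] by (meson DERIV_isCont continuous_at_imp_continuous_on)
  have cont_z: "continuous_on UNIV (z k)" if "k \<le> n" for k
  proof (rule continuous_on_coordinatewise_then_product)
    fix i
    show "continuous_on UNIV (\<lambda>t. z k t i)"
      using cont_y[of i] that by (cases "i < k") (auto simp: z_def)
  qed
  have "((\<lambda>t. f (z k t)) has_real_derivative (\<Sum>i<k. f' i (y s) * y' s i)) (at s)" if "k \<le> n" for k
    using that
  proof (induction k)
    case 0
    then show ?case by (simp add: z_def)
  next
    case (Suc k)
    then have k: "k < n" "k \<le> n" by auto
    define F where "F t u = f ((z k t)(k := u))" for t u
    define D where "D = (\<Sum>i<k. f' i (y s) * y' s i)"
    have zk: "(z k t)(k := y s k) = z k t" "z (Suc k) t = (z k t)(k := y t k)" "(z k s)(k := y s k) = y s" for t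
      by (auto simp: z_def fun_eq_iff less_Suc_eq)
    have zks: "z k s = y s" by (auto simp: z_def)
    have "((\<lambda>(t, u). F t u) has_derivative
        (\<lambda>(a, b). D * a + blinfun_apply (blinfun_mult_right (f' k ((z k s)(k := y s k)))) b)) (at (s, y s k) within UNIV \<times> UNIV)"
    proof (rule has_derivative_partialsI)
      show "((\<lambda>t. F t (y s k)) has_derivative (*) D) (at s within UNIV)"
        using Suc.IH[OF k(2)] unfolding F_def zk D_def has_field_derivative_def .
      show "(F t has_derivative blinfun_apply (blinfun_mult_right (f' k ((z k t)(k := u))))) (at u within UNIV)" for t u
        using C1_partialsD(5)[OF f k(1), of "z k t" u]
        unfolding F_def[abs_def] has_field_derivative_def by simp
      have "continuous_on UNIV (\<lambda>p. f' k ((z k (fst p))(k := snd p)))"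
        by (intro continuous_on_compose2[OF C1_partialsD(4)[OF f k(1)]] continuous_on_fun_upd
            continuous_on_compose2[OF cont_z[OF k(2)]] continuous_intros) auto
      then have "continuous_on UNIV (\<lambda>p. blinfun_mult_right (f' k ((z k (fst p))(k := snd p))))"
        by (rule bounded_linear.continuous_on[OF bounded_linear_blinfun_mult_right])
      then show "continuous (at (s, y s k) within UNIV \<times> UNIV) (\<lambda>(t, u). blinfun_mult_right (f' k ((z k t)(k := u))))"
        by (simp add: case_prod_unfold continuous_on_eq_continuous_at)
    qed auto
    then have D: "((\<lambda>p. F (fst p) (snd p)) has_derivative (\<lambda>p. D * fst p + f' k (y s) * snd p)) (at (s, y s k))"
      by (simp add: case_prod_unfold zk zks)
    have "((\<lambda>t. (t, y t k)) has_derivative (\<lambda>h. (h, y' s k * h))) (at s)"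
      using y[OF k(1), of s] unfolding has_field_derivative_def
      by (intro has_derivative_Pair has_derivative_ident)
    from has_derivative_compose[OF this D]
    have "((\<lambda>t. F t (y t k)) has_derivative (\<lambda>h. D * h + f' k (y s) * (y' s k * h))) (at s)" by simp
    then have "((\<lambda>t. F t (y t k)) has_real_derivative (D + f' k (y s) * y' s k)) (at s)"
      unfolding has_field_derivative_def by (rule has_derivative_eq_rhs) (simp add: fun_eq_iff algebra_simps)
    then show ?case by (simp only: F_def zk D_def sum.lessThan_Suc)
  qed
  from this[of n] have "((\<lambda>t. f (z n t)) has_real_derivative (\<Sum>i<n. f' i (y s) * y' s i)) (at s)" by simp
  moreover have "f (z n t) = f (y t)" for t
    using C1_partialsD(1)[OF f] unfolding tame_def depends_on_first_def by (simp add: z_def)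
  ultimately show ?thesis by simp
qed

lemma poly_growth_compose:
  assumes "poly_growth n f" "K \<ge> 0"
  obtains C N where "C \<ge> 0"
    "\<And>x y. (\<And>i. i < n \<Longrightarrow> \<bar>y i\<bar> \<le> K * (1 + L2_set x {..<m})) \<Longrightarrow> \<bar>f y\<bar> \<le> C * (1 + L2_set x {..<m}) ^ N"
proof -
  obtain C N where f: "C \<ge> 0" "\<And>x. \<bar>f x\<bar> \<le> C * (1 + L2_set x {..<n}) ^ N"
    using assms(1) by (rule poly_growthE) blast
  have "\<bar>f y\<bar> \<le> C * (1 + n * K) ^ N * (1 + L2_set x {..<m}) ^ N"
    if y: "\<And>i. i < n \<Longrightarrow> \<bar>y i\<bar> \<le> K * (1 + L2_set x {..<m})" for x y
  proof -
    have "L2_set y {..<n} \<le> (\<Sum>i<n. \<bar>y i\<bar>)" by (rule L2_set_le_sum_abs)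
    also have "\<dots> \<le> (\<Sum>i<n. K * (1 + L2_set x {..<m}))" using y by (intro sum_mono) auto
    finally have "L2_set y {..<n} \<le> n * K * (1 + L2_set x {..<m})" by simp
    then have "1 + L2_set y {..<n} \<le> (1 + n * K) * (1 + L2_set x {..<m})"
      unfolding distrib_right mult_1_left using L2_set_nonneg[of x "{..<m}"] by linarith
    then have "(1 + L2_set y {..<n}) ^ N \<le> ((1 + n * K) * (1 + L2_set x {..<m})) ^ N"
      by (intro power_mono) auto
    then have "C * (1 + L2_set y {..<n}) ^ N \<le> C * ((1 + n * K) * (1 + L2_set x {..<m})) ^ N"
      using f(1) by (rule mult_left_mono)
    then show ?thesis using f(2)[of y] by (simp add: power_mult_distrib)
  qed
  then show thesis using f(1) assms(2) by (intro that[of "C * (1 + n * K) ^ N" N]) auto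
qed

text \<open>
  Linear substitutions, in particular rotations, preserve tameness.
\<close>

lemma tame_compose:
  assumes f: "tame n f" and T: "T \<in> borel_measurable borel"
    and growth: "K \<ge> 0" "\<And>x i. i < n \<Longrightarrow> \<bar>T x i\<bar> \<le> K * (1 + L2_set x {..<m})"
    and dep: "\<And>x y i. \<forall>j<m. x j = y j \<Longrightarrow> i < n \<Longrightarrow> T x i = T y i"
  shows "tame m (\<lambda>x. f (T x))"
proof -
  obtain C N where C: "C \<ge> 0"
    "\<And>x y. (\<And>i. i < n \<Longrightarrow> \<bar>y i\<bar> \<le> K * (1 + L2_set x {..<m})) \<Longrightarrow> \<bar>f y\<bar> \<le> C * (1 + L2_set x {..<m}) ^ N"
    using poly_growth_compose[of n f K m] f growth(1) unfolding tame_def by metis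
  have "poly_growth m (\<lambda>x. f (T x))"
    by (rule poly_growthI[of _ C _ N], rule C(2)) (rule growth(2))
  moreover have "f (T x) = f (T y)" if "\<forall>j<m. x j = y j" for x y
    using f dep[OF that] unfolding tame_def depends_on_first_def by blast
  moreover have "(\<lambda>x. f (T x)) \<in> borel_measurable borel"
    using measurable_compose[OF T tame_measurable[OF f]] .
  ultimately show ?thesis unfolding tame_def depends_on_first_def by blast
qed

section \<open>Rotation of two independent Gaussian vectors\<close>

text \<open>
  The rotation of the two blocks \<open>x = (x\<^sub>0, ..., x\<^bsub>n-1\<^esub>)\<close> and \<open>y = (x\<^sub>n, ..., x\<^bsub>2n-1\<^esub>)\<close>. The signs make it
  a reflection: it is its own inverse and its own transpose, and the second block is the derivative in
  \<open>\<theta>\<close> of the first.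
\<close>

definition rot :: "nat \<Rightarrow> real \<Rightarrow> (nat \<Rightarrow> real) \<Rightarrow> nat \<Rightarrow> real" where
  "rot n \<theta> x i = (if i < n then sin \<theta> * x i + cos \<theta> * x (n + i)
     else if i < 2 * n then cos \<theta> * x (i - n) - sin \<theta> * x i else x i)"

lemma rot_simps:
  "i < n \<Longrightarrow> rot n \<theta> x i = sin \<theta> * x i + cos \<theta> * x (n + i)"
  "i < n \<Longrightarrow> rot n \<theta> x (n + i) = cos \<theta> * x i - sin \<theta> * x (n + i)"
  by (auto simp: rot_def)

lemma rot_rot: "rot n \<theta> (rot n \<theta> x) = x"
proof
  fix i
  have sc: "sin \<theta> * (sin \<theta> * a + cos \<theta> * b) + cos \<theta> * (cos \<theta> * a - sin \<theta> * b) = a"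
       "cos \<theta> * (sin \<theta> * a + cos \<theta> * b) - sin \<theta> * (cos \<theta> * a - sin \<theta> * b) = b" for a b
    using sin_cos_squared_add[of \<theta>] by algebra+
  consider "i < n" | j where "i = n + j" "j < n" | "i \<ge> 2 * n"
    by (metis add_diff_inverse_nat add_less_cancel_left mult_2 not_le)
  then show "rot n \<theta> (rot n \<theta> x) i = x i"
    by cases (simp_all add: rot_simps sc, simp add: rot_def)
qed

lemma sum_lessThan_double: "(\<Sum>k<2 * n. g k) = (\<Sum>k<n. g k + g (n + k))" for g :: "nat \<Rightarrow> 'b::comm_monoid_add"
proof -
  have "(\<Sum>k<2 * n. g k) = (\<Sum>k<n. g k) + (\<Sum>k=n..<2 * n. g k)"
    by (simp add: lessThan_atLeast0 sum.atLeastLessThan_concat)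
  also have "(\<Sum>k=n..<2 * n. g k) = (\<Sum>k=0..<n. g (k + n))"
    using sum.shift_bounds_nat_ivl[of g 0 n n] by (simp add: mult_2)
  finally show ?thesis by (simp add: sum.distrib lessThan_atLeast0 add.commute)
qed

lemma borel_measurable_rot:
  assumes "\<phi> \<in> borel_measurable M" "X \<in> M \<rightarrow>\<^sub>M (borel :: (nat \<Rightarrow> real) measure)"
  shows "(\<lambda>w. rot n (\<phi> w) (X w)) \<in> M \<rightarrow>\<^sub>M (borel :: (nat \<Rightarrow> real) measure)"
proof (rule measurable_coordinatewise_then_product)
  fix i
  have [measurable]: "\<phi> \<in> borel_measurable M" "\<And>j. (\<lambda>w. X w j) \<in> borel_measurable M"
    using assms measurable_compose[OF assms(2) borel_measurable_coordinate] by auto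
  have "(\<lambda>w. rot n (\<phi> w) (X w) i) = (if i < n then (\<lambda>w. sin (\<phi> w) * X w i + cos (\<phi> w) * X w (n + i))
     else if i < 2 * n then (\<lambda>w. cos (\<phi> w) * X w (i - n) - sin (\<phi> w) * X w i) else (\<lambda>w. X w i))"
    by (auto simp: rot_def fun_eq_iff)
  also have "\<dots> \<in> borel_measurable M" by simp
  finally show "(\<lambda>w. rot n (\<phi> w) (X w) i) \<in> borel_measurable M" .
qed

lemma abs_rot_le:
  assumes "i < 2 * n" shows "\<bar>rot n \<theta> x i\<bar> \<le> 2 * (1 + L2_set x {..<2 * n})"
proof -
  have b: "\<bar>s * a + c * b\<bar> \<le> 2 * L" "\<bar>c * a - s * b\<bar> \<le> 2 * L"
    if "\<bar>s\<bar> \<le> 1" "\<bar>c\<bar> \<le> 1" "\<bar>a\<bar> \<le> L" "\<bar>b\<bar> \<le> L" for s c a b L :: real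
  proof -
    have "\<bar>s * a\<bar> \<le> 1 * L" "\<bar>c * b\<bar> \<le> 1 * L" "\<bar>c * a\<bar> \<le> 1 * L" "\<bar>s * b\<bar> \<le> 1 * L"
      unfolding abs_mult using that by (intro mult_mono; simp)+
    then show "\<bar>s * a + c * b\<bar> \<le> 2 * L" "\<bar>c * a - s * b\<bar> \<le> 2 * L" by linarith+
  qed
  show ?thesis
  proof (cases "i < n")
    case True
    then show ?thesis by (simp only: rot_simps, intro b abs_coordinate_le_L2_set) auto
  next
    case False
    then obtain j where "i = n + j" "j < n"
      using assms by (metis add_diff_inverse_nat add_less_cancel_left mult_2)
    then show ?thesis by (simp only: rot_simps, intro b abs_coordinate_le_L2_set) auto
  qed
qed

lemma rot_cong: "\<forall>j<2 * n. x j = y j \<Longrightarrow> i < 2 * n \<Longrightarrow> rot n \<theta> x i = rot n \<theta> y i"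
  by (auto simp: rot_def)

lemma tame_rot:
  assumes "tame (2 * n) f" shows "tame (2 * n) (\<lambda>x. f (rot n \<theta> x))"
  by (rule tame_compose[OF assms borel_measurable_rot _ abs_rot_le rot_cong]) auto

text \<open>
  An orthogonal map preserves the sum of squares in the characteristic function.
\<close>

lemma gauss_integral_rot:
  assumes f: "tame (2 * n) f"
  shows "(\<integral>x. f (rot n \<theta> x) \<partial>gauss) = (\<integral>x. f x \<partial>gauss)"
proof (rule gauss.gaussian_expectation[where Z="\<lambda>k x. rot n \<theta> x k" and n="2 * n"])
  have "(\<lambda>x. rot n \<theta> x) \<in> gauss \<rightarrow>\<^sub>M borel" by (rule borel_measurable_rot) auto
  from measurable_compose[OF this borel_measurable_coordinate]
  show "(\<lambda>x. rot n \<theta> x k) \<in> borel_measurable gauss" for k .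
  show "f \<in> borel_measurable borel" "depends_on_first (2 * n) f" using f by (auto simp: tame_def)
  fix c :: "nat \<Rightarrow> real"
  have 1: "(\<Sum>k<2 * n. c k * rot n \<theta> x k) = (\<Sum>k<2 * n. rot n \<theta> c k * x k)" for x
    unfolding sum_lessThan_double by (intro sum.cong refl) (simp add: rot_simps, simp add: algebra_simps)
  have 2: "(\<Sum>k<2 * n. (rot n \<theta> c k)\<^sup>2) = (\<Sum>k<2 * n. (c k)\<^sup>2)"
    unfolding sum_lessThan_double
  proof (intro sum.cong refl)
    fix k assume "k \<in> {..<n}"
    then have "rot n \<theta> c k = sin \<theta> * c k + cos \<theta> * c (n + k)" "rot n \<theta> c (n + k) = cos \<theta> * c k - sin \<theta> * c (n + k)"
      by (simp_all add: rot_simps)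
    then show "(rot n \<theta> c k)\<^sup>2 + (rot n \<theta> c (n + k))\<^sup>2 = (c k)\<^sup>2 + (c (n + k))\<^sup>2"
      using sin_cos_squared_add[of \<theta>] by algebra
  qed
  show "(CLINT x|gauss. iexp (\<Sum>k<2 * n. c k * rot n \<theta> x k)) = of_real (exp (- (\<Sum>k<2 * n. (c k)\<^sup>2) / 2))"
    unfolding 1 gauss_char 2 ..
qed

lemma gauss_integral_independent:
  assumes g: "tame n g" and f: "tame n f"
  shows "(\<integral>x. g x * f (\<lambda>i. x (n + i)) \<partial>gauss) = (\<integral>x. g x \<partial>gauss) * (\<integral>x. f x \<partial>gauss)"
proof -
  interpret P: pair_prob_space gauss gauss ..
  define Z where "Z k p = (if k < n then fst p k else snd p (k - n))" for k and p :: "(nat \<Rightarrow> real) \<times> (nat \<Rightarrow> real)"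
  define F where "F z = g z * f (\<lambda>i. z (n + i))" for z :: "nat \<Rightarrow> real"
  have [measurable]: "g \<in> borel_measurable borel" "f \<in> borel_measurable borel"
    using f g by (auto simp: tame_def)
  have dg: "g x = g y" if "\<And>i. i < n \<Longrightarrow> x i = y i" for x y
    using g that by (auto simp: tame_def depends_on_first_def)
  have df: "f x = f y" if "\<And>i. i < n \<Longrightarrow> x i = y i" for x y
    using f that by (auto simp: tame_def depends_on_first_def)
  have shift: "(\<lambda>z i. z (n + i)) \<in> borel \<rightarrow>\<^sub>M (borel :: (nat \<Rightarrow> real) measure)"
    by (rule measurable_coordinatewise_then_product) simp
  have FZ: "F (\<lambda>k. Z k p) = g (fst p) * f (snd p)" for p
  proof -
    have "g (\<lambda>k. Z k p) = g (fst p)" by (rule dg) (simp add: Z_def)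
    moreover have "f (\<lambda>i. Z (n + i) p) = f (snd p)" by (rule df) (simp add: Z_def)
    ultimately show ?thesis by (simp add: F_def)
  qed
  have m1: "(\<lambda>p. fst p k) \<in> borel_measurable (gauss \<Otimes>\<^sub>M gauss)" for k
    by (rule measurable_compose[OF measurable_fst]) simp
  have m2: "(\<lambda>p. snd p k) \<in> borel_measurable (gauss \<Otimes>\<^sub>M gauss)" for k
    by (rule measurable_compose[OF measurable_snd]) simp
  have int: "integrable (gauss \<Otimes>\<^sub>M gauss) (\<lambda>(x, y). h x * k y)"
    if "integrable gauss h" "integrable gauss k" for h k :: "(nat \<Rightarrow> real) \<Rightarrow> 'c::{real_normed_field, banach, second_countable_topology}"
  proof (rule P.Fubini_integrable)
    have "(\<lambda>p. h (fst p)) \<in> borel_measurable (gauss \<Otimes>\<^sub>M gauss)" "(\<lambda>p. k (snd p)) \<in> borel_measurable (gauss \<Otimes>\<^sub>M gauss)"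
      using that by (auto intro!: measurable_compose[OF measurable_fst] measurable_compose[OF measurable_snd])
    then show "(\<lambda>(x, y). h x * k y) \<in> borel_measurable (gauss \<Otimes>\<^sub>M gauss)"
      unfolding case_prod_unfold by (rule borel_measurable_times)
  qed (use that in \<open>auto simp: norm_mult\<close>)
  have prod: "(\<integral>p. h (fst p) * k (snd p) \<partial>(gauss \<Otimes>\<^sub>M gauss)) = (\<integral>x. h x \<partial>gauss) * (\<integral>x. k x \<partial>gauss)"
    if "integrable gauss h" "integrable gauss k" for h k :: "(nat \<Rightarrow> real) \<Rightarrow> 'c::{real_normed_field, banach, second_countable_topology}"
    using P.integral_fst'[OF int[OF that]] by (simp add: case_prod_unfold)
  have "(\<integral>x. F x \<partial>gauss) = (\<integral>p. F (\<lambda>k. Z k p) \<partial>(gauss \<Otimes>\<^sub>M gauss))"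
  proof (rule P.gaussian_expectation[where Z=Z and n="2 * n", symmetric])
    show "Z k \<in> borel_measurable (gauss \<Otimes>\<^sub>M gauss)" for k
      unfolding Z_def[abs_def] using m1 m2 by (cases "k < n") auto
    show "F \<in> borel_measurable borel"
      unfolding F_def[abs_def] using measurable_compose[OF shift, of f borel] by simp
    show "depends_on_first (2 * n) F"
      unfolding depends_on_first_def F_def
    proof (intro allI impI)
      fix x y :: "nat \<Rightarrow> real" assume "\<forall>i<2 * n. x i = y i"
      then have "g x = g y" "f (\<lambda>i. x (n + i)) = f (\<lambda>i. y (n + i))" by (auto intro!: dg df)
      then show "g x * f (\<lambda>i. x (n + i)) = g y * f (\<lambda>i. y (n + i))" by simp
    qed
    fix c :: "nat \<Rightarrow> real"
    have "iexp (\<Sum>k<2 * n. c k * Z k p) = iexp (\<Sum>k<n. c k * fst p k) * iexp (\<Sum>k<n. c (n + k) * snd p k)" for p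
      by (simp add: sum_lessThan_double Z_def sum.distrib exp_add[symmetric] distrib_left)
    then have "(CLINT p|gauss \<Otimes>\<^sub>M gauss. iexp (\<Sum>k<2 * n. c k * Z k p))
        = (CLINT p|gauss \<Otimes>\<^sub>M gauss. iexp (\<Sum>k<n. c k * fst p k) * iexp (\<Sum>k<n. c (n + k) * snd p k))" by simp
    also have "\<dots> = (CLINT x|gauss. iexp (\<Sum>k<n. c k * x k)) * (CLINT x|gauss. iexp (\<Sum>k<n. c (n + k) * x k))"
      by (rule prod; rule gauss.integrable_const_bound[where B=1]) auto
    also have "\<dots> = of_real (exp (- (\<Sum>k<n. (c k)\<^sup>2) / 2) * exp (- (\<Sum>k<n. (c (n + k))\<^sup>2) / 2))"
      by (simp only: gauss_char of_real_mult)
    also have "exp (- (\<Sum>k<n. (c k)\<^sup>2) / 2) * exp (- (\<Sum>k<n. (c (n + k))\<^sup>2) / 2) = exp (- (\<Sum>k<2 * n. (c k)\<^sup>2) / 2)"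
      unfolding sum_lessThan_double sum.distrib exp_add[symmetric] by (simp add: field_simps)
    finally show "(CLINT p|gauss \<Otimes>\<^sub>M gauss. iexp (\<Sum>k<2 * n. c k * Z k p)) = of_real (exp (- (\<Sum>k<2 * n. (c k)\<^sup>2) / 2))" .
  qed
  also have "\<dots> = (\<integral>x. g x \<partial>gauss) * (\<integral>x. f x \<partial>gauss)"
    unfolding FZ by (rule prod[OF tame_integrable[OF g] tame_integrable[OF f]])
  finally show ?thesis by (simp only: F_def)
qed

text \<open>
  Along the rotation from \<open>\<theta> = 0\<close>, where the first block is \<open>y\<close>, to \<open>\<theta> = \<pi>/2\<close>, where it is \<open>x\<close>, the
  function \<open>f\<close> changes by \<open>f(x) - f(y)\<close>. Its derivative at the angle \<open>\<theta>\<close> is \<open>\<nabla>f(x\<^sub>\<theta>) \<cdot> y\<^sub>\<theta>\<close>. Rotating back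
  under the expectation puts the angle on the test function \<open>g\<close> instead.
\<close>

lemma
  assumes g: "tame n g" and f: "C1_partials n f f'"
  defines "R \<equiv> \<lambda>\<theta>. \<integral>x. g (rot n \<theta> x) * (\<Sum>i<n. f' i x * x (n + i)) \<partial>gauss"
  shows rotation_formula_integrable: "integrable lborel (\<lambda>\<theta>. R \<theta> * indicator {0..pi/2} \<theta>)"
    and rotation_formula: "(\<integral>x. g x * (f x - (\<integral>y. f y \<partial>gauss)) \<partial>gauss) = (\<integral>\<theta>. R \<theta> * indicator {0..pi/2} \<theta> \<partial>lborel)"
proof -
  have tg: "tame (2 * n) g" using tame_mono[OF g] by simp
  have tf: "tame (2 * n) f" using tame_mono[OF C1_partialsD(1)[OF f]] by simp
  have tf': "tame (2 * n) (f' i)" if "i < n" for i using tame_mono[OF C1_partialsD(3)[OF f that]] by simp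
  define H where "H x = (\<Sum>i<n. f' i x * x (n + i))" for x
  have tH: "tame (2 * n) H" unfolding H_def by (intro tame_sum tame_mult tf' tame_coordinate) auto
  have R: "R \<theta> = (\<integral>x. g x * H (rot n \<theta> x) \<partial>gauss)" for \<theta>
  proof -
    have "(\<integral>x. g (rot n \<theta> (rot n \<theta> x)) * H (rot n \<theta> x) \<partial>gauss) = (\<integral>x. g (rot n \<theta> x) * H x \<partial>gauss)"
      by (rule gauss_integral_rot[where f="\<lambda>x. g (rot n \<theta> x) * H x"]) (intro tame_mult tame_rot tg tH)
    then show ?thesis by (simp add: R_def rot_rot H_def)
  qed
  have ftc: "(\<integral>\<theta>. H (rot n \<theta> x) * indicator {0..pi/2} \<theta> \<partial>lborel) = f x - f (\<lambda>i. x (n + i))" for x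
  proof -
    have dep: "f y = f z" if "\<And>i. i < n \<Longrightarrow> y i = z i" for y z
      using C1_partialsD(1)[OF f] that by (auto simp: tame_def depends_on_first_def)
    have "(\<integral>\<theta>. H (rot n \<theta> x) * indicator {0..pi/2} \<theta> \<partial>lborel) = f (rot n (pi/2) x) - f (rot n 0 x)"
    proof (rule integral_FTC_Icc_real)
      fix \<theta> :: real
      have d: "((\<lambda>t. rot n t x i) has_real_derivative rot n t x (n + i)) (at t)" if "i < n" for i t
        using that by (simp add: rot_simps) (auto intro!: derivative_eq_intros)
      show "DERIV (\<lambda>\<theta>. f (rot n \<theta> x)) \<theta> :> H (rot n \<theta> x)"
        unfolding H_def by (rule C1_partials_chain[OF f d])
      have cr: "continuous_on UNIV (\<lambda>\<theta>. rot n \<theta> x)"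
      proof (rule continuous_on_coordinatewise_then_product)
        fix i
        show "continuous_on UNIV (\<lambda>\<theta>. rot n \<theta> x i)"
          by (cases "i < n"; cases "i < 2 * n") (auto simp: rot_def intro!: continuous_intros)
      qed
      have "continuous_on UNIV (\<lambda>\<theta>. H (rot n \<theta> x))"
        unfolding H_def using continuous_on_product_then_coordinatewise[OF cr]
        by (intro continuous_on_sum continuous_on_mult continuous_on_compose2[OF C1_partialsD(4)[OF f] cr]) auto
      then show "isCont (\<lambda>\<theta>. H (rot n \<theta> x)) \<theta>" by (simp add: continuous_on_eq_continuous_at)
    qed simp
    moreover have "f (rot n (pi/2) x) = f x" by (rule dep) (simp add: rot_simps)
    moreover have "f (rot n 0 x) = f (\<lambda>i. x (n + i))" by (rule dep) (simp add: rot_simps)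
    ultimately show ?thesis by simp
  qed
  interpret P: pair_sigma_finite gauss lborel
    by (intro pair_sigma_finite.intro gauss.sigma_finite_measure_axioms lborel.sigma_finite_measure_axioms)
  obtain C N where C: "C \<ge> 0"
    "\<And>x y. (\<And>i. i < 2 * n \<Longrightarrow> \<bar>y i\<bar> \<le> 2 * (1 + L2_set x {..<2 * n})) \<Longrightarrow> \<bar>H y\<bar> \<le> C * (1 + L2_set x {..<2 * n}) ^ N"
    using poly_growth_compose[of "2 * n" H 2 "2 * n"] tH unfolding tame_def by auto
  define B where "B x = \<bar>g x\<bar> * (C * (1 + L2_set x {..<2 * n}) ^ N)" for x
  have tB: "tame (2 * n) B"
    unfolding B_def using tame_abs_powr[OF tg, of 1]
    by (intro tame_mult tame_cmult tame_power tame_add tame_const tame_L2_set) auto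
  have Bnn: "B x \<ge> 0" for x unfolding B_def using C(1) by simp
  have Bint: "integrable (gauss \<Otimes>\<^sub>M lborel) (\<lambda>(x, \<theta>). B x * indicator {0..pi/2} \<theta>)"
  proof (rule P.Fubini_integrable)
    have [measurable]: "B \<in> borel_measurable gauss" using tB by (rule tame_measurable_gauss)
    show "(\<lambda>(x, \<theta>). B x * indicator {0..pi/2} \<theta>) \<in> borel_measurable (gauss \<Otimes>\<^sub>M lborel)"
      by measurable
    have "(\<integral>\<theta>. norm (case (x, \<theta>) of (x, \<theta>) \<Rightarrow> B x * indicator {0..pi/2} \<theta>) \<partial>lborel) = B x * (pi/2)" for x
      using Bnn by (simp add: abs_mult)
    then have eq: "(\<lambda>x. \<integral>\<theta>. norm (case (x, \<theta>) of (x, \<theta>) \<Rightarrow> B x * indicator {0..pi/2} \<theta>) \<partial>lborel) = (\<lambda>x. B x * (pi/2))"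
      by (rule ext)
    show "integrable gauss (\<lambda>x. \<integral>\<theta>. norm (case (x, \<theta>) of (x, \<theta>) \<Rightarrow> B x * indicator {0..pi/2} \<theta>) \<partial>lborel)"
      unfolding eq using tame_integrable[OF tB] by simp
  qed auto
  have int: "integrable (gauss \<Otimes>\<^sub>M lborel) (\<lambda>(x, \<theta>). g x * (H (rot n \<theta> x) * indicator {0..pi/2} \<theta>))"
  proof (rule Bochner_Integration.integrable_bound[OF Bint])
    have [measurable]: "g \<in> borel_measurable gauss" using g by (rule tame_measurable_gauss)
    have "(\<lambda>p. rot n (snd p) (fst p)) \<in> gauss \<Otimes>\<^sub>M lborel \<rightarrow>\<^sub>M borel"
      by (rule borel_measurable_rot) measurable
    from measurable_compose[OF this tame_measurable[OF tH]]
    have [measurable]: "(\<lambda>p. H (rot n (snd p) (fst p))) \<in> borel_measurable (gauss \<Otimes>\<^sub>M lborel)" .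
    show "(\<lambda>(x, \<theta>). g x * (H (rot n \<theta> x) * indicator {0..pi/2} \<theta>)) \<in> borel_measurable (gauss \<Otimes>\<^sub>M lborel)"
      unfolding case_prod_unfold by measurable
    have "norm (g x * (H (rot n \<theta> x) * indicator {0..pi/2} \<theta>)) \<le> norm (B x * indicator {0..pi/2} \<theta>)" for x \<theta>
    proof -
      have "\<bar>H (rot n \<theta> x)\<bar> \<le> C * (1 + L2_set x {..<2 * n}) ^ N"
        by (rule C(2)) (rule abs_rot_le)
      then have "\<bar>g x\<bar> * \<bar>H (rot n \<theta> x)\<bar> \<le> B x"
        unfolding B_def by (rule mult_left_mono) simp
      then show ?thesis using Bnn[of x] by (auto simp: abs_mult indicator_def)
    qed
    then show "AE p in gauss \<Otimes>\<^sub>M lborel. norm (case p of (x, \<theta>) \<Rightarrow> g x * (H (rot n \<theta> x) * indicator {0..pi/2} \<theta>))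
        \<le> norm (case p of (x, \<theta>) \<Rightarrow> B x * indicator {0..pi/2} \<theta>)" by (intro AE_I2) (simp add: case_prod_unfold)
  qed
  have inner: "(\<integral>x. g x * (H (rot n \<theta> x) * indicator {0..pi/2} \<theta>) \<partial>gauss) = R \<theta> * indicator {0..pi/2} \<theta>" for \<theta>
    unfolding R mult.assoc[symmetric] by (rule integral_mult_left_zero)
  show "integrable lborel (\<lambda>\<theta>. R \<theta> * indicator {0..pi/2} \<theta>)"
    using P.integrable_snd[OF int] unfolding inner .
  have "(\<integral>\<theta>. R \<theta> * indicator {0..pi/2} \<theta> \<partial>lborel) = (\<integral>x. (\<integral>\<theta>. g x * (H (rot n \<theta> x) * indicator {0..pi/2} \<theta>) \<partial>lborel) \<partial>gauss)"
    unfolding inner[symmetric] by (rule P.Fubini_integral[OF int])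
  also have "\<dots> = (\<integral>x. g x * (f x - f (\<lambda>i. x (n + i))) \<partial>gauss)" by (simp add: ftc)
  also have "\<dots> = (\<integral>x. g x * f x \<partial>gauss) - (\<integral>x. g x * f (\<lambda>i. x (n + i)) \<partial>gauss)"
  proof -
    have "tame (2 * n) (\<lambda>x. f (\<lambda>i. x (n + i)))"
    proof (rule tame_compose[OF C1_partialsD(1)[OF f], where K=1])
      show "(\<lambda>x i. x (n + i)) \<in> borel \<rightarrow>\<^sub>M (borel :: (nat \<Rightarrow> real) measure)"
        by (rule measurable_coordinatewise_then_product) simp
      show "\<bar>x (n + i)\<bar> \<le> 1 * (1 + L2_set x {..<2 * n})" if "i < n" for x i
        using abs_coordinate_le_L2_set[of "n + i" "2 * n" x] that by simp
    qed auto
    then have "integrable gauss (\<lambda>x. g x * f (\<lambda>i. x (n + i)))"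
      using tame_integrable[OF tame_mult[OF tg]] by simp
    moreover have "integrable gauss (\<lambda>x. g x * f x)" using tame_integrable[OF tame_mult[OF tg tf]] .
    ultimately show ?thesis by (simp add: right_diff_distrib)
  qed
  also have "\<dots> = (\<integral>x. g x * f x \<partial>gauss) - (\<integral>x. g x \<partial>gauss) * (\<integral>x. f x \<partial>gauss)"
    by (simp only: gauss_integral_independent[OF g C1_partialsD(1)[OF f]])
  also have "\<dots> = (\<integral>x. g x * (f x - (\<integral>y. f y \<partial>gauss)) \<partial>gauss)"
    using tame_integrable[OF tame_mult[OF tg tf]] tame_integrable[OF tg] by (simp add: right_diff_distrib)
  finally show "(\<integral>x. g x * (f x - (\<integral>y. f y \<partial>gauss)) \<partial>gauss) = (\<integral>\<theta>. R \<theta> * indicator {0..pi/2} \<theta> \<partial>lborel)" ..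
qed

section \<open>\<open>L\<^sup>q\<close> norms of Gaussian functionals\<close>

lemma Lq_norm_nonneg [simp]: "Lq_norm M q f \<ge> 0"
  by (simp add: Lq_norm_def)

lemma Lq_norm_powr:
  assumes "q > 0"
  shows "Lq_norm M q f powr q = (\<integral>x. norm (f x) powr q \<partial>M)"
  using assms by (simp add: Lq_norm_def powr_inverse_powr integral_nonneg_AE)

lemma Lq_norm_mono:
  fixes f g :: "(nat \<Rightarrow> real) \<Rightarrow> real"
  assumes "tame n f" "tame m g" "q > 0" "\<And>x. \<bar>f x\<bar> \<le> \<bar>g x\<bar>"
  shows "Lq_norm gauss q f \<le> Lq_norm gauss q g"
proof -
  have "(\<integral>x. \<bar>f x\<bar> powr q \<partial>gauss) \<le> (\<integral>x. \<bar>g x\<bar> powr q \<partial>gauss)"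
    using assms by (intro integral_mono tame_integrable[OF tame_abs_powr[of n]] tame_integrable[OF tame_abs_powr[of m]] powr_mono2) auto
  then show ?thesis unfolding Lq_norm_def real_norm_def
    using assms(3) by (intro powr_mono2) (auto simp: integral_nonneg_AE)
qed

lemma Lq_norm_triangle:
  fixes f g h :: "(nat \<Rightarrow> real) \<Rightarrow> real"
  assumes f: "tame n f" and g: "tame n g" and h: "tame n h" and q: "q \<ge> 1"
    and le: "\<And>x. \<bar>h x\<bar> \<le> \<bar>f x\<bar> + \<bar>g x\<bar>"
  shows "Lq_norm gauss q h \<le> Lq_norm gauss q f + Lq_norm gauss q g"
proof -
  have af: "tame n (\<lambda>x. \<bar>f x\<bar>)" "tame n (\<lambda>x. \<bar>g x\<bar>)"
    using tame_abs_powr[OF f, of 1] tame_abs_powr[OF g, of 1] by auto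
  have "Lq_norm gauss q h \<le> Lq_norm gauss q (\<lambda>x. \<bar>f x\<bar> + \<bar>g x\<bar>)"
    using h q le by (intro Lq_norm_mono[OF _ tame_add[OF af]]) auto
  also have "\<dots> \<le> Lq_norm gauss q f + Lq_norm gauss q g"
    using minkowski[where M=gauss and q=q and f="\<lambda>x. \<bar>f x\<bar>" and g="\<lambda>x. \<bar>g x\<bar>"] tame_integrable[OF tame_abs_powr[OF f, of q]] 
      tame_integrable[OF tame_abs_powr[OF g, of q]] q tame_measurable_gauss[OF af(1)] tame_measurable_gauss[OF af(2)]
    unfolding Lq_norm_def real_norm_def by simp
  finally show ?thesis .
qed

lemma Lq_norm_const: "q > 0 \<Longrightarrow> Lq_norm gauss q (\<lambda>_. c) = \<bar>c\<bar>" for c :: real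
  using gauss.prob_space by (simp add: Lq_norm_def powr_powr_inverse)

lemma Lq_norm_rot:
  assumes "tame (2 * n) f" "q > 0"
  shows "Lq_norm gauss q (\<lambda>x. f (rot n \<theta> x)) = Lq_norm gauss q f"
  unfolding Lq_norm_def real_norm_def
  using gauss_integral_rot[OF tame_abs_powr[OF assms(1), of q], of \<theta>] assms(2) by simp

lemma holder_conjugate:
  fixes f g :: "(nat \<Rightarrow> real) \<Rightarrow> real"
  assumes f: "tame n f" and g: "tame n g" and pq: "p > 1" "1 / p + 1 / q = 1"
    and nn: "\<And>x. f x \<ge> 0" "\<And>x. g x \<ge> 0"
  shows "(\<integral>x. f x * g x \<partial>gauss) \<le> Lq_norm gauss p f * Lq_norm gauss q g"
proof -
  have q: "q > 1" "0 < 1 / q" "1 / q < 1" "1 - 1 / q = 1 / p"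
  proof -
    have "1 / q = 1 - 1 / p" using pq(2) by simp
    moreover have "0 < 1 / p" "1 / p < 1" using pq(1) by auto
    ultimately show "0 < 1 / q" "1 / q < 1" "1 - 1 / q = 1 / p" by auto
    then show "q > 1" by (auto simp: divide_less_eq_1)
  qed
  have "(\<integral>x. (f x powr p) powr (1 - 1 / q) * (g x powr q) powr (1 / q) \<partial>gauss)
      \<le> (\<integral>x. f x powr p \<partial>gauss) powr (1 - 1 / q) * (\<integral>x. g x powr q \<partial>gauss) powr (1 / q)"
    using pq q nn f g by (intro integral_powr_interpolation tame_integrable[of n] tame_powr) auto
  then show ?thesis
    using pq q(1) nn unfolding q(4) Lq_norm_def real_norm_def by (simp add: powr_powr_inverse abs_of_nonneg)
qed

lemma tame_powr_bounded_below:
  assumes "tame n f" "\<And>x. f x \<ge> \<epsilon>" "\<epsilon> > 0"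
  shows "tame n (\<lambda>x. f x powr r)"
proof (cases "r \<ge> 0")
  case True
  then show ?thesis using assms by (intro tame_powr) (auto intro: order_trans less_imp_le)
next
  case False
  show ?thesis
  proof (rule tame_bound[OF tame_const[of n "\<epsilon> powr r"]])
    show "(\<lambda>x. f x powr r) \<in> borel_measurable borel"
      using tame_measurable[OF assms(1)] by simp
    show "depends_on_first n (\<lambda>x. f x powr r)"
      using assms(1) unfolding tame_def depends_on_first_def by metis
    show "\<bar>f x powr r\<bar> \<le> \<bar>\<epsilon> powr r\<bar>" for x
      using powr_mono2'[of r \<epsilon> "f x"] assms(2)[of x] assms(3) False by simp
  qed
qed

section \<open>The gradient of a power of the norm\<close>

text \<open>
  The squared Euclidean norm of the family \<open>a\<close>, regularised by \<open>\<epsilon>\<close> so that all its powers are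
  continuously differentiable.
\<close>

definition reg_norm2 :: "real \<Rightarrow> 'i set \<Rightarrow> ('i \<Rightarrow> (nat \<Rightarrow> real) \<Rightarrow> real) \<Rightarrow> (nat \<Rightarrow> real) \<Rightarrow> real" where
  "reg_norm2 \<epsilon> A a x = (\<Sum>\<alpha>\<in>A. (a \<alpha> x)\<^sup>2) + \<epsilon>"

text \<open>
  The regularised version of \<open>\<bar>a\<bar>\<^bsup>p-2\<^esup> a\<close>, the function against which \<open>a\<close> is tested to obtain
  \<open>E \<bar>a\<bar>\<^sup>p\<close>.
\<close>

definition power_field ::
    "real \<Rightarrow> real \<Rightarrow> 'i set \<Rightarrow> ('i \<Rightarrow> (nat \<Rightarrow> real) \<Rightarrow> real) \<Rightarrow> 'i \<Rightarrow> (nat \<Rightarrow> real) \<Rightarrow> real" where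
  "power_field p \<epsilon> A a \<alpha> x = reg_norm2 \<epsilon> A a x powr ((p - 2) / 2) * a \<alpha> x"

definition power_field_partial ::
    "real \<Rightarrow> real \<Rightarrow> 'i set \<Rightarrow> ('i \<Rightarrow> (nat \<Rightarrow> real) \<Rightarrow> real) \<Rightarrow> ('i \<Rightarrow> nat \<Rightarrow> (nat \<Rightarrow> real) \<Rightarrow> real)
      \<Rightarrow> 'i \<Rightarrow> nat \<Rightarrow> (nat \<Rightarrow> real) \<Rightarrow> real" where
  "power_field_partial p \<epsilon> A a a' \<alpha> i x =
     (p - 2) * reg_norm2 \<epsilon> A a x powr ((p - 2) / 2 - 1) * (\<Sum>\<beta>\<in>A. a \<beta> x * a' \<beta> i x) * a \<alpha> x
     + reg_norm2 \<epsilon> A a x powr ((p - 2) / 2) * a' \<alpha> i x"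

lemma reg_norm2_ge: "reg_norm2 \<epsilon> A a x \<ge> \<epsilon>"
  by (simp add: reg_norm2_def sum_nonneg)

lemma reg_norm2_pos: "\<epsilon> > 0 \<Longrightarrow> reg_norm2 \<epsilon> A a x > 0"
  using reg_norm2_ge[of \<epsilon> A a x] by linarith

lemma reg_norm2_L2: "reg_norm2 \<epsilon> A a x = (L2_set (\<lambda>\<alpha>. a \<alpha> x) A)\<^sup>2 + \<epsilon>"
  by (simp add: reg_norm2_def L2_set_def sum_nonneg)

lemma tame_reg_norm2:
  assumes "\<And>\<alpha>. \<alpha> \<in> A \<Longrightarrow> tame n (a \<alpha>)" shows "tame n (reg_norm2 \<epsilon> A a)"
  unfolding reg_norm2_def[abs_def] using assms by (intro tame_add tame_sum tame_power tame_const)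

lemma C1_partials_power_field:
  assumes "finite A" and a: "\<And>\<alpha>. \<alpha> \<in> A \<Longrightarrow> C1_partials n (a \<alpha>) (a' \<alpha>)" and "\<epsilon> > 0" and "\<alpha> \<in> A"
  shows "C1_partials n (power_field p \<epsilon> A a \<alpha>) (power_field_partial p \<epsilon> A a a' \<alpha>)"
proof -
  note ta = C1_partialsD(1)[OF a] and ca = C1_partialsD(2)[OF a]
    and ta' = C1_partialsD(3)[OF a] and ca' = C1_partialsD(4)[OF a]
  have tS: "tame n (\<lambda>x. reg_norm2 \<epsilon> A a x powr r)" for r
    by (rule tame_powr_bounded_below[OF tame_reg_norm2 reg_norm2_ge \<open>\<epsilon> > 0\<close>]) (rule ta)
  have cS: "continuous_on UNIV (\<lambda>x. reg_norm2 \<epsilon> A a x powr r)" for r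
  proof (rule continuous_on_powr)
    show "continuous_on UNIV (reg_norm2 \<epsilon> A a)"
      unfolding reg_norm2_def[abs_def] by (intro continuous_intros ca)
    show "\<forall>x\<in>UNIV. reg_norm2 \<epsilon> A a x \<noteq> 0" using reg_norm2_pos[OF \<open>\<epsilon> > 0\<close>] by (metis less_irrefl)
  qed (rule continuous_on_const)
  show ?thesis
    unfolding C1_partials_def
  proof (intro conjI allI impI)
    show "tame n (power_field p \<epsilon> A a \<alpha>)"
      unfolding power_field_def[abs_def] by (intro tame_mult tS ta \<open>\<alpha> \<in> A\<close>)
    show "continuous_on UNIV (power_field p \<epsilon> A a \<alpha>)"
      unfolding power_field_def[abs_def] by (intro continuous_on_mult cS ca \<open>\<alpha> \<in> A\<close>)
    fix i assume i: "i < n"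
    show "tame n (power_field_partial p \<epsilon> A a a' \<alpha> i)"
      unfolding power_field_partial_def[abs_def]
      by (intro tame_add tame_mult tS ta ta' tame_sum tame_const i \<open>\<alpha> \<in> A\<close>)
    show "continuous_on UNIV (power_field_partial p \<epsilon> A a a' \<alpha> i)"
      unfolding power_field_partial_def[abs_def]
      by (intro continuous_on_add continuous_on_mult cS ca ca' continuous_on_sum continuous_on_const i \<open>\<alpha> \<in> A\<close>)
    fix x
    have d: "((\<lambda>t. a \<beta> (x(i := t))) has_real_derivative a' \<beta> i x) (at (x i))" if "\<beta> \<in> A" for \<beta>
      using C1_partialsD(5)[OF a[OF that] i, of x "x i"] by simp
    have dS: "((\<lambda>t. reg_norm2 \<epsilon> A a (x(i := t))) has_real_derivative (\<Sum>\<beta>\<in>A. 2 * (a \<beta> x * a' \<beta> i x))) (at (x i))"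
      unfolding reg_norm2_def
      by (rule derivative_eq_intros DERIV_sum d refl | assumption | simp add: mult_ac)+
    have pos: "0 < reg_norm2 \<epsilon> A a (x(i := x i))" by (rule reg_norm2_pos[OF \<open>\<epsilon> > 0\<close>])
    have dP: "((\<lambda>t. reg_norm2 \<epsilon> A a (x(i := t)) powr ((p - 2) / 2)) has_real_derivative
        (p - 2) / 2 * reg_norm2 \<epsilon> A a x powr ((p - 2) / 2 - 1) * (\<Sum>\<beta>\<in>A. 2 * (a \<beta> x * a' \<beta> i x))) (at (x i))"
      using DERIV_fun_powr[OF dS pos, of "(p - 2) / 2"] by (simp del: fun_upd_apply)
    have "((\<lambda>t. power_field p \<epsilon> A a \<alpha> (x(i := t))) has_real_derivative
       (p - 2) / 2 * reg_norm2 \<epsilon> A a x powr ((p - 2) / 2 - 1) * (\<Sum>\<beta>\<in>A. 2 * (a \<beta> x * a' \<beta> i x)) * a \<alpha> (x(i := x i))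
        + a' \<alpha> i x * reg_norm2 \<epsilon> A a (x(i := x i)) powr ((p - 2) / 2)) (at (x i))"
      unfolding power_field_def by (rule DERIV_mult[OF dP d[OF \<open>\<alpha> \<in> A\<close>]])
    then show "((\<lambda>t. power_field p \<epsilon> A a \<alpha> (x(i := t))) has_real_derivative power_field_partial p \<epsilon> A a a' \<alpha> i x) (at (x i))"
      by (rule DERIV_cong) (simp add: power_field_partial_def sum_distrib_left[symmetric] mult_ac)
  qed
qed

lemma abs_sum_mult_le_L2: "\<bar>\<Sum>i\<in>A. f i * g i\<bar> \<le> L2_set f A * L2_set g A"
proof -
  have "\<bar>\<Sum>i\<in>A. f i * g i\<bar> \<le> (\<Sum>i\<in>A. \<bar>f i\<bar> * \<bar>g i\<bar>)"
    unfolding abs_mult[symmetric] by (rule sum_abs)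
  also have "\<dots> \<le> L2_set f A * L2_set g A" by (rule L2_set_mult_ineq)
  finally show ?thesis .
qed

lemma L2_set_product:
  "L2_set (\<lambda>i. L2_set (\<lambda>\<alpha>. w \<alpha> i) A) I = L2_set (\<lambda>(\<alpha>, i). w \<alpha> i) (A \<times> I)"
proof -
  have "(\<Sum>i\<in>I. \<Sum>\<alpha>\<in>A. (w \<alpha> i)\<^sup>2) = (\<Sum>\<alpha>\<in>A. \<Sum>i\<in>I. (w \<alpha> i)\<^sup>2)" by (rule sum.swap)
  also have "\<dots> = (\<Sum>(\<alpha>, i)\<in>A \<times> I. (w \<alpha> i)\<^sup>2)" by (rule sum.cartesian_product)
  finally show ?thesis by (simp add: L2_set_def sum_nonneg case_prod_unfold)
qed

text \<open>
  The derivative of \<open>z \<mapsto> \<bar>z\<bar>\<^bsup>p-2\<^esup> z\<close> has operator norm \<open>(p - 1) \<bar>z\<bar>\<^bsup>p-2\<^esup>\<close>: a multiple \<open>\<bar>z\<bar>\<^bsup>p-2\<^esup>\<close> of the identity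
  plus a rank-one part that contributes \<open>(p - 2) \<bar>z\<bar>\<^bsup>p-2\<^esup>\<close>. Cauchy-Schwarz is used for either part, and
  \<open>\<bar>a\<bar>\<^sup>2 \<le> \<bar>a\<bar>\<^sup>2 + \<epsilon>\<close> absorbs the regularisation.
\<close>

lemma power_field_partial_bound:
  assumes "p \<ge> 2" "\<epsilon> > 0"
  shows "(\<Sum>\<alpha>\<in>A. \<Sum>i<n. w \<alpha> i * power_field_partial p \<epsilon> A a a' \<alpha> i x)
    \<le> (p - 1) * reg_norm2 \<epsilon> A a x powr ((p - 2) / 2)
        * (L2_set (\<lambda>(\<alpha>, i). w \<alpha> i) (A \<times> {..<n}) * L2_set (\<lambda>(\<alpha>, i). a' \<alpha> i x) (A \<times> {..<n}))"
proof -
  define S where "S = reg_norm2 \<epsilon> A a x"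
  define P where "P = S powr ((p - 2) / 2)"
  define Q where "Q = S powr ((p - 2) / 2 - 1)"
  define L where "L = L2_set (\<lambda>\<alpha>. a \<alpha> x) A"
  define w1 where "w1 i = L2_set (\<lambda>\<alpha>. w \<alpha> i) A" for i
  define a1 where "a1 i = L2_set (\<lambda>\<alpha>. a' \<alpha> i x) A" for i
  define W where "W = L2_set (\<lambda>(\<alpha>, i). w \<alpha> i) (A \<times> {..<n})"
  define Z where "Z = L2_set (\<lambda>(\<alpha>, i). a' \<alpha> i x) (A \<times> {..<n})"
  have S: "S > 0" unfolding S_def by (rule reg_norm2_pos[OF assms(2)])
  have QS: "Q * S = P"
    unfolding Q_def P_def using S powr_add[of S "(p - 2) / 2 - 1" 1] by simp
  have LS: "L\<^sup>2 \<le> S" unfolding L_def S_def reg_norm2_L2 using assms(2) by simp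
  have "(\<Sum>\<alpha>\<in>A. \<Sum>i<n. w \<alpha> i * power_field_partial p \<epsilon> A a a' \<alpha> i x)
      = (\<Sum>\<alpha>\<in>A. \<Sum>i<n. (p - 2) * Q * ((\<Sum>\<beta>\<in>A. a \<beta> x * a' \<beta> i x) * (a \<alpha> x * w \<alpha> i)) + P * (w \<alpha> i * a' \<alpha> i x))"
    unfolding power_field_partial_def S_def[symmetric] P_def[symmetric] Q_def[symmetric]
    by (intro sum.cong refl) (simp add: algebra_simps)
  also have "\<dots> = (p - 2) * Q * (\<Sum>\<alpha>\<in>A. \<Sum>i<n. (\<Sum>\<beta>\<in>A. a \<beta> x * a' \<beta> i x) * (a \<alpha> x * w \<alpha> i))
      + P * (\<Sum>\<alpha>\<in>A. \<Sum>i<n. w \<alpha> i * a' \<alpha> i x)"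
    by (simp only: sum.distrib sum_distrib_left)
  also have "(\<Sum>\<alpha>\<in>A. \<Sum>i<n. (\<Sum>\<beta>\<in>A. a \<beta> x * a' \<beta> i x) * (a \<alpha> x * w \<alpha> i))
      = (\<Sum>i<n. (\<Sum>\<beta>\<in>A. a \<beta> x * a' \<beta> i x) * (\<Sum>\<alpha>\<in>A. a \<alpha> x * w \<alpha> i))"
    by (subst sum.swap) (simp only: sum_distrib_left)
  also have "\<dots> \<le> (\<Sum>i<n. L\<^sup>2 * (\<bar>a1 i\<bar> * \<bar>w1 i\<bar>))"
  proof (rule sum_mono)
    fix i
    have "(\<Sum>\<beta>\<in>A. a \<beta> x * a' \<beta> i x) * (\<Sum>\<alpha>\<in>A. a \<alpha> x * w \<alpha> i)
       \<le> \<bar>\<Sum>\<beta>\<in>A. a \<beta> x * a' \<beta> i x\<bar> * \<bar>\<Sum>\<alpha>\<in>A. a \<alpha> x * w \<alpha> i\<bar>"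
      unfolding abs_mult[symmetric] by (rule abs_ge_self)
    also have "\<dots> \<le> (L * a1 i) * (L * w1 i)"
      unfolding L_def a1_def w1_def by (intro mult_mono abs_sum_mult_le_L2) auto
    also have "\<dots> = L\<^sup>2 * (\<bar>a1 i\<bar> * \<bar>w1 i\<bar>)" by (simp add: power2_eq_square a1_def w1_def)
    finally show "(\<Sum>\<beta>\<in>A. a \<beta> x * a' \<beta> i x) * (\<Sum>\<alpha>\<in>A. a \<alpha> x * w \<alpha> i) \<le> L\<^sup>2 * (\<bar>a1 i\<bar> * \<bar>w1 i\<bar>)" .
  qed
  also have "\<dots> = L\<^sup>2 * (\<Sum>i<n. \<bar>a1 i\<bar> * \<bar>w1 i\<bar>)" by (simp only: sum_distrib_left)
  also have "\<dots> \<le> S * (Z * W)"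
  proof (intro mult_mono LS)
    have "(\<Sum>i<n. \<bar>a1 i\<bar> * \<bar>w1 i\<bar>) \<le> L2_set a1 {..<n} * L2_set w1 {..<n}" by (rule L2_set_mult_ineq)
    also have "\<dots> = Z * W" unfolding a1_def w1_def L2_set_product Z_def W_def ..
    finally show "(\<Sum>i<n. \<bar>a1 i\<bar> * \<bar>w1 i\<bar>) \<le> Z * W" .
  qed (use S in \<open>auto intro!: sum_nonneg\<close>)
  finally have 1: "(\<Sum>\<alpha>\<in>A. \<Sum>i<n. w \<alpha> i * power_field_partial p \<epsilon> A a a' \<alpha> i x)
      \<le> (p - 2) * Q * (S * (Z * W)) + P * (\<Sum>\<alpha>\<in>A. \<Sum>i<n. w \<alpha> i * a' \<alpha> i x)"
    using assms(1) by (simp add: mult_left_mono Q_def)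
  have "(\<Sum>\<alpha>\<in>A. \<Sum>i<n. w \<alpha> i * a' \<alpha> i x) = (\<Sum>p\<in>A \<times> {..<n}. (case p of (\<alpha>, i) \<Rightarrow> w \<alpha> i) * (case p of (\<alpha>, i) \<Rightarrow> a' \<alpha> i x))"
    by (simp add: sum.cartesian_product case_prod_unfold)
  also have "\<dots> \<le> W * Z"
    unfolding W_def Z_def by (rule abs_le_D1[OF abs_sum_mult_le_L2])
  finally have "P * (\<Sum>\<alpha>\<in>A. \<Sum>i<n. w \<alpha> i * a' \<alpha> i x) \<le> P * (W * Z)"
    by (rule mult_left_mono) (simp add: P_def)
  moreover have "(p - 2) * Q * (S * (Z * W)) = (p - 2) * P * (W * Z)"
    unfolding QS[symmetric] by (simp add: mult_ac)
  ultimately have "(\<Sum>\<alpha>\<in>A. \<Sum>i<n. w \<alpha> i * power_field_partial p \<epsilon> A a a' \<alpha> i x) \<le> (p - 2) * P * (W * Z) + P * (W * Z)"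
    using 1 by linarith
  also have "\<dots> = (p - 1) * P * (W * Z)" by (simp add: algebra_simps)
  finally show ?thesis unfolding P_def S_def W_def Z_def .
qed

text \<open>
  The common end of the two arguments that test with \<open>power_field\<close>. Without regularisation the
  hypothesis reads \<open>\<parallel>a\<parallel>\<^sub>p\<^sup>p \<le> c \<parallel>a\<parallel>\<^sub>p\<^bsup>p-2\<^esup> D\<^sup>2\<close>, from which \<open>\<parallel>a\<parallel>\<^sub>p\<^bsup>p-2\<^esup>\<close> cancels. By Minkowski's inequality the
  regularised norm exceeds \<open>\<parallel>a\<parallel>\<^sub>p\<close> by at most \<open>\<surd>\<epsilon>\<close>, so that the limit \<open>\<epsilon> \<rightarrow> 0\<close> is a limit of numbers and no
  integral has to be passed to the limit.
\<close>

lemma absorb_regularisation: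
  fixes a :: "'i \<Rightarrow> (nat \<Rightarrow> real) \<Rightarrow> real"
  assumes a: "\<And>\<alpha>. \<alpha> \<in> A \<Longrightarrow> tame n (a \<alpha>)" and p: "p \<ge> 2" and nn: "c \<ge> 0" "D \<ge> 0"
    and bound: "\<And>\<epsilon>. \<epsilon> > 0 \<Longrightarrow>
      (\<Sum>\<alpha>\<in>A. \<integral>x. power_field p \<epsilon> A a \<alpha> x * a \<alpha> x \<partial>gauss)
        \<le> c * (\<integral>x. reg_norm2 \<epsilon> A a x powr (p / 2) \<partial>gauss) powr (1 - 2 / p) * D\<^sup>2"
  shows "Lq_norm gauss p (\<lambda>x. L2_set (\<lambda>\<alpha>. a \<alpha> x) A) \<le> sqrt c * D"
proof -
  define L where "L x = L2_set (\<lambda>\<alpha>. a \<alpha> x) A" for x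
  have tL: "tame n L" unfolding L_def[abs_def] using a by (rule tame_L2_set)
  have Lnn: "L x \<ge> 0" for x by (simp add: L_def)
  define I where "I = Lq_norm gauss p L"
  have I0: "I \<ge> 0" by (simp add: I_def)
  have Ip: "I powr p = (\<integral>x. L x powr p \<partial>gauss)"
    unfolding I_def using p Lnn by (subst Lq_norm_powr) auto
  \<comment> \<open>The regularisation is \<open>\<epsilon> = e\<^sup>2\<close>, so that \<open>\<bar>a\<bar>\<^sup>2 + \<epsilon> \<le> (\<bar>a\<bar> + e)\<^sup>2\<close>.\<close>
  have main: "I powr p \<le> c * (I + e) powr (p - 2) * D\<^sup>2" if e: "e > 0" for e
  proof -
    have e2: "e\<^sup>2 > 0" using e by simp
    define S where "S = reg_norm2 (e\<^sup>2) A a"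
    have S: "S x = (L x)\<^sup>2 + e\<^sup>2" for x unfolding S_def L_def by (rule reg_norm2_L2)
    have tS: "tame n (\<lambda>x. S x powr r)" for r
      unfolding S_def by (rule tame_powr_bounded_below[OF tame_reg_norm2[OF a] reg_norm2_ge e2])
    have "I powr p \<le> (\<integral>x. S x powr ((p - 2) / 2) * (L x)\<^sup>2 \<partial>gauss)"
      unfolding Ip
    proof (rule integral_mono)
      show "integrable gauss (\<lambda>x. L x powr p)"
        using p Lnn by (intro tame_integrable[OF tame_powr[OF tL]]) auto
      show "integrable gauss (\<lambda>x. S x powr ((p - 2) / 2) * (L x)\<^sup>2)"
        by (intro tame_integrable[OF tame_mult[OF tS tame_power[OF tL]]])
      show "L x powr p \<le> S x powr ((p - 2) / 2) * (L x)\<^sup>2" for x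
      proof (cases "L x = 0")
        case False
        then have pos: "L x > 0" using Lnn[of x] by simp
        have "L x powr p = ((L x)\<^sup>2) powr ((p - 2) / 2) * (L x)\<^sup>2"
        proof -
          have "((L x)\<^sup>2) powr ((p - 2) / 2) = (L x powr 2) powr ((p - 2) / 2)" using pos by simp
          also have "\<dots> = L x powr (p - 2)"
            unfolding powr_powr by (rule arg_cong[where f="\<lambda>r. L x powr r"]) simp
          finally have "((L x)\<^sup>2) powr ((p - 2) / 2) = L x powr (p - 2)" .
          then show ?thesis using pos powr_add[of "L x" "p - 2" 2] by simp
        qed
        also have "\<dots> \<le> S x powr ((p - 2) / 2) * (L x)\<^sup>2"
          using p by (intro mult_right_mono powr_mono2) (auto simp: S)
        finally show ?thesis .
      qed simp
    qed
    also have "\<dots> = (\<Sum>\<alpha>\<in>A. \<integral>x. power_field p (e\<^sup>2) A a \<alpha> x * a \<alpha> x \<partial>gauss)"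
    proof -
      have "S x powr ((p - 2) / 2) * (L x)\<^sup>2 = (\<Sum>\<alpha>\<in>A. power_field p (e\<^sup>2) A a \<alpha> x * a \<alpha> x)" for x
        by (simp add: power_field_def S_def L_def L2_set_def sum_nonneg sum_distrib_left power2_eq_square mult.assoc)
      moreover have "integrable gauss (\<lambda>x. power_field p (e\<^sup>2) A a \<alpha> x * a \<alpha> x)" if "\<alpha> \<in> A" for \<alpha>
        unfolding power_field_def S_def[symmetric]
        by (intro tame_integrable[of n] tame_mult tS a that)
      ultimately show ?thesis by (simp add: Bochner_Integration.integral_sum)
    qed
    also have "\<dots> \<le> c * (\<integral>x. S x powr (p / 2) \<partial>gauss) powr (1 - 2 / p) * D\<^sup>2"
      unfolding S_def by (rule bound[OF e2])
    also have "\<dots> \<le> c * (I + e) powr (p - 2) * D\<^sup>2"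
    proof (intro mult_right_mono mult_left_mono nn zero_le_power2)
      have "Lq_norm gauss p (\<lambda>x. S x powr (1 / 2)) \<le> Lq_norm gauss p L + Lq_norm gauss p (\<lambda>_. e)"
      proof (rule Lq_norm_triangle[OF tL tame_const tS])
        show "\<bar>S x powr (1 / 2)\<bar> \<le> \<bar>L x\<bar> + \<bar>e\<bar>" for x
          unfolding S using sqrt_sum_squares_le_sum_abs[of "L x" e] by (simp add: powr_half_sqrt)
      qed (use p in simp)
      also have "\<dots> = I + e" using p e by (simp add: I_def Lq_norm_const)
      finally have le: "Lq_norm gauss p (\<lambda>x. S x powr (1 / 2)) \<le> I + e" .
      have "(\<integral>x. S x powr (p / 2) \<partial>gauss) powr (1 - 2 / p) = Lq_norm gauss p (\<lambda>x. S x powr (1 / 2)) powr (p - 2)"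
        unfolding Lq_norm_def using p by (simp add: powr_powr field_simps)
      also have "\<dots> \<le> (I + e) powr (p - 2)" using le p by (intro powr_mono2) auto
      finally show "(\<integral>x. S x powr (p / 2) \<partial>gauss) powr (1 - 2 / p) \<le> (I + e) powr (p - 2)" .
    qed
    finally show ?thesis .
  qed
  show ?thesis
  proof (cases "I = 0")
    case True
    then show ?thesis using nn by (simp add: I_def L_def[abs_def])
  next
    case False
    then have Ipos: "I > 0" using I0 by simp
    have "((\<lambda>e. c * (I + e) powr (p - 2) * D\<^sup>2) \<longlongrightarrow> c * (I + 0) powr (p - 2) * D\<^sup>2) (at_right 0)"
      using Ipos by (intro tendsto_intros) auto
    moreover have "\<forall>\<^sub>F e in at_right 0. I powr p \<le> c * (I + e) powr (p - 2) * D\<^sup>2"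
      by (rule eventually_at_right_less[THEN eventually_mono]) (rule main)
    ultimately have "I powr p \<le> c * (I + 0) powr (p - 2) * D\<^sup>2"
      by (rule tendsto_lowerbound) simp
    also have "I powr p = I powr (p - 2) * I\<^sup>2" using Ipos powr_add[of I "p - 2" 2] by simp
    finally have "I powr (p - 2) * I\<^sup>2 \<le> I powr (p - 2) * (c * D\<^sup>2)" by (simp add: mult_ac)
    then have "I\<^sup>2 \<le> c * D\<^sup>2" using Ipos by (simp only: mult_le_cancel_left_pos powr_gt_zero)
    then have "sqrt (I\<^sup>2) \<le> sqrt (c * D\<^sup>2)" by (rule real_sqrt_le_mono)
    then show ?thesis using nn I0 by (simp add: real_sqrt_mult I_def L_def[abs_def])
  qed
qed

text \<open>
  Hoelder's inequality with exponents \<open>p / (p - 2)\<close> and \<open>p / 2\<close>; for \<open>p = 2\<close> the weight is \<open>1\<close>.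
\<close>

lemma integral_weight_le:
  assumes p: "p \<ge> 2" and S: "tame n S" "\<And>x. S x > 0" "\<And>r. tame n (\<lambda>x. S x powr r)" 
    and Q: "tame n Q" "\<And>x. Q x \<ge> 0"
  shows "(\<integral>x. S x powr ((p - 2) / 2) * (Q x)\<^sup>2 \<partial>gauss)
    \<le> (\<integral>x. S x powr (p / 2) \<partial>gauss) powr (1 - 2 / p) * (Lq_norm gauss p Q)\<^sup>2"
proof (cases "p = 2")
  case True
  have "Lq_norm gauss 2 Q powr 2 = (\<integral>x. norm (Q x) powr 2 \<partial>gauss)" by (rule Lq_norm_powr) simp
  also have "\<dots> = (\<integral>x. (Q x)\<^sup>2 \<partial>gauss)" using Q(2) by simp
  finally have *: "(Lq_norm gauss 2 Q)\<^sup>2 = (\<integral>x. (Q x)\<^sup>2 \<partial>gauss)" by simp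
  have "(\<integral>x. S x powr (p / 2) \<partial>gauss) \<noteq> 0"
  proof
    assume "(\<integral>x. S x powr (p / 2) \<partial>gauss) = 0"
    then have "AE x in gauss. S x powr (p / 2) = 0"
      using integral_nonneg_eq_0_iff_AE[OF tame_integrable[OF S(3)]] by simp
    then have "AE x in gauss. False"
      by (rule eventually_mono) (use S(2) in \<open>metis powr_eq_0_iff less_irrefl\<close>)
    then show False by simp
  qed
  then have e2: "(\<integral>x. S x powr (p / 2) \<partial>gauss) powr (1 - 2 / p) = 1" using True by simp
  have e1: "S x powr ((p - 2) / 2) = 1" for x using S(2)[of x] True by simp
  show ?thesis unfolding e1 e2 using True * by simp
next
  case False
  then have p2: "p > 2" using p by simp
  have "(\<integral>x. (S x powr (p / 2)) powr (1 - 2 / p) * (Q x powr p) powr (2 / p) \<partial>gauss)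
     \<le> (\<integral>x. S x powr (p / 2) \<partial>gauss) powr (1 - 2 / p) * (\<integral>x. Q x powr p \<partial>gauss) powr (2 / p)"
    using p2 by (intro integral_powr_interpolation tame_integrable[OF S(3)] tame_integrable[OF tame_powr[OF Q(1) _ Q(2)]]) auto
  moreover have "(S x powr (p / 2)) powr (1 - 2 / p) = S x powr ((p - 2) / 2)" for x
  proof -
    have "p / 2 * (1 - 2 / p) = (p - 2) / 2" using p2 by (simp add: field_simps)
    then show ?thesis by (simp only: powr_powr)
  qed
  moreover have "(Q x powr p) powr (2 / p) = (Q x)\<^sup>2" for x
    using p2 Q(2)[of x] by (cases "Q x = 0") (simp_all add: powr_powr)
  moreover have "(\<integral>x. Q x powr p \<partial>gauss) powr (2 / p) = (Lq_norm gauss p Q)\<^sup>2"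
  proof -
    have "(Lq_norm gauss p Q)\<^sup>2 = Lq_norm gauss p Q powr 2" by simp
    also have "\<dots> = (\<integral>x. Q x powr p \<partial>gauss) powr (2 / p)"
      unfolding Lq_norm_def using Q(2) by (simp add: powr_powr)
    finally show ?thesis ..
  qed
  ultimately show ?thesis by simp
qed

section \<open>The Poincare inequality\<close>

lemma tame_double: "tame n f \<Longrightarrow> tame (2 * n) f"
  by (erule tame_mono) simp

lemma tame_cong: "tame n f \<Longrightarrow> \<forall>i<n. x i = y i \<Longrightarrow> f x = f y"
  unfolding tame_def depends_on_first_def by blast

lemma depends_on_first_combine:
  assumes "tame n f" "tame n g" "tame n k"
  shows "depends_on_first n (\<lambda>x. h (f x) (g x) (k x))"
  unfolding depends_on_first_def
proof (intro allI impI)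
  fix x y :: "nat \<Rightarrow> real" assume "\<forall>i<n. x i = y i"
  then have "f x = f y" "g x = g y" "k x = k y" using assms tame_cong by blast+
  then show "h (f x) (g x) (k x) = h (f y) (g y) (k y)" by simp
qed

lemma gauss_integral_sum:
  "(\<And>i. i \<in> I \<Longrightarrow> tame n (f i)) \<Longrightarrow> (\<integral>x. (\<Sum>i\<in>I. f i x) \<partial>gauss) = (\<Sum>i\<in>I. \<integral>x. f i x \<partial>gauss)"
  by (rule Bochner_Integration.integral_sum) (rule tame_integrable)

lemma gauss_integral_sum2:
  assumes "\<And>\<alpha> i. \<alpha> \<in> A \<Longrightarrow> i \<in> I \<Longrightarrow> tame n (f \<alpha> i)"
  shows "(\<integral>x. (\<Sum>\<alpha>\<in>A. \<Sum>i\<in>I. f \<alpha> i x) \<partial>gauss) = (\<Sum>\<alpha>\<in>A. \<Sum>i\<in>I. \<integral>x. f \<alpha> i x \<partial>gauss)"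
proof -
  have "(\<integral>x. (\<Sum>\<alpha>\<in>A. \<Sum>i\<in>I. f \<alpha> i x) \<partial>gauss) = (\<Sum>\<alpha>\<in>A. \<integral>x. (\<Sum>i\<in>I. f \<alpha> i x) \<partial>gauss)"
    by (rule gauss_integral_sum[where n=n]) (rule tame_sum, rule assms)
  also have "\<dots> = (\<Sum>\<alpha>\<in>A. \<Sum>i\<in>I. \<integral>x. f \<alpha> i x \<partial>gauss)"
    by (rule sum.cong[OF refl], rule gauss_integral_sum[where n=n], rule assms)
  finally show ?thesis .
qed

text \<open>
  The rotation formula in the form in which it is used: a bound that holds at each angle is
  integrated, with \<open>c = 1\<close> for \<open>q < 2\<close> and \<open>c = cos\<close> for \<open>q \<ge> 2\<close>.
\<close>

lemma rotation_inequality: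
  assumes fin: "finite A" and g: "\<And>\<alpha>. \<alpha> \<in> A \<Longrightarrow> tame n (g \<alpha>)" and f: "\<And>\<alpha>. \<alpha> \<in> A \<Longrightarrow> C1_partials n (f \<alpha>) (f' \<alpha>)"
    and c: "\<And>\<theta>. isCont c \<theta>" "\<And>\<theta>. (C has_real_derivative c \<theta>) (at \<theta>)"
    and bound: "\<And>\<theta>. 0 \<le> \<theta> \<Longrightarrow> \<theta> \<le> pi / 2 \<Longrightarrow>
      (\<Sum>\<alpha>\<in>A. \<integral>x. g \<alpha> (rot n \<theta> x) * (\<Sum>i<n. f' \<alpha> i x * x (n + i)) \<partial>gauss) \<le> K * c \<theta>"
  shows "(\<Sum>\<alpha>\<in>A. \<integral>x. g \<alpha> x * (f \<alpha> x - (\<integral>y. f \<alpha> y \<partial>gauss)) \<partial>gauss) \<le> K * (C (pi / 2) - C 0)"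
proof -
  define R where "R \<alpha> \<theta> = (\<integral>x. g \<alpha> (rot n \<theta> x) * (\<Sum>i<n. f' \<alpha> i x * x (n + i)) \<partial>gauss)" for \<alpha> \<theta>
  have intR: "integrable lborel (\<lambda>\<theta>. R \<alpha> \<theta> * indicator {0..pi/2} \<theta>)" if "\<alpha> \<in> A" for \<alpha>
    unfolding R_def using rotation_formula_integrable[OF g[OF that] f[OF that]] .
  have intc: "integrable lborel (\<lambda>\<theta>. c \<theta> * indicator {0..pi/2} \<theta>)"
    using borel_integrable_atLeastAtMost[of 0 "pi/2" c] c(1) by (simp add: mult.commute)
  have "(\<Sum>\<alpha>\<in>A. \<integral>x. g \<alpha> x * (f \<alpha> x - (\<integral>y. f \<alpha> y \<partial>gauss)) \<partial>gauss)
      = (\<Sum>\<alpha>\<in>A. \<integral>\<theta>. R \<alpha> \<theta> * indicator {0..pi/2} \<theta> \<partial>lborel)"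
    unfolding R_def by (intro sum.cong refl rotation_formula g f)
  also have "\<dots> = (\<integral>\<theta>. (\<Sum>\<alpha>\<in>A. R \<alpha> \<theta> * indicator {0..pi/2} \<theta>) \<partial>lborel)"
    by (rule Bochner_Integration.integral_sum[symmetric]) (rule intR)
  also have "\<dots> \<le> (\<integral>\<theta>. K * (c \<theta> * indicator {0..pi/2} \<theta>) \<partial>lborel)"
  proof (rule integral_mono)
    show "integrable lborel (\<lambda>\<theta>. \<Sum>\<alpha>\<in>A. R \<alpha> \<theta> * indicator {0..pi/2} \<theta>)"
      by (rule Bochner_Integration.integrable_sum) (rule intR)
    show "integrable lborel (\<lambda>\<theta>. K * (c \<theta> * indicator {0..pi/2} \<theta>))"
      using intc by (rule integrable_mult_right)
    show "(\<Sum>\<alpha>\<in>A. R \<alpha> \<theta> * indicator {0..pi/2} \<theta>) \<le> K * (c \<theta> * indicator {0..pi/2} \<theta>)" for \<theta>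
      using bound[of \<theta>] by (cases "\<theta> \<in> {0..pi/2}") (auto simp: R_def)
  qed
  also have "\<dots> = K * (C (pi / 2) - C 0)"
  proof -
    have "(\<integral>\<theta>. c \<theta> * indicator {0..pi/2} \<theta> \<partial>lborel) = C (pi / 2) - C 0"
      by (rule integral_FTC_Icc_real) (use c in auto)
    then show ?thesis by simp
  qed
  finally show ?thesis .
qed

text \<open>
  Conditionally on the first block, the covariance of the second one is the identity matrix.
\<close>

lemma integral_coordinates_orthonormal:
  assumes h: "tame n h" and ij: "i < n" "j < n"
  shows "(\<integral>x. h x * (x (n + i) * x (n + j)) \<partial>gauss) = (if i = j then \<integral>x. h x \<partial>gauss else 0)"
proof -
  define g' where "g' x = (if i = j then h x else 0)" for x :: "nat \<Rightarrow> real"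
  have th: "tame (2 * n) h" by (rule tame_double[OF h])
  have hu: "h (x(n + i := t)) = h x" for x t
    using h unfolding tame_def depends_on_first_def by simp
  have "(\<integral>x. x (n + i) * (h x * x (n + j)) \<partial>gauss) = (\<integral>x. g' x \<partial>gauss)"
  proof (rule gauss_integration_by_parts[where n="2 * n"])
    show "tame (2 * n) (\<lambda>x. h x * x (n + j))" using th ij by (intro tame_mult tame_coordinate) auto
    show "tame (2 * n) g'" unfolding g'_def using th by (cases "i = j") auto
    show "n + i < 2 * n" using ij by simp
    show "((\<lambda>t. h (x(n + i := t)) * (x(n + i := t)) (n + j)) has_real_derivative g' (x(n + i := t))) (at t)" for x t
      unfolding hu g'_def by (cases "i = j") (auto intro!: derivative_eq_intros)
    show "continuous_on UNIV (\<lambda>t. g' (x(n + i := t)))" for x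
      unfolding hu g'_def by simp
  qed
  then show ?thesis by (simp add: g'_def mult_ac)
qed

text \<open>
  Given \<open>x\<close>, the vector with coordinates \<open>\<Sum>\<^sub>i a \<alpha> i x * y\<^sub>i\<close> has second moment \<open>Q(x)\<^sup>2\<close>, where \<open>Q\<close> is
  the Euclidean norm of \<open>a\<close>, hence a \<open>q\<close>-th moment of at most \<open>Q(x)\<^sup>q\<close>. In place of conditioning, Young's
  inequality bounds \<open>N\<^sup>q\<close> by a combination of \<open>Q\<^sup>q\<close> and \<open>Q\<^bsup>q-2\<^esup> N\<^sup>2\<close>, and these have the same expectation.
\<close>

lemma gaussian_moment_le:
  assumes fin: "finite A" and a: "\<And>\<alpha> i. \<alpha> \<in> A \<Longrightarrow> i < n \<Longrightarrow> tame n (a \<alpha> i)" and q: "1 < q" "q \<le> 2"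
  shows "Lq_norm gauss q (\<lambda>x. L2_set (\<lambda>\<alpha>. \<Sum>i<n. a \<alpha> i x * x (n + i)) A)
    \<le> Lq_norm gauss q (\<lambda>x. L2_set (\<lambda>(\<alpha>, i). a \<alpha> i x) (A \<times> {..<n}))"
proof -
  define Z where "Z \<alpha> x = (\<Sum>i<n. a \<alpha> i x * x (n + i))" for \<alpha> x
  define N where "N x = L2_set (\<lambda>\<alpha>. Z \<alpha> x) A" for x
  define Q where "Q x = L2_set (\<lambda>(\<alpha>, i). a \<alpha> i x) (A \<times> {..<n})" for x
  \<comment> \<open>Where \<open>Q = 0\<close> the weight has the value 0 by convention; there \<open>N = 0\<close> as well.\<close>
  define w where "w x = Q x powr (q - 2)" for x
  have ta2: "tame (2 * n) (a \<alpha> i)" if "\<alpha> \<in> A" "i < n" for \<alpha> i by (rule tame_double[OF a[OF that]])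
  have tQ: "tame n Q" unfolding Q_def[abs_def] by (rule tame_L2_set) (clarsimp simp: a)
  have tQ2: "tame (2 * n) Q" by (rule tame_double[OF tQ])
  have tZ: "tame (2 * n) (Z \<alpha>)" if "\<alpha> \<in> A" for \<alpha>
    unfolding Z_def[abs_def] using that by (intro tame_sum tame_mult ta2 tame_coordinate) auto
  have tN: "tame (2 * n) N" unfolding N_def[abs_def] by (rule tame_L2_set) (rule tZ)
  have Q0: "Q x \<ge> 0" "N x \<ge> 0" for x by (auto simp: Q_def N_def)
  have aQ: "\<bar>a \<alpha> i x\<bar> \<le> Q x" if "\<alpha> \<in> A" "i < n" for \<alpha> i x
  proof -
    have "\<bar>a \<alpha> i x\<bar> \<le> L2_set (\<lambda>p. \<bar>case p of (\<alpha>, i) \<Rightarrow> a \<alpha> i x\<bar>) (A \<times> {..<n})"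
      using member_le_L2_set[of "A \<times> {..<n}" "(\<alpha>, i)" "\<lambda>p. \<bar>case p of (\<alpha>, i) \<Rightarrow> a \<alpha> i x\<bar>"] fin that by simp
    then show ?thesis by (simp add: Q_def L2_set_def)
  qed
  have Q2: "w x * (Q x)\<^sup>2 = Q x powr q" for x
  proof (cases "Q x = 0")
    case False
    then have "Q x > 0" using Q0(1)[of x] by simp
    then show ?thesis using powr_add[of "Q x" "q - 2" 2] by (simp add: w_def)
  qed (use q in \<open>simp add: w_def\<close>)
  have twaa: "tame n (\<lambda>x. w x * (a \<alpha> i x * a \<alpha> j x))" if "\<alpha> \<in> A" "i < n" "j < n" for \<alpha> i j
  proof (rule tame_bound)
    show "tame n (\<lambda>x. Q x powr q)" using q Q0 by (intro tame_powr tQ) auto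
    show "(\<lambda>x. w x * (a \<alpha> i x * a \<alpha> j x)) \<in> borel_measurable borel"
      unfolding w_def using tame_measurable[OF tQ] tame_measurable[OF a] that by simp
    show "depends_on_first n (\<lambda>x. w x * (a \<alpha> i x * a \<alpha> j x))"
      unfolding w_def
      by (rule depends_on_first_combine[OF tQ a[OF that(1,2)] a[OF that(1,3)], of "\<lambda>u v z. u powr (q - 2) * (v * z)"])
    fix x
    have "\<bar>w x * (a \<alpha> i x * a \<alpha> j x)\<bar> \<le> w x * (Q x * Q x)"
      unfolding abs_mult using aQ that Q0 by (intro mult_mono) (auto simp: w_def)
    also have "\<dots> = Q x powr q" using Q2[of x] by (simp add: power2_eq_square)
    finally show "\<bar>w x * (a \<alpha> i x * a \<alpha> j x)\<bar> \<le> \<bar>Q x powr q\<bar>" by simp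
  qed
  have zero: "N x = 0" if "Q x = 0" for x
  proof -
    have "a \<alpha> i x = 0" if "\<alpha> \<in> A" "i < n" for \<alpha> i using aQ[OF that, of x] \<open>Q x = 0\<close> by simp
    then show ?thesis by (simp add: N_def Z_def L2_set_def)
  qed
  have N2: "(N x)\<^sup>2 = (\<Sum>\<alpha>\<in>A. \<Sum>i<n. \<Sum>j<n. (a \<alpha> i x * a \<alpha> j x) * (x (n + i) * x (n + j)))" for x
  proof -
    have "(N x)\<^sup>2 = (\<Sum>\<alpha>\<in>A. Z \<alpha> x * Z \<alpha> x)" by (simp add: N_def L2_set_def sum_nonneg power2_eq_square)
    then show ?thesis by (simp add: Z_def sum_product mult_ac)
  qed
  have wN2: "w x * (N x)\<^sup>2 = (\<Sum>\<alpha>\<in>A. \<Sum>i<n. \<Sum>j<n. (w x * (a \<alpha> i x * a \<alpha> j x)) * (x (n + i) * x (n + j)))" for x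
    unfolding N2 by (simp add: sum_distrib_left mult.assoc)
  have tterm: "tame (2 * n) (\<lambda>x. (w x * (a \<alpha> i x * a \<alpha> j x)) * (x (n + i) * x (n + j)))"
    if "\<alpha> \<in> A" "i < n" "j < n" for \<alpha> i j
    by (rule tame_mult[OF tame_double[OF twaa[OF that]] tame_mult[OF tame_coordinate tame_coordinate]]) (use that in auto)
  have EwN2: "(\<integral>x. w x * (N x)\<^sup>2 \<partial>gauss) = (\<integral>x. Q x powr q \<partial>gauss)"
  proof -
    have "(\<integral>x. w x * (N x)\<^sup>2 \<partial>gauss) = (\<Sum>\<alpha>\<in>A. \<Sum>i<n. \<Sum>j<n. \<integral>x. (w x * (a \<alpha> i x * a \<alpha> j x)) * (x (n + i) * x (n + j)) \<partial>gauss)"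
    proof -
      have "(\<integral>x. w x * (N x)\<^sup>2 \<partial>gauss) = (\<Sum>\<alpha>\<in>A. \<Sum>i<n. \<integral>x. (\<Sum>j<n. (w x * (a \<alpha> i x * a \<alpha> j x)) * (x (n + i) * x (n + j))) \<partial>gauss)"
        unfolding wN2 by (rule gauss_integral_sum2[where n="2 * n"], rule tame_sum, rule tterm) auto
      also have "\<dots> = (\<Sum>\<alpha>\<in>A. \<Sum>i<n. \<Sum>j<n. \<integral>x. (w x * (a \<alpha> i x * a \<alpha> j x)) * (x (n + i) * x (n + j)) \<partial>gauss)"
        by (rule sum.cong[OF refl], rule sum.cong[OF refl], rule gauss_integral_sum[where n="2 * n"], rule tterm) auto
      finally show ?thesis .
    qed
    also have "\<dots> = (\<Sum>\<alpha>\<in>A. \<Sum>i<n. \<Sum>j<n. if i = j then \<integral>x. w x * (a \<alpha> i x * a \<alpha> j x) \<partial>gauss else 0)"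
      by (intro sum.cong refl integral_coordinates_orthonormal twaa) auto
    also have "\<dots> = (\<Sum>\<alpha>\<in>A. \<Sum>i<n. \<integral>x. w x * (a \<alpha> i x * a \<alpha> i x) \<partial>gauss)" by simp
    also have "\<dots> = (\<integral>x. (\<Sum>\<alpha>\<in>A. \<Sum>i<n. w x * (a \<alpha> i x * a \<alpha> i x)) \<partial>gauss)"
      by (rule gauss_integral_sum2[symmetric, where n=n], rule twaa) auto
    also have "\<dots> = (\<integral>x. w x * (Q x)\<^sup>2 \<partial>gauss)"
    proof (rule Bochner_Integration.integral_cong[OF refl])
      fix x
      have "(Q x)\<^sup>2 = (\<Sum>(\<alpha>, i)\<in>A \<times> {..<n}. (a \<alpha> i x)\<^sup>2)"
        by (simp add: Q_def L2_set_def sum_nonneg case_prod_unfold)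
      also have "\<dots> = (\<Sum>\<alpha>\<in>A. \<Sum>i<n. (a \<alpha> i x)\<^sup>2)" by (rule sum.cartesian_product[symmetric])
      finally show "(\<Sum>\<alpha>\<in>A. \<Sum>i<n. w x * (a \<alpha> i x * a \<alpha> i x)) = w x * (Q x)\<^sup>2"
        by (simp add: sum_distrib_left power2_eq_square)
    qed
    also have "\<dots> = (\<integral>x. Q x powr q \<partial>gauss)" unfolding Q2 ..
    finally show ?thesis .
  qed
  have iwN2: "integrable gauss (\<lambda>x. w x * (N x)\<^sup>2)"
    unfolding wN2 by (rule tame_integrable[where n="2 * n"], rule tame_sum, rule tame_sum, rule tame_sum, rule tterm) auto
  have iQ: "integrable gauss (\<lambda>x. Q x powr q)" using q Q0 by (intro tame_integrable[OF tame_powr[OF tQ]]) auto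
  have "(\<integral>x. N x powr q \<partial>gauss) \<le> (\<integral>x. (1 - q / 2) * Q x powr q + (q / 2) * (w x * (N x)\<^sup>2) \<partial>gauss)"
  proof (rule integral_mono)
    show "integrable gauss (\<lambda>x. N x powr q)" using q Q0 by (intro tame_integrable[OF tame_powr[OF tN]]) auto
    show "integrable gauss (\<lambda>x. (1 - q / 2) * Q x powr q + (q / 2) * (w x * (N x)\<^sup>2))"
      using iQ iwN2 by auto
    fix x
    show "N x powr q \<le> (1 - q / 2) * Q x powr q + (q / 2) * (w x * (N x)\<^sup>2)"
    proof (cases "Q x = 0 \<or> N x = 0")
      case True
      then have "N x = 0" using zero by auto
      then show ?thesis using q by simp
    next
      case False
      then have pos: "Q x > 0" "N x > 0" using Q0[of x] by auto
      have "(Q x powr q) powr (1 - q / 2) * (w x * (N x)\<^sup>2) powr (q / 2) \<le> (1 - q / 2) * Q x powr q + (q / 2) * (w x * (N x)\<^sup>2)"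
        using q pos by (intro Youngs_inequality_0) (auto simp: w_def)
      moreover have "(Q x powr q) powr (1 - q / 2) * (w x * (N x)\<^sup>2) powr (q / 2) = N x powr q"
      proof -
        have "(w x * (N x)\<^sup>2) powr (q / 2) = Q x powr ((q - 2) * (q / 2)) * N x powr q"
          using pos powr_powr[of "N x" 2 "q / 2"] by (simp add: w_def powr_mult powr_powr)
        moreover have "(Q x powr q) powr (1 - q / 2) * Q x powr ((q - 2) * (q / 2)) = Q x powr 0"
          unfolding powr_powr powr_add[symmetric] by (rule arg_cong[where f="\<lambda>r. Q x powr r"]) (simp add: field_simps)
        ultimately show ?thesis using pos by (simp add: mult.assoc[symmetric])
      qed
      ultimately show ?thesis by simp
    qed
  qed
  also have "\<dots> = (1 - q / 2) * (\<integral>x. Q x powr q \<partial>gauss) + (q / 2) * (\<integral>x. Q x powr q \<partial>gauss)"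
    using iQ iwN2 by (simp add: EwN2)
  also have "\<dots> = (\<integral>x. Q x powr q \<partial>gauss)" by (simp add: algebra_simps)
  finally have "(\<integral>x. N x powr q \<partial>gauss) powr (1 / q) \<le> (\<integral>x. Q x powr q \<partial>gauss) powr (1 / q)"
    using q by (intro powr_mono2) (auto simp: integral_nonneg_AE)
  then show ?thesis
    using Q0 by (simp add: Lq_norm_def N_def Q_def Z_def)
qed

lemma poincare_small_exponent:
  assumes fin: "finite A" and f: "\<And>\<alpha>. \<alpha> \<in> A \<Longrightarrow> C1_partials n (f \<alpha>) (f' \<alpha>)" and q: "1 < q" "q \<le> 2"
  shows "Lq_norm gauss q (\<lambda>x. L2_set (\<lambda>\<alpha>. f \<alpha> x - (\<integral>y. f \<alpha> y \<partial>gauss)) A)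
    \<le> pi / 2 * Lq_norm gauss q (\<lambda>x. L2_set (\<lambda>(\<alpha>, i). f' \<alpha> i x) (A \<times> {..<n}))"
proof -
  define z where "z \<alpha> x = f \<alpha> x - (\<integral>y. f \<alpha> y \<partial>gauss)" for \<alpha> x
  define N where "N x = L2_set (\<lambda>\<alpha>. z \<alpha> x) A" for x
  \<comment> \<open>For \<open>q < 2\<close> the test function need not be differentiable at zeros of \<open>N\<close>; it is never differentiated.\<close>
  define g where "g \<alpha> x = N x powr (q - 2) * z \<alpha> x" for \<alpha> x
  define Z where "Z \<alpha> x = (\<Sum>i<n. f' \<alpha> i x * x (n + i))" for \<alpha> x
  define Y where "Y x = L2_set (\<lambda>\<alpha>. Z \<alpha> x) A" for x
  define q' where "q' = q / (q - 1)"
  have q': "q' > 1" "1 / q' + 1 / q = 1" unfolding q'_def using q by (auto simp: field_simps)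
  have tz: "tame n (z \<alpha>)" if "\<alpha> \<in> A" for \<alpha>
    unfolding z_def[abs_def] using C1_partialsD(1)[OF f[OF that]] by (intro tame_diff tame_const)
  have tN: "tame n N" unfolding N_def[abs_def] by (rule tame_L2_set) (rule tz)
  have tN2: "tame (2 * n) N" by (rule tame_double[OF tN])
  have nn: "N x \<ge> 0" "Y x \<ge> 0" for x by (auto simp: N_def Y_def)
  have tZ: "tame (2 * n) (Z \<alpha>)" if "\<alpha> \<in> A" for \<alpha>
    unfolding Z_def[abs_def] using that
    by (intro tame_sum tame_mult tame_coordinate tame_double[OF C1_partialsD(3)[OF f]]) auto
  have tY: "tame (2 * n) Y" unfolding Y_def[abs_def] by (rule tame_L2_set) (rule tZ)
  have L2g: "L2_set (\<lambda>\<alpha>. g \<alpha> x) A = N x powr (q - 1)" for x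
  proof -
    have "L2_set (\<lambda>\<alpha>. g \<alpha> x) A = N x powr (q - 2) * N x"
      unfolding g_def N_def by (rule L2_set_right_distrib[symmetric]) simp
    also have "\<dots> = N x powr (q - 1)"
      using nn(1)[of x] powr_add[of "N x" "q - 2" 1] by (cases "N x = 0") auto
    finally show ?thesis .
  qed
  have tNq: "tame n (\<lambda>x. N x powr (q - 1))" "tame (2 * n) (\<lambda>x. N x powr (q - 1))"
    using q nn by (auto intro!: tame_powr tN tN2)
  have tg: "tame n (g \<alpha>)" if "\<alpha> \<in> A" for \<alpha>
  proof (rule tame_bound[OF tNq(1)])
    show "g \<alpha> \<in> borel_measurable borel"
      unfolding g_def[abs_def] using tame_measurable[OF tN] tame_measurable[OF tz[OF that]] by simp
    show "depends_on_first n (g \<alpha>)"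
      unfolding g_def[abs_def]
      by (rule depends_on_first_combine[OF tN tz[OF that] tz[OF that], of "\<lambda>u v z. u powr (q - 2) * v"])
    show "\<bar>g \<alpha> x\<bar> \<le> \<bar>N x powr (q - 1)\<bar>" for x
      using member_le_L2_set[OF fin that, of "\<lambda>\<alpha>. \<bar>g \<alpha> x\<bar>"] L2g[of x] by (simp add: L2_set_def)
  qed
  define I where "I = Lq_norm gauss q N"
  define D where "D = Lq_norm gauss q Y"
  have "I powr q = (\<Sum>\<alpha>\<in>A. \<integral>x. g \<alpha> x * z \<alpha> x \<partial>gauss)"
  proof -
    have "I powr q = (\<integral>x. N x powr q \<partial>gauss)"
      unfolding I_def using q nn by (subst Lq_norm_powr) auto
    also have "\<dots> = (\<integral>x. (\<Sum>\<alpha>\<in>A. g \<alpha> x * z \<alpha> x) \<partial>gauss)"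
    proof (rule Bochner_Integration.integral_cong[OF refl])
      fix x
      have "(\<Sum>\<alpha>\<in>A. g \<alpha> x * z \<alpha> x) = N x powr (q - 2) * (N x)\<^sup>2"
        by (simp add: g_def N_def L2_set_def sum_nonneg sum_distrib_left power2_eq_square mult.assoc)
      also have "\<dots> = N x powr q"
        using nn(1)[of x] powr_add[of "N x" "q - 2" 2] q by (cases "N x = 0") auto
      finally show "N x powr q = (\<Sum>\<alpha>\<in>A. g \<alpha> x * z \<alpha> x)" ..
    qed
    also have "\<dots> = (\<Sum>\<alpha>\<in>A. \<integral>x. g \<alpha> x * z \<alpha> x \<partial>gauss)"
      by (rule Bochner_Integration.integral_sum) (rule tame_integrable[OF tame_mult[OF tg tz]])
    finally show ?thesis .
  qed
  also have "\<dots> \<le> I powr (q - 1) * D * (pi / 2 - 0)"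
    unfolding z_def
  proof (rule rotation_inequality[where c="\<lambda>_. 1" and C="\<lambda>\<theta>. \<theta>", OF fin tg f])
    fix \<theta> :: real
    have "(\<Sum>\<alpha>\<in>A. \<integral>x. g \<alpha> (rot n \<theta> x) * Z \<alpha> x \<partial>gauss) = (\<integral>x. (\<Sum>\<alpha>\<in>A. g \<alpha> (rot n \<theta> x) * Z \<alpha> x) \<partial>gauss)"
      by (intro Bochner_Integration.integral_sum[symmetric] tame_integrable[OF tame_mult[OF tame_rot[OF tame_double[OF tg]] tZ]])
    also have "\<dots> \<le> (\<integral>x. N (rot n \<theta> x) powr (q - 1) * Y x \<partial>gauss)"
    proof (rule integral_mono)
      show "integrable gauss (\<lambda>x. \<Sum>\<alpha>\<in>A. g \<alpha> (rot n \<theta> x) * Z \<alpha> x)"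
        by (intro Bochner_Integration.integrable_sum tame_integrable[OF tame_mult[OF tame_rot[OF tame_double[OF tg]] tZ]])
      show "integrable gauss (\<lambda>x. N (rot n \<theta> x) powr (q - 1) * Y x)"
        by (rule tame_integrable[OF tame_mult[OF tame_rot[OF tNq(2)] tY]])
      show "(\<Sum>\<alpha>\<in>A. g \<alpha> (rot n \<theta> x) * Z \<alpha> x) \<le> N (rot n \<theta> x) powr (q - 1) * Y x" for x
        unfolding L2g[symmetric] Y_def by (rule abs_le_D1[OF abs_sum_mult_le_L2])
    qed
    also have "\<dots> \<le> Lq_norm gauss q' (\<lambda>x. N (rot n \<theta> x) powr (q - 1)) * Lq_norm gauss q Y"
      using q' nn by (intro holder_conjugate[OF tame_rot[OF tNq(2)] tY]) auto
    also have "Lq_norm gauss q' (\<lambda>x. N (rot n \<theta> x) powr (q - 1)) = Lq_norm gauss q' (\<lambda>x. N x powr (q - 1))"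
      using q' by (intro Lq_norm_rot tNq) auto
    also have "\<dots> = I powr (q - 1)"
    proof -
      have "(q - 1) * q' = q" "1 / q' = 1 / q * (q - 1)" using q by (auto simp: q'_def field_simps)
      then show ?thesis unfolding Lq_norm_def I_def using nn by (simp add: powr_powr)
    qed
    finally show "(\<Sum>\<alpha>\<in>A. \<integral>x. g \<alpha> (rot n \<theta> x) * (\<Sum>i<n. f' \<alpha> i x * x (n + i)) \<partial>gauss) \<le> I powr (q - 1) * D * 1"
      by (simp add: Z_def D_def)
  qed auto
  finally have main: "I powr q \<le> I powr (q - 1) * (pi / 2 * D)" by (simp add: mult_ac)
  have "I \<le> pi / 2 * D"
  proof (cases "I = 0")
    case False
    then have Ipos: "I > 0" unfolding I_def using Lq_norm_nonneg[of gauss q N] by linarith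
    have "I powr q = I powr (q - 1) * I" using Ipos powr_add[of I "q - 1" 1] by simp
    then show ?thesis using main Ipos by (simp only: mult_le_cancel_left_pos powr_gt_zero)
  qed (simp add: D_def)
  also have "D \<le> Lq_norm gauss q (\<lambda>x. L2_set (\<lambda>(\<alpha>, i). f' \<alpha> i x) (A \<times> {..<n}))"
    unfolding D_def Y_def Z_def by (rule gaussian_moment_le[OF fin C1_partialsD(3)[OF f] q])
  finally show ?thesis by (simp add: I_def N_def[abs_def] z_def)
qed

lemma poincare_large_exponent:
  assumes fin: "finite A" and f: "\<And>\<alpha>. \<alpha> \<in> A \<Longrightarrow> C1_partials n (f \<alpha>) (f' \<alpha>)" and q: "q \<ge> 2"
  shows "Lq_norm gauss q (\<lambda>x. L2_set (\<lambda>\<alpha>. f \<alpha> x - (\<integral>y. f \<alpha> y \<partial>gauss)) A)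
    \<le> sqrt (q - 1) * Lq_norm gauss q (\<lambda>x. L2_set (\<lambda>(\<alpha>, i). f' \<alpha> i x) (A \<times> {..<n}))"
proof -
  define z where "z \<alpha> x = f \<alpha> x - (\<integral>y. f \<alpha> y \<partial>gauss)" for \<alpha> x
  define Q where "Q x = L2_set (\<lambda>(\<alpha>, i). f' \<alpha> i x) (A \<times> {..<n})" for x
  define D where "D = Lq_norm gauss q Q"
  have z: "C1_partials n (z \<alpha>) (f' \<alpha>)" if "\<alpha> \<in> A" for \<alpha>
    unfolding z_def[abs_def] by (rule C1_partials_diff_const[OF f[OF that]])
  have tf': "tame n (f' \<alpha> i)" "tame (2 * n) (f' \<alpha> i)" if "\<alpha> \<in> A" "i < n" for \<alpha> i
    by (rule C1_partialsD(3)[OF f[OF that(1)] that(2)], rule tame_double[OF C1_partialsD(3)[OF f[OF that(1)] that(2)]])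
  have tQ: "tame n Q" unfolding Q_def[abs_def] by (rule tame_L2_set) (clarsimp simp: tf')
  have tQ2: "tame (2 * n) Q" by (rule tame_double[OF tQ])
  have Q0: "Q x \<ge> 0" for x by (simp add: Q_def)
  have "Lq_norm gauss q (\<lambda>x. L2_set (\<lambda>\<alpha>. z \<alpha> x) A) \<le> sqrt (q - 1) * D"
  proof (rule absorb_regularisation)
    fix \<epsilon> :: real assume \<epsilon>: "\<epsilon> > 0"
    define g where "g = power_field q \<epsilon> A z"
    define g' where "g' = power_field_partial q \<epsilon> A z f'"
    define S where "S = reg_norm2 \<epsilon> A z"
    define J where "J = (\<integral>x. S x powr (q / 2) \<partial>gauss)"
    define P where "P x = S x powr ((q - 2) / 2)" for x
    have g: "C1_partials n (g \<alpha>) (g' \<alpha>)" if "\<alpha> \<in> A" for \<alpha>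
      unfolding g_def g'_def using C1_partials_power_field[OF fin z \<epsilon> that] .
    have tS: "tame n S" unfolding S_def by (rule tame_reg_norm2) (rule C1_partialsD(1)[OF z])
    have tSr: "tame n (\<lambda>x. S x powr r)" "tame (2 * n) (\<lambda>x. S x powr r)" for r
    proof -
      show "tame n (\<lambda>x. S x powr r)"
        using tS \<epsilon> unfolding S_def by (intro tame_powr_bounded_below[OF _ reg_norm2_ge])
      then show "tame (2 * n) (\<lambda>x. S x powr r)" by (rule tame_mono) simp
    qed
    have Spos: "S x > 0" for x unfolding S_def by (rule reg_norm2_pos[OF \<epsilon>])
    have tg': "tame (2 * n) (g' \<alpha> i)" if "\<alpha> \<in> A" "i < n" for \<alpha> i
      by (rule tame_double[OF C1_partialsD(3)[OF g[OF that(1)] that(2)]])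
    have tg: "tame (2 * n) (g \<alpha>)" if "\<alpha> \<in> A" for \<alpha>
      by (rule tame_double[OF C1_partialsD(1)[OF g[OF that]]])
    \<comment> \<open>\<open>2 Q(x) Q(x\<^sub>\<theta>) \<le> Q(x)\<^sup>2 + Q(x\<^sub>\<theta>)\<^sup>2\<close>, and \<open>x\<close> and \<open>x\<^sub>\<theta>\<close> have the same law.\<close>
    have weight: "(\<integral>x. P (rot n \<theta> x) * (Q x * Q (rot n \<theta> x)) \<partial>gauss) \<le> J powr (1 - 2 / q) * D\<^sup>2" for \<theta>
    proof -
      have W: "(\<integral>x. P (rot n \<theta> x) * (R x)\<^sup>2 \<partial>gauss) \<le> J powr (1 - 2 / q) * (Lq_norm gauss q R)\<^sup>2"
        if "tame (2 * n) R" "\<And>x. R x \<ge> 0" for R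
      proof -
        have "(\<integral>x. S (rot n \<theta> x) powr (q / 2) \<partial>gauss) = J"
          unfolding J_def by (rule gauss_integral_rot[OF tSr(2)])
        then show ?thesis
          unfolding P_def
          using integral_weight_le[where S="\<lambda>x. S (rot n \<theta> x)" and Q=R, OF q tame_rot[OF tame_double[OF tS]] Spos tame_rot[OF tSr(2)] that]
          by simp
      qed
      have tP: "tame (2 * n) (\<lambda>x. P (rot n \<theta> x))" unfolding P_def by (rule tame_rot[OF tSr(2)])
      have "(\<integral>x. P (rot n \<theta> x) * (Q x * Q (rot n \<theta> x)) \<partial>gauss)
          \<le> (\<integral>x. (P (rot n \<theta> x) * (Q x)\<^sup>2 + P (rot n \<theta> x) * (Q (rot n \<theta> x))\<^sup>2) / 2 \<partial>gauss)"
      proof (rule integral_mono)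
        show "integrable gauss (\<lambda>x. P (rot n \<theta> x) * (Q x * Q (rot n \<theta> x)))"
          by (rule tame_integrable[OF tame_mult[OF tP tame_mult[OF tQ2 tame_rot[OF tQ2]]]])
        show "integrable gauss (\<lambda>x. (P (rot n \<theta> x) * (Q x)\<^sup>2 + P (rot n \<theta> x) * (Q (rot n \<theta> x))\<^sup>2) / 2)"
          by (intro integrable_divide tame_integrable[OF tame_add[OF tame_mult[OF tP tame_power[OF tQ2]] tame_mult[OF tP tame_power[OF tame_rot[OF tQ2]]]]])
        fix x
        have "0 \<le> (Q x - Q (rot n \<theta> x))\<^sup>2" by simp
        then have "Q x * Q (rot n \<theta> x) \<le> ((Q x)\<^sup>2 + (Q (rot n \<theta> x))\<^sup>2) / 2"
          by (simp add: power2_eq_square algebra_simps)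
        then have "P (rot n \<theta> x) * (Q x * Q (rot n \<theta> x)) \<le> P (rot n \<theta> x) * (((Q x)\<^sup>2 + (Q (rot n \<theta> x))\<^sup>2) / 2)"
          by (rule mult_left_mono) (simp add: P_def)
        then show "P (rot n \<theta> x) * (Q x * Q (rot n \<theta> x)) \<le> (P (rot n \<theta> x) * (Q x)\<^sup>2 + P (rot n \<theta> x) * (Q (rot n \<theta> x))\<^sup>2) / 2"
          by (simp add: distrib_left)
      qed
      also have "\<dots> = ((\<integral>x. P (rot n \<theta> x) * (Q x)\<^sup>2 \<partial>gauss) + (\<integral>x. P (rot n \<theta> x) * (Q (rot n \<theta> x))\<^sup>2 \<partial>gauss)) / 2"
        using tame_integrable[OF tame_mult[OF tP tame_power[OF tQ2, of 2]]] tame_integrable[OF tame_mult[OF tP tame_power[OF tame_rot[OF tQ2], of _ 2]]]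
        by simp
      also have "\<dots> \<le> (J powr (1 - 2 / q) * D\<^sup>2 + J powr (1 - 2 / q) * D\<^sup>2) / 2"
        using W[OF tQ2 Q0] W[OF tame_rot[OF tQ2] Q0, of \<theta>] Lq_norm_rot[OF tQ2, of q \<theta>] q
        unfolding D_def by (intro divide_right_mono add_mono) auto
      also have "\<dots> = J powr (1 - 2 / q) * D\<^sup>2" by simp
      finally show ?thesis .
    qed
    have "(\<Sum>\<alpha>\<in>A. \<integral>x. g \<alpha> x * z \<alpha> x \<partial>gauss) \<le> (q - 1) * (J powr (1 - 2 / q) * D\<^sup>2) * (sin (pi / 2) - sin 0)"
      unfolding z_def
    proof (rule rotation_inequality[where c=cos and C=sin, OF fin C1_partialsD(1)[OF g] f])
      fix \<theta> :: real assume \<theta>: "0 \<le> \<theta>" "\<theta> \<le> pi / 2"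
      then have c0: "cos \<theta> \<ge> 0" by (intro cos_ge_zero) auto
      \<comment> \<open>The coordinate \<open>y\<^sub>i\<close> enters \<open>x\<^sub>\<theta>\<close> only through its \<open>i\<close>-th component, with factor \<open>cos \<theta>\<close>.\<close>
      have ibp: "(\<integral>x. x (n + i) * (g \<alpha> (rot n \<theta> x) * f' \<alpha> i x) \<partial>gauss) = (\<integral>x. g' \<alpha> i (rot n \<theta> x) * cos \<theta> * f' \<alpha> i x \<partial>gauss)"
        if "\<alpha> \<in> A" "i < n" for \<alpha> i
      proof (rule gauss_integration_by_parts[where n="2 * n"])
        show "tame (2 * n) (\<lambda>x. g \<alpha> (rot n \<theta> x) * f' \<alpha> i x)"
          by (rule tame_mult[OF tame_rot[OF tg] tf'(2)]) (use that in auto)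
        show "tame (2 * n) (\<lambda>x. g' \<alpha> i (rot n \<theta> x) * cos \<theta> * f' \<alpha> i x)"
          by (rule tame_mult[OF tame_mult[OF tame_rot[OF tg'] tame_const] tf'(2)]) (use that in auto)
        show "n + i < 2 * n" using that by simp
        have fi: "f' \<alpha> i (x(n + i := t)) = f' \<alpha> i x" for x t
          using tf'(1)[OF that] unfolding tame_def depends_on_first_def by simp
        fix x :: "nat \<Rightarrow> real"
        have cont_rot: "continuous_on UNIV (\<lambda>t. rot n \<theta> (x(n + i := t)))"
        proof (rule continuous_on_coordinatewise_then_product)
          fix j
          have "continuous_on UNIV (\<lambda>t. (x(n + i := t)) k)" for k by (cases "k = n + i") auto
          then show "continuous_on UNIV (\<lambda>t. rot n \<theta> (x(n + i := t)) j)"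
            by (cases "j < n"; cases "j < 2 * n") (auto simp: rot_def simp del: fun_upd_apply intro!: continuous_intros)
        qed
        show "continuous_on UNIV (\<lambda>t. g' \<alpha> i (rot n \<theta> (x(n + i := t))) * cos \<theta> * f' \<alpha> i (x(n + i := t)))"
          unfolding fi
          by (intro continuous_on_mult continuous_on_const
              continuous_on_compose2[OF C1_partialsD(4)[OF g[OF that(1)] that(2)] cont_rot]) auto
        fix t
        have "((\<lambda>t. g \<alpha> (rot n \<theta> (x(n + i := t)))) has_real_derivative
            (\<Sum>j<n. g' \<alpha> j (rot n \<theta> (x(n + i := t))) * (if j = i then cos \<theta> else 0))) (at t)"
        proof (rule C1_partials_chain[OF g[OF that(1)]])
          fix j s assume "j < n"
          then show "((\<lambda>t. rot n \<theta> (x(n + i := t)) j) has_real_derivative (if j = i then cos \<theta> else 0)) (at s)"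
            by (cases "j = i") (auto simp: rot_simps intro!: derivative_eq_intros)
        qed
        also have "(\<Sum>j<n. g' \<alpha> j (rot n \<theta> (x(n + i := t))) * (if j = i then cos \<theta> else 0)) = g' \<alpha> i (rot n \<theta> (x(n + i := t))) * cos \<theta>"
          using that(2) by (simp add: if_distrib[of "\<lambda>c. _ * c"] cong: if_cong)
        finally show "((\<lambda>t. g \<alpha> (rot n \<theta> (x(n + i := t))) * f' \<alpha> i (x(n + i := t))) has_real_derivative
            g' \<alpha> i (rot n \<theta> (x(n + i := t))) * cos \<theta> * f' \<alpha> i (x(n + i := t))) (at t)"
          unfolding fi by (rule DERIV_cmult_right)
      qed
      have tg'f': "tame (2 * n) (\<lambda>x. g' \<alpha> i (rot n \<theta> x) * cos \<theta> * f' \<alpha> i x)" if "\<alpha> \<in> A" "i < n" for \<alpha> i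
        by (rule tame_mult[OF tame_mult[OF tame_rot[OF tg'[OF that]] tame_const] tf'(2)[OF that]])
      have "(\<Sum>\<alpha>\<in>A. \<integral>x. g \<alpha> (rot n \<theta> x) * (\<Sum>i<n. f' \<alpha> i x * x (n + i)) \<partial>gauss)
          = (\<Sum>\<alpha>\<in>A. \<Sum>i<n. \<integral>x. x (n + i) * (g \<alpha> (rot n \<theta> x) * f' \<alpha> i x) \<partial>gauss)"
      proof (rule sum.cong[OF refl])
        fix \<alpha> assume \<alpha>: "\<alpha> \<in> A"
        have "(\<integral>x. g \<alpha> (rot n \<theta> x) * (\<Sum>i<n. f' \<alpha> i x * x (n + i)) \<partial>gauss) = (\<integral>x. (\<Sum>i<n. x (n + i) * (g \<alpha> (rot n \<theta> x) * f' \<alpha> i x)) \<partial>gauss)"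
          by (rule Bochner_Integration.integral_cong[OF refl]) (simp add: sum_distrib_left mult_ac)
        also have "\<dots> = (\<Sum>i<n. \<integral>x. x (n + i) * (g \<alpha> (rot n \<theta> x) * f' \<alpha> i x) \<partial>gauss)"
          by (rule gauss_integral_sum[where n="2 * n"], rule tame_mult[OF tame_coordinate tame_mult[OF tame_rot[OF tg[OF \<alpha>]] tf'(2)[OF \<alpha>]]]) auto
        finally show "(\<integral>x. g \<alpha> (rot n \<theta> x) * (\<Sum>i<n. f' \<alpha> i x * x (n + i)) \<partial>gauss) = (\<Sum>i<n. \<integral>x. x (n + i) * (g \<alpha> (rot n \<theta> x) * f' \<alpha> i x) \<partial>gauss)" .
      qed
      also have "\<dots> = (\<Sum>\<alpha>\<in>A. \<Sum>i<n. \<integral>x. g' \<alpha> i (rot n \<theta> x) * cos \<theta> * f' \<alpha> i x \<partial>gauss)"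
        by (intro sum.cong refl ibp) auto
      also have "\<dots> = (\<integral>x. (\<Sum>\<alpha>\<in>A. \<Sum>i<n. g' \<alpha> i (rot n \<theta> x) * cos \<theta> * f' \<alpha> i x) \<partial>gauss)"
        by (rule gauss_integral_sum2[symmetric, where n="2 * n"], rule tg'f') auto
      also have "\<dots> \<le> (\<integral>x. cos \<theta> * (q - 1) * (P (rot n \<theta> x) * (Q x * Q (rot n \<theta> x))) \<partial>gauss)"
      proof (rule integral_mono)
        show "integrable gauss (\<lambda>x. \<Sum>\<alpha>\<in>A. \<Sum>i<n. g' \<alpha> i (rot n \<theta> x) * cos \<theta> * f' \<alpha> i x)"
          by (rule tame_integrable[where n="2 * n"], rule tame_sum, rule tame_sum, rule tg'f') auto
        show "integrable gauss (\<lambda>x. cos \<theta> * (q - 1) * (P (rot n \<theta> x) * (Q x * Q (rot n \<theta> x))))"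
          unfolding P_def
          by (intro integrable_mult_right tame_integrable[OF tame_mult[OF tame_rot[OF tSr(2)] tame_mult[OF tQ2 tame_rot[OF tQ2]]]])
        fix x
        have "(\<Sum>\<alpha>\<in>A. \<Sum>i<n. g' \<alpha> i (rot n \<theta> x) * cos \<theta> * f' \<alpha> i x) = cos \<theta> * (\<Sum>\<alpha>\<in>A. \<Sum>i<n. f' \<alpha> i x * g' \<alpha> i (rot n \<theta> x))"
          by (simp add: sum_distrib_left mult_ac)
        also have "\<dots> \<le> cos \<theta> * ((q - 1) * P (rot n \<theta> x) * (Q x * Q (rot n \<theta> x)))"
          unfolding g'_def P_def S_def Q_def by (rule mult_left_mono[OF power_field_partial_bound[OF q \<epsilon>] c0])
        finally show "(\<Sum>\<alpha>\<in>A. \<Sum>i<n. g' \<alpha> i (rot n \<theta> x) * cos \<theta> * f' \<alpha> i x) \<le> cos \<theta> * (q - 1) * (P (rot n \<theta> x) * (Q x * Q (rot n \<theta> x)))"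
          by (simp add: mult_ac)
      qed
      also have "\<dots> = cos \<theta> * (q - 1) * (\<integral>x. P (rot n \<theta> x) * (Q x * Q (rot n \<theta> x)) \<partial>gauss)" by simp
      also have "\<dots> \<le> cos \<theta> * (q - 1) * (J powr (1 - 2 / q) * D\<^sup>2)"
        using c0 q by (intro mult_left_mono weight) auto
      finally show "(\<Sum>\<alpha>\<in>A. \<integral>x. g \<alpha> (rot n \<theta> x) * (\<Sum>i<n. f' \<alpha> i x * x (n + i)) \<partial>gauss) \<le> (q - 1) * (J powr (1 - 2 / q) * D\<^sup>2) * cos \<theta>"
        by (simp add: mult_ac)
    qed (auto intro!: derivative_eq_intros)
    then show "(\<Sum>\<alpha>\<in>A. \<integral>x. power_field q \<epsilon> A z \<alpha> x * z \<alpha> x \<partial>gauss)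
        \<le> (q - 1) * (\<integral>x. reg_norm2 \<epsilon> A z x powr (q / 2) \<partial>gauss) powr (1 - 2 / q) * D\<^sup>2"
      by (simp add: g_def J_def S_def mult_ac)
  qed (use q C1_partialsD(1)[OF z] in \<open>auto simp: D_def\<close>)
  then show ?thesis by (simp add: z_def D_def Q_def[abs_def])
qed

lemma poincare:
  assumes fin: "finite A" and f: "\<And>\<alpha>. \<alpha> \<in> A \<Longrightarrow> C1_partials n (f \<alpha>) (f' \<alpha>)" and q: "q > 1"
  shows "Lq_norm gauss q (\<lambda>x. L2_set (\<lambda>\<alpha>. f \<alpha> x - (\<integral>y. f \<alpha> y \<partial>gauss)) A)
    \<le> c_const q * Lq_norm gauss q (\<lambda>x. L2_set (\<lambda>(\<alpha>, i). f' \<alpha> i x) (A \<times> {..<n}))"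
proof (cases "q \<ge> 2")
  case True
  then show ?thesis using poincare_large_exponent[OF fin f] by (simp add: c_const_def)
next
  case False
  then show ?thesis using poincare_small_exponent[OF fin f q] by (simp add: c_const_def)
qed

section \<open>Symmetry of higher partial derivatives\<close>

text \<open>
  Both mixed derivatives are limits of the same second-order difference quotient, by two
  applications of the mean value theorem in either order.
\<close>

lemma mixed_partials_commute:
  fixes F :: "real \<Rightarrow> real \<Rightarrow> real"
  assumes x: "\<And>s t. ((\<lambda>s. F s t) has_real_derivative Fx s t) (at s)"
    and y: "\<And>s t. ((\<lambda>t. F s t) has_real_derivative Fy s t) (at t)"
    and xy: "\<And>s t. ((\<lambda>t. Fx s t) has_real_derivative Fxy s t) (at t)"
    and yx: "\<And>s t. ((\<lambda>s. Fy s t) has_real_derivative Fyx s t) (at s)"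
    and cxy: "continuous_on UNIV (\<lambda>p. Fxy (fst p) (snd p))"
    and cyx: "continuous_on UNIV (\<lambda>p. Fyx (fst p) (snd p))"
  shows "Fxy a b = Fyx a b"
proof (rule ccontr)
  assume neq: "Fxy a b \<noteq> Fyx a b"
  define e where "e = \<bar>Fxy a b - Fyx a b\<bar> / 2"
  have e: "e > 0" using neq by (simp add: e_def)
  have "isCont (\<lambda>p. Fxy (fst p) (snd p)) (a, b)" "isCont (\<lambda>p. Fyx (fst p) (snd p)) (a, b)"
    using cxy cyx by (simp_all add: continuous_on_eq_continuous_at)
  then obtain d1 d2 where d: "d1 > 0" "\<And>p. dist p (a, b) < d1 \<Longrightarrow> dist (Fxy (fst p) (snd p)) (Fxy a b) < e"
     "d2 > 0" "\<And>p. dist p (a, b) < d2 \<Longrightarrow> dist (Fyx (fst p) (snd p)) (Fyx a b) < e"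
    using e unfolding continuous_at_eps_delta by (metis fst_conv snd_conv)
  \<comment> \<open>The intermediate points lie in a square of side \<open>h\<close>, hence within \<open>2 h\<close> of its corner.\<close>
  define h where "h = min d1 d2 / 2"
  have h: "h > 0" "2 * h \<le> d1" "2 * h \<le> d2" using d by (auto simp: h_def)
  have close: "dist (s, t) (a, b) < 2 * h" if "a < s" "s < a + h" "b < t" "t < b + h" for s t
  proof -
    have "dist (s, t) (a, b) \<le> \<bar>s - a\<bar> + \<bar>t - b\<bar>"
      unfolding dist_prod_def dist_real_def by (simp add: sqrt_sum_squares_le_sum_abs)
    then show ?thesis using that by simp
  qed
  have "\<exists>z>a. z < a + h \<and> (F (a + h) (b + h) - F (a + h) b) - (F a (b + h) - F a b) = (a + h - a) * (Fx z (b + h) - Fx z b)"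
    using h(1) x by (intro MVT2) (auto intro!: derivative_intros)
  then obtain s where s: "a < s" "s < a + h"
    "(F (a + h) (b + h) - F (a + h) b) - (F a (b + h) - F a b) = h * (Fx s (b + h) - Fx s b)" by auto
  have "\<exists>z>b. z < b + h \<and> Fx s (b + h) - Fx s b = (b + h - b) * Fxy s z"
    using h(1) xy by (intro MVT2) auto
  then obtain t where t: "b < t" "t < b + h" "Fx s (b + h) - Fx s b = h * Fxy s t" by auto
  have "\<exists>z>b. z < b + h \<and> (F (a + h) (b + h) - F a (b + h)) - (F (a + h) b - F a b) = (b + h - b) * (Fy (a + h) z - Fy a z)"
    using h(1) y by (intro MVT2) (auto intro!: derivative_intros)
  then obtain t' where t': "b < t'" "t' < b + h"
    "(F (a + h) (b + h) - F a (b + h)) - (F (a + h) b - F a b) = h * (Fy (a + h) t' - Fy a t')" by auto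
  have "\<exists>z>a. z < a + h \<and> Fy (a + h) t' - Fy a t' = (a + h - a) * Fyx z t'"
    using h(1) yx by (intro MVT2) auto
  then obtain s' where s': "a < s'" "s' < a + h" "Fy (a + h) t' - Fy a t' = h * Fyx s' t'" by auto
  have "h * (h * Fxy s t) = h * (h * Fyx s' t')"     unfolding t(3)[symmetric] s(3)[symmetric] s'(3)[symmetric] t'(3)[symmetric] by simp
  then have eq: "Fxy s t = Fyx s' t'" using h(1) by simp
  have "dist (Fxy s t) (Fxy a b) < e" "dist (Fyx s' t') (Fyx a b) < e"
    using d(2)[of "(s, t)"] d(4)[of "(s', t')"] close[OF s(1,2) t(1,2)] close[OF s'(1,2) t'(1,2)] h by auto
  then show False using eq unfolding e_def dist_real_def by (auto simp: abs_if split: if_splits)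
qed

text \<open>
  \<open>u is\<close> is the iterated partial derivative of \<open>u []\<close> along the list \<open>is\<close>, whose head is the
  last derivative taken.
\<close>

definition jet :: "nat \<Rightarrow> (nat list \<Rightarrow> (nat \<Rightarrow> real) \<Rightarrow> real) \<Rightarrow> bool" where
  "jet n u \<longleftrightarrow> (\<forall>is. set is \<subseteq> {..<n} \<longrightarrow> C1_partials n (u is) (\<lambda>i. u (i # is)))"

lemma jetD: "jet n u \<Longrightarrow> set is \<subseteq> {..<n} \<Longrightarrow> C1_partials n (u is) (\<lambda>i. u (i # is))"
  by (simp add: jet_def)

lemma jet_tame: "jet n u \<Longrightarrow> set is \<subseteq> {..<n} \<Longrightarrow> tame n (u is)"
  by (rule C1_partialsD(1)[OF jetD])

lemma jet_Cons_cong: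
  assumes u: "jet n u" and "set is \<subseteq> {..<n}" "set js \<subseteq> {..<n}" "i < n" "u is = u js"
  shows "u (i # is) = u (i # js)"
proof
  fix x
  have "((\<lambda>t. u is (x(i := t))) has_real_derivative u (i # is) (x(i := x i))) (at (x i))"
    by (rule C1_partialsD(5)[OF jetD[OF u assms(2)] assms(4)])
  moreover have "((\<lambda>t. u is (x(i := t))) has_real_derivative u (i # js) (x(i := x i))) (at (x i))"
    unfolding assms(5) by (rule C1_partialsD(5)[OF jetD[OF u assms(3)] assms(4)])
  ultimately show "u (i # is) x = u (i # js) x" using DERIV_unique by fastforce
qed

lemma jet_swap:
  assumes u: "jet n u" and iss: "set is \<subseteq> {..<n}" and ij: "i < n" "j < n"
  shows "u (i # j # is) = u (j # i # is)"
proof (cases "i = j")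
  case False
  show ?thesis
  proof
    fix x :: "nat \<Rightarrow> real"
    define y where "y s t = x(i := s, j := t)" for s t
    have y: "y s t = (x(j := t))(i := s)" "y s t = (x(i := s))(j := t)" for s t
      using False by (auto simp: y_def fun_upd_twist)
    have cy: "continuous_on UNIV (\<lambda>p. y (fst p) (snd p))"
      unfolding y_def by (intro continuous_on_fun_upd continuous_intros)
    have c: "continuous_on UNIV (\<lambda>p. u (k # l # is) (y (fst p) (snd p)))" if "k < n" "l < n" for k l
      using C1_partialsD(4)[OF jetD[OF u, of "l # is"]] iss that
      by (intro continuous_on_compose2[OF _ cy, of UNIV "u (k # l # is)"]) auto
    have "u (j # i # is) (y (x i) (x j)) = u (i # j # is) (y (x i) (x j))"
    proof (rule mixed_partials_commute[where F="\<lambda>s t. u is (y s t)" and Fxy="\<lambda>s t. u (j # i # is) (y s t)"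
          and Fyx="\<lambda>s t. u (i # j # is) (y s t)"])
      show "((\<lambda>s. u is (y s t)) has_real_derivative u (i # is) (y s t)) (at s)" for s t
        unfolding y(1) by (rule C1_partialsD(5)[OF jetD[OF u iss] ij(1)])
      show "((\<lambda>t. u is (y s t)) has_real_derivative u (j # is) (y s t)) (at t)" for s t
        unfolding y(2) by (rule C1_partialsD(5)[OF jetD[OF u iss] ij(2)])
      show "((\<lambda>t. u (i # is) (y s t)) has_real_derivative u (j # i # is) (y s t)) (at t)" for s t
        unfolding y(2) by (rule C1_partialsD(5)[OF jetD[OF u] ij(2)]) (use iss ij in auto)
      show "((\<lambda>s. u (j # is) (y s t)) has_real_derivative u (i # j # is) (y s t)) (at s)" for s t
        unfolding y(1) by (rule C1_partialsD(5)[OF jetD[OF u] ij(1)]) (use iss ij in auto)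
    qed (use c ij in auto)
    moreover have "y (x i) (x j) = x" by (simp add: y_def)
    ultimately show "u (i # j # is) x = u (j # i # is) x" by simp
  qed
qed simp

text \<open>
  Iterated partial derivatives do not depend on the order of differentiation.
\<close>

lemma jet_mset:
  assumes u: "jet n u"
  shows "set is \<subseteq> {..<n} \<Longrightarrow> mset is = mset js \<Longrightarrow> u is = u js"
proof (induction "is" arbitrary: js)
  case Nil
  then show ?case by simp
next
  case (Cons a as)
  have move: "u (xs @ a # ys) = u (a # xs @ ys)" if "set (xs @ a # ys) \<subseteq> {..<n}" for xs ys
    using that
  proof (induction xs)
    case (Cons b xs)
    then have "u (b # (xs @ a # ys)) = u (b # (a # xs @ ys))" by (intro jet_Cons_cong[OF u]) auto
    also have "\<dots> = u (a # b # (xs @ ys))" using Cons by (intro jet_swap[OF u]) auto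
    finally show ?case by simp
  qed simp
  have "a \<in> set js" using Cons.prems(2) by (metis list.set_intros(1) mset_eq_setD)
  then obtain xs ys where js: "js = xs @ a # ys" by (meson split_list)
  have set_js: "set js \<subseteq> {..<n}" using Cons.prems by (metis mset_eq_setD)
  have "mset as = mset (xs @ ys)" using Cons.prems(2) js by simp
  then have "u as = u (xs @ ys)" using Cons.prems(1) by (intro Cons.IH) auto
  then have "u (a # as) = u (a # xs @ ys)"
    using Cons.prems(1) set_js js by (intro jet_Cons_cong[OF u]) auto
  also have "\<dots> = u js" using move[of xs ys] set_js js by simp
  finally show ?case .
qed

section \<open>Multi-indices\<close>

definition ilists :: "nat \<Rightarrow> nat \<Rightarrow> nat list set" where
  "ilists n k = {is. length is = k \<and> set is \<subseteq> {..<n}}"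

lemma finite_ilists [simp]: "finite (ilists n k)"
  using finite_lists_length_eq[of "{..<n}" k] by (simp add: ilists_def conj_commute)

lemma ilists_0 [simp]: "ilists n 0 = {[]}"
  by (auto simp: ilists_def)

lemma sum_ilists_Suc:
  "(\<Sum>is\<in>ilists n (Suc k). g is) = (\<Sum>is\<in>ilists n k. \<Sum>i<n. g (i # is))"
proof -
  have "ilists n (Suc k) = (\<lambda>(is, i). i # is) ` (ilists n k \<times> {..<n})"
  proof (intro equalityI subsetI)
    fix js assume "js \<in> ilists n (Suc k)"
    then obtain i "is" where "js = i # is" "is \<in> ilists n k" "i < n"
      by (cases js) (auto simp: ilists_def)
    then show "js \<in> (\<lambda>(is, i). i # is) ` (ilists n k \<times> {..<n})" by force
  qed (auto simp: ilists_def)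
  moreover have "inj_on (\<lambda>(is, i). i # is) (ilists n k \<times> {..<n})" by (auto simp: inj_on_def)
  ultimately have "(\<Sum>is\<in>ilists n (Suc k). g is) = (\<Sum>(is, i)\<in>ilists n k \<times> {..<n}. g (i # is))"
    by (simp add: sum.reindex case_prod_unfold)
  then show ?thesis by (simp add: sum.cartesian_product)
qed

lemma L2_set_ilists_Suc:
  "L2_set (\<lambda>((b, is), i). w b (i # is)) ((B \<times> ilists n k) \<times> {..<n}) = L2_set (\<lambda>(b, is). w b is) (B \<times> ilists n (Suc k))"
proof -
  have "(\<Sum>p\<in>(B \<times> ilists n k) \<times> {..<n}. (case p of ((b, is), i) \<Rightarrow> w b (i # is))\<^sup>2)
      = (\<Sum>b\<in>B. \<Sum>is\<in>ilists n k. \<Sum>i<n. (w b (i # is))\<^sup>2)"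
  proof -
    have "(\<Sum>b\<in>B. \<Sum>is\<in>ilists n k. \<Sum>i<n. (w b (i # is))\<^sup>2) = (\<Sum>(b, is)\<in>B \<times> ilists n k. \<Sum>i<n. (w b (i # is))\<^sup>2)"
      by (rule sum.cartesian_product)
    also have "\<dots> = (\<Sum>\<alpha>\<in>B \<times> ilists n k. \<Sum>i<n. (w (fst \<alpha>) (i # snd \<alpha>))\<^sup>2)" by (simp only: case_prod_unfold)
    also have "\<dots> = (\<Sum>(\<alpha>, i)\<in>(B \<times> ilists n k) \<times> {..<n}. (w (fst \<alpha>) (i # snd \<alpha>))\<^sup>2)"
      by (rule sum.cartesian_product)
    finally show ?thesis by (simp only: case_prod_unfold)
  qed
  also have "\<dots> = (\<Sum>b\<in>B. \<Sum>is\<in>ilists n (Suc k). (w b is)\<^sup>2)" by (simp only: sum_ilists_Suc)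
  also have "\<dots> = (\<Sum>p\<in>B \<times> ilists n (Suc k). (case p of (b, is) \<Rightarrow> w b is)\<^sup>2)"
    by (simp add: sum.cartesian_product case_prod_unfold)
  finally show ?thesis by (simp only: L2_set_def case_prod_unfold)
qed

section \<open>The Wiener chaos generated by a symmetric tensor\<close>

text \<open>
  The multiple Wiener integral of a symmetric tensor \<open>T\<close> in \<open>j\<close> of its arguments, with \<open>is\<close> as the
  remaining ones. It arises by applying the divergence \<open>\<Sum>\<^sub>i (x\<^sub>i - \<partial>\<^sub>i)\<close> \<open>j\<close> times to the constant \<open>T\<close>; for \<open>n = 1\<close>
  it is the Hermite polynomial of degree \<open>j\<close>. The recursion is the three-term recursion of these
  polynomials, with the derivative written out by \<open>C1_partials_chaos\<close>. The index \<open>j - 1\<close> is truncated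
  at \<open>j = 0\<close>, where its coefficient vanishes.
\<close>

fun chaos :: "nat \<Rightarrow> (nat list \<Rightarrow> real) \<Rightarrow> nat \<Rightarrow> nat list \<Rightarrow> (nat \<Rightarrow> real) \<Rightarrow> real" where
  "chaos n T 0 is x = T is"
| "chaos n T (Suc j) is x =
     (\<Sum>i<n. x i * chaos n T j (i # is) x - real j * chaos n T (j - 1) (i # i # is) x)"

lemma chaos_mset:
  assumes T: "\<And>is js. mset is = mset js \<Longrightarrow> T is = T js"
  shows "mset is = mset js \<Longrightarrow> chaos n T j is x = chaos n T j js x"
proof (induction j arbitrary: "is" js rule: less_induct)
  case (less j)
  show ?case
  proof (cases j)
    case 0
    then show ?thesis using T[OF less.prems] by simp
  next
    case (Suc m)
    have 1: "chaos n T m (i # is) x = chaos n T m (i # js) x" for i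
      by (rule less.IH) (simp_all add: Suc less.prems)
    have 2: "chaos n T (m - 1) (i # i # is) x = chaos n T (m - 1) (i # i # js) x" for i
      by (rule less.IH) (simp_all add: Suc less.prems)
    show ?thesis unfolding Suc chaos.simps by (rule sum.cong[OF refl]) (simp only: 1 2)
  qed
qed

text \<open>
  \<open>\<partial>\<^sub>i I\<^sub>j = j I\<^bsub>j-1\<^esub>\<close>: the commutator of \<open>\<partial>\<^sub>i\<close> with the divergence is the identity, and each of the \<open>j\<close>
  divergences contributes it once.
\<close>

lemma C1_partials_chaos:
  assumes T: "\<And>is js. mset is = mset js \<Longrightarrow> T is = T js"
  shows "C1_partials n (chaos n T j is) (\<lambda>i x. real j * chaos n T (j - 1) (i # is) x)"
proof (induction j arbitrary: "is" rule: less_induct)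
  case (less j)
  show ?case
  proof (cases j)
    case 0
    have "chaos n T 0 is = (\<lambda>_. T is)" by (simp add: fun_eq_iff)
    then show ?thesis by (simp add: 0 C1_partials_def)
  next
    case (Suc m)
    have IH: "C1_partials n (chaos n T m js) (\<lambda>i x. real m * chaos n T (m - 1) (i # js) x)"
         "C1_partials n (chaos n T (m - 1) js) (\<lambda>i x. real (m - 1) * chaos n T (m - 1 - 1) (i # js) x)" for js
      using Suc by (intro less.IH; simp)+
    have eq: "chaos n T (Suc m) js = (\<lambda>x. \<Sum>i<n. x i * chaos n T m (i # js) x - real m * chaos n T (m - 1) (i # i # js) x)" for js
      by (simp add: fun_eq_iff)
    have tame: "tame n (chaos n T (Suc m) is)"
      unfolding eq by (intro tame_sum tame_diff tame_mult tame_const tame_coordinate C1_partialsD(1)[OF IH(1)] C1_partialsD(1)[OF IH(2)]) simp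
    have cont: "continuous_on UNIV (chaos n T (Suc m) is)"
      unfolding eq by (intro continuous_on_sum continuous_on_diff continuous_on_mult continuous_on_const
          continuous_on_product_coordinates C1_partialsD(2)[OF IH(1)] C1_partialsD(2)[OF IH(2)])
    have deriv: "((\<lambda>t. chaos n T (Suc m) is (x(k := t))) has_real_derivative real (Suc m) * chaos n T m (k # is) x) (at (x k))"
      if k: "k < n" for k x
    proof -
      have d1: "((\<lambda>t. (x(k := t)) i * chaos n T m (i # is) (x(k := t))) has_real_derivative
          (if i = k then 1 else 0) * chaos n T m (i # is) x + (real m * chaos n T (m - 1) (k # i # is) x) * x i) (at (x k))" for i
      proof -
        have "((\<lambda>t. (x(k := t)) i) has_real_derivative (if i = k then 1 else 0)) (at (x k))" by (cases "i = k") auto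
        from DERIV_mult[OF this C1_partialsD(5)[OF IH(1) k, of "i # is" x "x k"]] show ?thesis by simp
      qed
      have d2: "((\<lambda>t. real m * chaos n T (m - 1) (i # i # is) (x(k := t))) has_real_derivative
          real m * (real (m - 1) * chaos n T (m - 1 - 1) (k # i # i # is) x)) (at (x k))" for i
        using DERIV_cmult[OF C1_partialsD(5)[OF IH(2) k, of "i # i # is" x "x k"], of "real m"] by simp
      have "((\<lambda>t. chaos n T (Suc m) is (x(k := t))) has_real_derivative
          (\<Sum>i<n. ((if i = k then 1 else 0) * chaos n T m (i # is) x + (real m * chaos n T (m - 1) (k # i # is) x) * x i)
             - real m * (real (m - 1) * chaos n T (m - 1 - 1) (k # i # i # is) x))) (at (x k))"
        unfolding eq by (intro DERIV_sum DERIV_diff d1 d2)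
      also have "(\<Sum>i<n. ((if i = k then 1 else 0) * chaos n T m (i # is) x + (real m * chaos n T (m - 1) (k # i # is) x) * x i)
             - real m * (real (m - 1) * chaos n T (m - 1 - 1) (k # i # i # is) x))
          = (\<Sum>i<n. (if i = k then 1 else 0) * chaos n T m (i # is) x)
            + real m * (\<Sum>i<n. x i * chaos n T (m - 1) (i # k # is) x - real (m - 1) * chaos n T (m - 1 - 1) (i # i # k # is) x)"
      proof -
        have "chaos n T (m - 1) (k # i # is) x = chaos n T (m - 1) (i # k # is) x"
             "chaos n T (m - 1 - 1) (k # i # i # is) x = chaos n T (m - 1 - 1) (i # i # k # is) x" for i
          by (rule chaos_mset[OF T]; simp)+
        then show ?thesis by (simp add: sum_distrib_left sum.distrib[symmetric] algebra_simps)
      qed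
      also have "(\<Sum>i<n. (if i = k then 1 else 0) * chaos n T m (i # is) x) = chaos n T m (k # is) x"
        using k by (simp add: if_distrib[of "\<lambda>c. c * _"] cong: if_cong)
      also have "real m * (\<Sum>i<n. x i * chaos n T (m - 1) (i # k # is) x - real (m - 1) * chaos n T (m - 1 - 1) (i # i # k # is) x)
          = real m * chaos n T m (k # is) x"
        by (cases m) auto
      finally show ?thesis
        by (rule DERIV_cong) (simp only: of_nat_Suc distrib_right mult_1_left)
    qed
    show ?thesis
      unfolding C1_partials_def Suc
    proof (intro conjI allI impI)
      fix i assume i: "i < n"
      show "tame n (\<lambda>x. real (Suc m) * chaos n T (Suc m - 1) (i # is) x)"
        using C1_partialsD(1)[OF IH(1)] by (simp only: diff_Suc_1) (rule tame_cmult)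
      show "continuous_on UNIV (\<lambda>x. real (Suc m) * chaos n T (Suc m - 1) (i # is) x)"
        using C1_partialsD(2)[OF IH(1)] by (simp only: diff_Suc_1) (intro continuous_on_mult continuous_on_const)
      show "((\<lambda>t. chaos n T (Suc m) is (x(i := t))) has_real_derivative real (Suc m) * chaos n T (Suc m - 1) (i # is) x) (at (x i))" for x
        using deriv[OF i, of x] by (simp only: diff_Suc_1)
    qed (rule tame, rule cont)
  qed
qed

lemma gauss_integral_duality:
  assumes f: "C1_partials n f f'" and g: "C1_partials n g g'" and i: "i < n"
  shows "(\<integral>x. f x * (x i * g x - g' i x) \<partial>gauss) = (\<integral>x. f' i x * g x \<partial>gauss)"
proof -
  note t = C1_partialsD(1)[OF f] C1_partialsD(1)[OF g] C1_partialsD(3)[OF f i] C1_partialsD(3)[OF g i]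
  have "(\<integral>x. x i * (f x * g x) \<partial>gauss) = (\<integral>x. f' i x * g x + g' i x * f x \<partial>gauss)"
  proof (rule gauss_integration_by_parts[OF _ _ i])
    show "tame n (\<lambda>x. f x * g x)" "tame n (\<lambda>x. f' i x * g x + g' i x * f x)"
      using t by (auto intro!: tame_add tame_mult)
    fix x t
    show "((\<lambda>t. f (x(i := t)) * g (x(i := t))) has_real_derivative
        f' i (x(i := t)) * g (x(i := t)) + g' i (x(i := t)) * f (x(i := t))) (at t)"
      by (rule DERIV_mult[OF C1_partialsD(5)[OF f i] C1_partialsD(5)[OF g i]])
    have u: "continuous_on UNIV (\<lambda>t. x(i := t))" by (intro continuous_on_fun_upd continuous_intros)
    show "continuous_on UNIV (\<lambda>t. f' i (x(i := t)) * g (x(i := t)) + g' i (x(i := t)) * f (x(i := t)))"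
      by (intro continuous_on_add continuous_on_mult continuous_on_compose2[OF C1_partialsD(4)[OF f i] u]
          continuous_on_compose2[OF C1_partialsD(4)[OF g i] u] continuous_on_compose2[OF C1_partialsD(2)[OF f] u]
          continuous_on_compose2[OF C1_partialsD(2)[OF g] u]) auto
  qed
  also have "\<dots> = (\<integral>x. f' i x * g x \<partial>gauss) + (\<integral>x. g' i x * f x \<partial>gauss)"
    by (rule Bochner_Integration.integral_add[OF tame_integrable[OF tame_mult[OF t(3,2)]] tame_integrable[OF tame_mult[OF t(4,1)]]])
  finally have *: "(\<integral>x. x i * (f x * g x) \<partial>gauss) - (\<integral>x. g' i x * f x \<partial>gauss) = (\<integral>x. f' i x * g x \<partial>gauss)" by simp
  have "(\<integral>x. f x * (x i * g x - g' i x) \<partial>gauss) = (\<integral>x. x i * (f x * g x) - g' i x * f x \<partial>gauss)"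
    by (rule Bochner_Integration.integral_cong[OF refl]) (simp add: algebra_simps)
  also have "\<dots> = (\<integral>x. x i * (f x * g x) \<partial>gauss) - (\<integral>x. g' i x * f x \<partial>gauss)"
    by (rule Bochner_Integration.integral_diff[OF tame_integrable[OF tame_mult[OF tame_coordinate[OF i] tame_mult[OF t(1,2)]]] tame_integrable[OF tame_mult[OF t(4,1)]]])
  finally show ?thesis using * by simp
qed

text \<open>
  The divergence is the adjoint of the gradient.
\<close>

lemma chaos_duality:
  assumes T: "\<And>is js. mset is = mset js \<Longrightarrow> T is = T js" and f: "C1_partials n f f'"
  shows "(\<integral>x. f x * chaos n T (Suc j) is x \<partial>gauss) = (\<Sum>i<n. \<integral>x. f' i x * chaos n T j (i # is) x \<partial>gauss)"
proof -
  note P = C1_partials_chaos[where T=T, OF T]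
  have "(\<integral>x. f x * chaos n T (Suc j) is x \<partial>gauss)
      = (\<integral>x. (\<Sum>i<n. f x * (x i * chaos n T j (i # is) x - real j * chaos n T (j - 1) (i # i # is) x)) \<partial>gauss)"
    by (simp add: sum_distrib_left)
  also have "\<dots> = (\<Sum>i<n. \<integral>x. f x * (x i * chaos n T j (i # is) x - real j * chaos n T (j - 1) (i # i # is) x) \<partial>gauss)"
    by (rule gauss_integral_sum[where n=n])
       (intro tame_mult tame_diff tame_const tame_coordinate C1_partialsD(1)[OF f] C1_partialsD(1)[OF P], simp)
  also have "\<dots> = (\<Sum>i<n. \<integral>x. f' i x * chaos n T j (i # is) x \<partial>gauss)"
    by (rule sum.cong[OF refl], rule gauss_integral_duality[OF f P]) auto
  finally show ?thesis .
qed

text \<open>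
  Write \<open>E \<bar>I\<^bsub>j+1\<^esub>\<bar>\<^sup>p\<close> as the pairing of \<open>\<bar>I\<^bsub>j+1\<^esub>\<bar>\<^bsup>p-2\<^esup> I\<^bsub>j+1\<^esub>\<close> with the divergence of \<open>I\<^sub>j\<close> and integrate by
  parts. The gradient of the first function is bounded by \<open>(p - 1) \<bar>I\<^bsub>j+1\<^esub>\<bar>\<^bsup>p-2\<^esup> \<bar>\<nabla>I\<^bsub>j+1\<^esub>\<bar>\<close>, and \<open>\<nabla>I\<^bsub>j+1\<^esub> = (j + 1) I\<^sub>j\<close>.
  The result \<open>(p - 1) (j + 1) E \<bar>I\<^bsub>j+1\<^esub>\<bar>\<^bsup>p-2\<^esup> \<bar>I\<^sub>j\<bar>\<^sup>2\<close> is linear in \<open>j\<close>, which gives \<open>\<surd>(l!)\<close> and not \<open>l!\<close> after \<open>l\<close> steps.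
\<close>

lemma chaos_norm_step:
  fixes T :: "'b \<Rightarrow> nat list \<Rightarrow> real"
  assumes B: "finite B" and T: "\<And>b is js. mset is = mset js \<Longrightarrow> T b is = T b js" and p: "p \<ge> 2"
  shows "Lq_norm gauss p (\<lambda>x. L2_set (\<lambda>(b, is). chaos n (T b) (Suc j) is x) (B \<times> ilists n k))
    \<le> sqrt ((p - 1) * real (Suc j)) * Lq_norm gauss p (\<lambda>x. L2_set (\<lambda>(b, is). chaos n (T b) j is x) (B \<times> ilists n (Suc k)))"
proof -
  define A where "A = B \<times> ilists n k"
  define a where "a \<alpha> = (case \<alpha> of (b, is) \<Rightarrow> chaos n (T b) (Suc j) is)" for \<alpha>
  define w where "w \<alpha> i x = (case \<alpha> of (b, is) \<Rightarrow> chaos n (T b) j (i # is) x)" for \<alpha> i and x :: "nat \<Rightarrow> real"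
  define a' where "a' \<alpha> i x = real (Suc j) * w \<alpha> i x" for \<alpha> i x
  define Q where "Q x = L2_set (\<lambda>(\<alpha>, i). w \<alpha> i x) (A \<times> {..<n})" for x
  define D where "D = Lq_norm gauss p Q"
  have fin: "finite A" using B by (simp add: A_def)
  note P = C1_partials_chaos[where T="T b" for b, OF T]
  have a: "C1_partials n (a \<alpha>) (a' \<alpha>)" for \<alpha>
    using P[of n _ "Suc j" "snd \<alpha>"] by (simp add: a_def a'_def[abs_def] w_def case_prod_unfold)
  have tw: "tame n (w \<alpha> i)" for \<alpha> i
    unfolding w_def[abs_def] case_prod_unfold by (rule C1_partialsD(1)[OF P])
  have tQ: "tame n Q" unfolding Q_def[abs_def] by (rule tame_L2_set) (simp add: case_prod_unfold tw)
  have Q0: "Q x \<ge> 0" for x by (simp add: Q_def)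
  have La': "L2_set (\<lambda>(\<alpha>, i). a' \<alpha> i x) (A \<times> {..<n}) = real (Suc j) * Q x" for x
    unfolding Q_def a'_def case_prod_unfold by (rule L2_set_right_distrib[symmetric]) simp
  have "Lq_norm gauss p (\<lambda>x. L2_set (\<lambda>\<alpha>. a \<alpha> x) A) \<le> sqrt ((p - 1) * real (Suc j)) * D"
  proof (rule absorb_regularisation[OF C1_partialsD(1)[OF a] p])
    fix \<epsilon> :: real assume \<epsilon>: "\<epsilon> > 0"
    define g where "g = power_field p \<epsilon> A a"
    define g' where "g' = power_field_partial p \<epsilon> A a a'"
    define S where "S = reg_norm2 \<epsilon> A a"
    have g: "C1_partials n (g \<alpha>) (g' \<alpha>)" if "\<alpha> \<in> A" for \<alpha>
      unfolding g_def g'_def using C1_partials_power_field[OF fin a \<epsilon> that] .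
    have tS: "tame n S" unfolding S_def by (rule tame_reg_norm2) (rule C1_partialsD(1)[OF a])
    have tSr: "tame n (\<lambda>x. S x powr r)" for r
      using tS \<epsilon> unfolding S_def by (intro tame_powr_bounded_below[OF _ reg_norm2_ge])
    have Spos: "S x > 0" for x unfolding S_def by (rule reg_norm2_pos[OF \<epsilon>])
    have tg'w: "tame n (\<lambda>x. g' \<alpha> i x * w \<alpha> i x)" if "\<alpha> \<in> A" "i < n" for \<alpha> i
      by (rule tame_mult[OF C1_partialsD(3)[OF g[OF that(1)] that(2)] tw])
    have "(\<Sum>\<alpha>\<in>A. \<integral>x. g \<alpha> x * a \<alpha> x \<partial>gauss) = (\<Sum>\<alpha>\<in>A. \<Sum>i<n. \<integral>x. g' \<alpha> i x * w \<alpha> i x \<partial>gauss)"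
    proof (rule sum.cong[OF refl])
      fix \<alpha> assume "\<alpha> \<in> A"
      obtain b "is" where \<alpha>: "\<alpha> = (b, is)" by (cases \<alpha>)
      have "(\<integral>x. g \<alpha> x * chaos n (T b) (Suc j) is x \<partial>gauss) = (\<Sum>i<n. \<integral>x. g' \<alpha> i x * chaos n (T b) j (i # is) x \<partial>gauss)"
        by (rule chaos_duality[OF T g[OF \<open>\<alpha> \<in> A\<close>]])
      then show "(\<integral>x. g \<alpha> x * a \<alpha> x \<partial>gauss) = (\<Sum>i<n. \<integral>x. g' \<alpha> i x * w \<alpha> i x \<partial>gauss)"
        by (simp only: \<alpha> a_def w_def prod.case)
    qed
    also have "\<dots> = (\<integral>x. (\<Sum>\<alpha>\<in>A. \<Sum>i<n. g' \<alpha> i x * w \<alpha> i x) \<partial>gauss)"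
      by (rule gauss_integral_sum2[symmetric, where n=n], rule tg'w) auto
    also have "\<dots> \<le> (\<integral>x. (p - 1) * real (Suc j) * (S x powr ((p - 2) / 2) * (Q x)\<^sup>2) \<partial>gauss)"
    proof (rule integral_mono)
      show "integrable gauss (\<lambda>x. \<Sum>\<alpha>\<in>A. \<Sum>i<n. g' \<alpha> i x * w \<alpha> i x)"
        by (rule tame_integrable[where n=n], rule tame_sum, rule tame_sum, rule tg'w) auto
      show "integrable gauss (\<lambda>x. (p - 1) * real (Suc j) * (S x powr ((p - 2) / 2) * (Q x)\<^sup>2))"
        by (intro integrable_mult_right tame_integrable[OF tame_mult[OF tSr tame_power[OF tQ]]])
      fix x
      have "(\<Sum>\<alpha>\<in>A. \<Sum>i<n. g' \<alpha> i x * w \<alpha> i x) = (\<Sum>\<alpha>\<in>A. \<Sum>i<n. w \<alpha> i x * g' \<alpha> i x)" by (simp only: mult.commute)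
      also have "\<dots> \<le> (p - 1) * S x powr ((p - 2) / 2) * (Q x * (real (Suc j) * Q x))"
        using power_field_partial_bound[OF p \<epsilon>, where w="\<lambda>\<alpha> i. w \<alpha> i x" and A=A and n=n and a=a and a'=a' and x=x]
        unfolding La' g'_def S_def Q_def .
      finally show "(\<Sum>\<alpha>\<in>A. \<Sum>i<n. g' \<alpha> i x * w \<alpha> i x) \<le> (p - 1) * real (Suc j) * (S x powr ((p - 2) / 2) * (Q x)\<^sup>2)"
        by (simp only: power2_eq_square mult_ac)
    qed
    also have "\<dots> = (p - 1) * real (Suc j) * (\<integral>x. S x powr ((p - 2) / 2) * (Q x)\<^sup>2 \<partial>gauss)" by (rule integral_mult_right_zero)
    also have "\<dots> \<le> (p - 1) * real (Suc j) * ((\<integral>x. S x powr (p / 2) \<partial>gauss) powr (1 - 2 / p) * D\<^sup>2)"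
      unfolding D_def by (rule mult_left_mono[OF integral_weight_le[OF p tS Spos tSr tQ Q0]]) (use p in simp)
    finally show "(\<Sum>\<alpha>\<in>A. \<integral>x. power_field p \<epsilon> A a \<alpha> x * a \<alpha> x \<partial>gauss)
        \<le> (p - 1) * real (Suc j) * (\<integral>x. reg_norm2 \<epsilon> A a x powr (p / 2) \<partial>gauss) powr (1 - 2 / p) * D\<^sup>2"
      by (simp only: g_def S_def mult.assoc)
  qed (use p in \<open>auto simp: D_def\<close>)
  moreover have "Q = (\<lambda>x. L2_set (\<lambda>(b, is). chaos n (T b) j is x) (B \<times> ilists n (Suc k)))"
  proof
    fix x
    show "Q x = L2_set (\<lambda>(b, is). chaos n (T b) j is x) (B \<times> ilists n (Suc k))"
      using L2_set_ilists_Suc[of "\<lambda>b is. chaos n (T b) j is x" B n k]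
      by (simp add: Q_def w_def A_def case_prod_unfold)
  qed
  ultimately show ?thesis by (simp only: D_def a_def A_def case_prod_unfold)
qed

lemma chaos_norm:
  fixes T :: "'b \<Rightarrow> nat list \<Rightarrow> real"
  assumes B: "finite B" and T: "\<And>b is js. mset is = mset js \<Longrightarrow> T b is = T b js" and p: "p \<ge> 2"
  shows "Lq_norm gauss p (\<lambda>x. L2_set (\<lambda>(b, is). chaos n (T b) j is x) (B \<times> ilists n k))
    \<le> sqrt (fact j) * sqrt (p - 1) ^ j * L2_set (\<lambda>(b, is). T b is) (B \<times> ilists n (k + j))"
proof (induction j arbitrary: k)
  case 0
  show ?case using p by (simp add: Lq_norm_const)
next
  case (Suc j)
  have "Lq_norm gauss p (\<lambda>x. L2_set (\<lambda>(b, is). chaos n (T b) (Suc j) is x) (B \<times> ilists n k))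
    \<le> sqrt ((p - 1) * real (Suc j)) * Lq_norm gauss p (\<lambda>x. L2_set (\<lambda>(b, is). chaos n (T b) j is x) (B \<times> ilists n (Suc k)))"
    by (rule chaos_norm_step[OF B T p])
  also have "\<dots> \<le> sqrt ((p - 1) * real (Suc j)) * (sqrt (fact j) * sqrt (p - 1) ^ j * L2_set (\<lambda>(b, is). T b is) (B \<times> ilists n (Suc k + j)))"
    using p by (intro mult_left_mono Suc.IH) simp
  also have "\<dots> = sqrt (fact (Suc j)) * sqrt (p - 1) ^ Suc j * L2_set (\<lambda>(b, is). T b is) (B \<times> ilists n (k + Suc j))"
    by (simp add: real_sqrt_mult mult_ac)
  finally show ?case .
qed

section \<open>The expectation of an iterated derivative\<close>

text \<open>
  Derivatives are moved one by one from \<open>u\<close> onto the constant tensor \<open>T\<close>.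
\<close>

lemma jet_chaos_pairing:
  assumes u: "jet n u" and T: "\<And>is js. mset is = mset js \<Longrightarrow> T is = T js"
  shows "j \<le> l \<Longrightarrow> (\<Sum>is\<in>ilists n l. \<integral>x. u is x * T is \<partial>gauss)
    = (\<Sum>is\<in>ilists n (l - j). \<integral>x. u is x * chaos n T j is x \<partial>gauss)"
proof (induction j)
  case (Suc j)
  define k where "k = l - Suc j"
  have k: "l - j = Suc k" using Suc.prems by (simp add: k_def)
  have "(\<Sum>is\<in>ilists n (Suc k). \<integral>x. u is x * chaos n T j is x \<partial>gauss)
      = (\<Sum>is\<in>ilists n k. \<Sum>i<n. \<integral>x. u (i # is) x * chaos n T j (i # is) x \<partial>gauss)"
    by (rule sum_ilists_Suc)
  also have "\<dots> = (\<Sum>is\<in>ilists n k. \<integral>x. u is x * chaos n T (Suc j) is x \<partial>gauss)"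
    by (rule sum.cong[OF refl], rule chaos_duality[symmetric, OF T jetD[OF u]]) (auto simp: ilists_def)
  finally show ?case using Suc by (simp add: k k_def[symmetric])
qed simp

lemma Lq_norm_mono_exponent:
  assumes f: "tame n f" and pq: "0 < p" "p \<le> q"
  shows "Lq_norm gauss p f \<le> Lq_norm gauss q f"
proof (cases "p = q")
  case False
  then have "p < q" using pq by simp
  have i: "integrable gauss (\<lambda>x. \<bar>f x\<bar> powr q)" using pq by (intro tame_integrable[OF tame_abs_powr[OF f]]) auto
  have "(\<integral>x. 1 powr (1 - p / q) * (\<bar>f x\<bar> powr q) powr (p / q) \<partial>gauss)
      \<le> (\<integral>x. 1 \<partial>gauss) powr (1 - p / q) * (\<integral>x. \<bar>f x\<bar> powr q \<partial>gauss) powr (p / q)"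
    using pq \<open>p < q\<close> i by (intro integral_powr_interpolation) auto
  then have "(\<integral>x. \<bar>f x\<bar> powr p \<partial>gauss) \<le> (\<integral>x. \<bar>f x\<bar> powr q \<partial>gauss) powr (p / q)"
    using gauss.prob_space pq by (simp add: powr_powr)
  then have "(\<integral>x. \<bar>f x\<bar> powr p \<partial>gauss) powr (1 / p) \<le> ((\<integral>x. \<bar>f x\<bar> powr q \<partial>gauss) powr (p / q)) powr (1 / p)"
    using pq by (intro powr_mono2) (auto simp: integral_nonneg_AE)
  then show ?thesis using pq by (simp add: Lq_norm_def powr_powr)
qed simp

text \<open>
  With \<open>T\<close> the expectation itself, \<open>\<bar>T\<bar>\<^sup>2 = E \<langle>u, I\<^sub>l(T)\<rangle> \<le> \<parallel>u\<parallel>\<^sub>q \<parallel>I\<^sub>l(T)\<parallel>\<^sub>p\<close>, and one factor \<open>\<bar>T\<bar>\<close> cancels.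
  The bound on \<open>I\<^sub>l(T)\<close> requires \<open>p \<ge> 2\<close>: for \<open>q < 2\<close> the conjugate exponent is taken, for \<open>q \<ge> 2\<close> the
  exponent \<open>2\<close>, together with \<open>\<parallel>u\<parallel>\<^sub>2 \<le> \<parallel>u\<parallel>\<^sub>q\<close>.
\<close>

lemma expectation_derivative_bound:
  assumes B: "finite B" and u: "\<And>b. b \<in> B \<Longrightarrow> jet n (u b)" and q: "q > 1"
  shows "L2_set (\<lambda>(b, is). \<integral>x. u b is x \<partial>gauss) (B \<times> ilists n l)
    \<le> d_const l q * Lq_norm gauss q (\<lambda>x. L2_set (\<lambda>b. u b [] x) B)"
proof -
  \<comment> \<open>Set to 0 outside the range of indices, \<open>T\<close> is symmetric on all lists.\<close>
  define T where "T b is = (if b \<in> B \<and> set is \<subseteq> {..<n} then \<integral>x. u b is x \<partial>gauss else 0)" for b "is"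
  define N where "N = L2_set (\<lambda>(b, is). T b is) (B \<times> ilists n l)"
  define U where "U x = L2_set (\<lambda>b. u b [] x) B" for x
  define P where "P x = L2_set (\<lambda>b. chaos n (T b) l [] x) B" for x
  have T: "T b is = T b js" if "mset is = mset js" for b "is" js
  proof -
    have "set is = set js" using that by (rule mset_eq_setD)
    moreover have "u b is = u b js" if "b \<in> B" "set is \<subseteq> {..<n}"
      using jet_mset[OF u[OF that(1)] that(2) \<open>mset is = mset js\<close>] .
    ultimately show ?thesis by (auto simp: T_def)
  qed
  have tu: "tame n (u b is)" if "b \<in> B" "set is \<subseteq> {..<n}" for b "is" using jet_tame[OF u[OF that(1)] that(2)] .
  have tU: "tame n U" unfolding U_def[abs_def] by (rule tame_L2_set) (simp add: tu)
  have tch: "tame n (chaos n (T b) j is)" for b j "is" by (rule C1_partialsD(1)[OF C1_partials_chaos[OF T]])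
  have tP: "tame n P" unfolding P_def[abs_def] by (rule tame_L2_set) (rule tch)
  have nn: "U x \<ge> 0" "P x \<ge> 0" for x by (auto simp: U_def P_def)
  have Pnorm: "Lq_norm gauss p P \<le> sqrt (fact l) * sqrt (p - 1) ^ l * N" if "p \<ge> 2" for p
  proof -
    have P: "P = (\<lambda>x. L2_set (\<lambda>(b, is). chaos n (T b) l is x) (B \<times> ilists n 0))"
    proof
      fix x
      have "(\<Sum>p\<in>B \<times> {[]}. (case p of (b, is) \<Rightarrow> chaos n (T b) l is x)\<^sup>2) = (\<Sum>b\<in>B. \<Sum>is\<in>{[]}. (chaos n (T b) l is x)\<^sup>2)"
        by (simp only: sum.cartesian_product case_prod_unfold)
      then show "P x = L2_set (\<lambda>(b, is). chaos n (T b) l is x) (B \<times> ilists n 0)"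
        by (simp add: P_def L2_set_def)
    qed
    show ?thesis
      unfolding P N_def using chaos_norm[where T=T, OF B T that, where n=n and j=l and k=0] by simp
  qed
  have "N\<^sup>2 = (\<Sum>b\<in>B. \<Sum>is\<in>ilists n l. T b is * T b is)"
    unfolding N_def L2_set_def by (simp add: sum_nonneg sum.cartesian_product case_prod_unfold power2_eq_square)
  also have "\<dots> = (\<Sum>b\<in>B. \<Sum>is\<in>ilists n l. \<integral>x. u b is x * T b is \<partial>gauss)"
    by (intro sum.cong refl) (auto simp: T_def ilists_def)
  also have "\<dots> = (\<Sum>b\<in>B. \<integral>x. u b [] x * chaos n (T b) l [] x \<partial>gauss)"
  proof (rule sum.cong[OF refl])
    fix b assume "b \<in> B"
    show "(\<Sum>is\<in>ilists n l. \<integral>x. u b is x * T b is \<partial>gauss) = (\<integral>x. u b [] x * chaos n (T b) l [] x \<partial>gauss)"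
      using jet_chaos_pairing[where T="T b", OF u[OF \<open>b \<in> B\<close>] T order_refl, of l] by simp
  qed
  also have "\<dots> = (\<integral>x. (\<Sum>b\<in>B. u b [] x * chaos n (T b) l [] x) \<partial>gauss)"
    by (rule gauss_integral_sum[symmetric, where n=n], rule tame_mult[OF tu tch]) auto
  also have "\<dots> \<le> (\<integral>x. U x * P x \<partial>gauss)"
  proof (rule integral_mono)
    show "integrable gauss (\<lambda>x. \<Sum>b\<in>B. u b [] x * chaos n (T b) l [] x)"
      by (rule tame_integrable[where n=n], rule tame_sum, rule tame_mult[OF tu tch]) auto
    show "integrable gauss (\<lambda>x. U x * P x)" by (rule tame_integrable[OF tame_mult[OF tU tP]])
    show "(\<Sum>b\<in>B. u b [] x * chaos n (T b) l [] x) \<le> U x * P x" for x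
      unfolding U_def P_def by (rule abs_le_D1[OF abs_sum_mult_le_L2])
  qed
  finally have NUP: "N\<^sup>2 \<le> (\<integral>x. U x * P x \<partial>gauss)" .
  have N0: "N \<ge> 0" by (simp add: N_def)
  have NN: "N\<^sup>2 \<le> d_const l q * Lq_norm gauss q U * N"
  proof (cases "q \<ge> 2")
    case True
    have "(\<integral>x. U x * P x \<partial>gauss) \<le> Lq_norm gauss 2 U * Lq_norm gauss 2 P"
      by (rule holder_conjugate[OF tU tP]) (auto simp: nn)
    also have "\<dots> \<le> Lq_norm gauss q U * (sqrt (fact l) * sqrt (2 - 1) ^ l * N)"
      using True by (intro mult_mono Lq_norm_mono_exponent[OF tU] Pnorm) auto
    finally show ?thesis using NUP True by (simp add: d_const_def mult_ac)
  next
    case False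
    define p where "p = conj_exponent q"
    have p: "p \<ge> 2" "1 / q + 1 / p = 1"
      using q False by (auto simp: p_def conj_exponent_def field_simps)
    have "(\<integral>x. U x * P x \<partial>gauss) \<le> Lq_norm gauss q U * Lq_norm gauss p P"
      by (rule holder_conjugate[OF tU tP q p(2)]) (auto simp: nn)
    also have "\<dots> \<le> Lq_norm gauss q U * (sqrt (fact l) * sqrt (p - 1) ^ l * N)"
      by (intro mult_left_mono Pnorm p) auto
    also have "sqrt (p - 1) ^ l = (p - 1) powr (real l / 2)"
      using p(1) by (simp add: powr_half_sqrt[symmetric] powr_realpow[symmetric] powr_powr)
    finally show ?thesis using NUP False by (simp add: d_const_def p_def mult_ac)
  qed
  have "N \<le> d_const l q * Lq_norm gauss q U"
  proof (cases "N = 0")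
    case True
    have "d_const l q \<ge> 0" by (simp add: d_const_def)
    then show ?thesis using True by simp
  next
    case False
    then have "N > 0" using N0 by simp
    then show ?thesis using NN by (simp add: power2_eq_square)
  qed
  moreover have "N = L2_set (\<lambda>(b, is). \<integral>x. u b is x \<partial>gauss) (B \<times> ilists n l)"
    unfolding N_def by (rule L2_set_cong) (auto simp: T_def ilists_def)
  ultimately show ?thesis by (simp add: U_def[abs_def])
qed

section \<open>The Sobolev inequality on Gaussian space\<close>

text \<open>
  Split the derivatives of order \<open>l\<close> into their fluctuations and their expectations.
\<close>

lemma jet_norm_interpolation:
  assumes B: "finite B" and u: "\<And>b. b \<in> B \<Longrightarrow> jet n (u b)" and q: "q > 1"
  defines "N \<equiv> \<lambda>l. Lq_norm gauss q (\<lambda>x. L2_set (\<lambda>(b, is). u b is x) (B \<times> ilists n l))"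
  shows "N l \<le> c_const q * N (Suc l) + d_const l q * Lq_norm gauss q (\<lambda>x. L2_set (\<lambda>b. u b [] x) B)"
proof -
  define A where "A = B \<times> ilists n l"
  define f where "f \<alpha> = u (fst \<alpha>) (snd \<alpha>)" for \<alpha>
  define f' where "f' \<alpha> i = u (fst \<alpha>) (i # snd \<alpha>)" for \<alpha> i
  define m where "m \<alpha> = (\<integral>x. f \<alpha> x \<partial>gauss)" for \<alpha>
  have fin: "finite A" using B by (simp add: A_def)
  have f: "C1_partials n (f \<alpha>) (f' \<alpha>)" if "\<alpha> \<in> A" for \<alpha>
  proof -
    have "fst \<alpha> \<in> B" "set (snd \<alpha>) \<subseteq> {..<n}" using that by (auto simp: A_def ilists_def)
    then show ?thesis unfolding f_def f'_def by (intro jetD u)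
  qed
  have tf: "tame n (f \<alpha>)" if "\<alpha> \<in> A" for \<alpha> by (rule C1_partialsD(1)[OF f[OF that]])
  have "N l = Lq_norm gauss q (\<lambda>x. L2_set (\<lambda>\<alpha>. f \<alpha> x) A)"
    by (simp add: N_def f_def A_def case_prod_unfold)
  also have "\<dots> \<le> Lq_norm gauss q (\<lambda>x. L2_set (\<lambda>\<alpha>. f \<alpha> x - m \<alpha>) A) + Lq_norm gauss q (\<lambda>x. L2_set m A)"
  proof (rule Lq_norm_triangle[where n=n])
    show "tame n (\<lambda>x. L2_set (\<lambda>\<alpha>. f \<alpha> x - m \<alpha>) A)"
      by (rule tame_L2_set, rule tame_diff[OF tf tame_const])
    show "tame n (\<lambda>x. L2_set (\<lambda>\<alpha>. f \<alpha> x) A)" by (rule tame_L2_set, rule tf)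
    show "\<bar>L2_set (\<lambda>\<alpha>. f \<alpha> x) A\<bar> \<le> \<bar>L2_set (\<lambda>\<alpha>. f \<alpha> x - m \<alpha>) A\<bar> + \<bar>L2_set m A\<bar>" for x
      using L2_set_triangle_ineq[of "\<lambda>\<alpha>. f \<alpha> x - m \<alpha>" m A] by simp
  qed (use q in auto)
  also have "Lq_norm gauss q (\<lambda>x. L2_set m A) = L2_set m A" using q by (simp add: Lq_norm_const)
  also have "\<dots> \<le> d_const l q * Lq_norm gauss q (\<lambda>x. L2_set (\<lambda>b. u b [] x) B)"
    using expectation_derivative_bound[where l=l, OF B u q]
    by (simp add: m_def[abs_def] f_def A_def case_prod_unfold)
  also have "Lq_norm gauss q (\<lambda>x. L2_set (\<lambda>\<alpha>. f \<alpha> x - m \<alpha>) A) \<le> c_const q * Lq_norm gauss q (\<lambda>x. L2_set (\<lambda>(\<alpha>, i). f' \<alpha> i x) (A \<times> {..<n}))"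
    unfolding m_def by (rule poincare[OF fin f q])
  also have "(\<lambda>x. L2_set (\<lambda>(\<alpha>, i). f' \<alpha> i x) (A \<times> {..<n})) = (\<lambda>x. L2_set (\<lambda>(b, is). u b is x) (B \<times> ilists n (Suc l)))"
  proof
    fix x
    show "L2_set (\<lambda>(\<alpha>, i). f' \<alpha> i x) (A \<times> {..<n}) = L2_set (\<lambda>(b, is). u b is x) (B \<times> ilists n (Suc l))"
      using L2_set_ilists_Suc[of "\<lambda>b is. u b is x" B n l] by (simp add: f'_def A_def case_prod_unfold)
  qed
  finally show ?thesis by (simp add: N_def)
qed

lemma powr_sum_le:
  fixes x y q :: real
  assumes "x \<ge> 0" "y \<ge> 0" "q \<ge> 1"
  shows "(x powr q + y powr q) powr (1 / q) \<le> x + y"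
proof (cases "x + y = 0")
  case True
  then have "x = 0" "y = 0" using assms by auto
  then show ?thesis using assms by simp
next
  case False
  then have s: "x + y > 0" using assms by linarith
  have t: "t powr q \<le> t" if "0 \<le> t" "t \<le> 1" for t
    using powr_mono'[of 1 q t] that assms(3) by simp
  have "x powr q + y powr q = (x + y) powr q * ((x / (x + y)) powr q + (y / (x + y)) powr q)"
    using s assms by (simp add: powr_divide distrib_left)
  also have "\<dots> \<le> (x + y) powr q * (x / (x + y) + y / (x + y))"
    using s assms by (intro mult_left_mono add_mono t) auto
  also have "\<dots> = (x + y) powr q" using s by (simp add: add_divide_distrib[symmetric])
  finally have "(x powr q + y powr q) powr (1 / q) \<le> ((x + y) powr q) powr (1 / q)"
    using assms by (intro powr_mono2) auto
  also have "\<dots> = x + y" using s assms by (simp add: powr_powr)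
  finally show ?thesis .
qed

text \<open>
  In the induction step \<open>a\<^sub>k\<close> is replaced by its bound through \<open>a\<^bsub>k+1\<^esub>\<close> and \<open>a\<^sub>0\<close>; the new summand
  \<open>a\<^bsub>k+1\<^esub>\<close> fits into the same factor \<open>1 + m\<close> because the product accumulated so far is at least \<open>1\<close>.
\<close>

lemma interpolation_chain:
  fixes a :: "nat \<Rightarrow> real"
  assumes a: "\<And>l. a l \<ge> 0" and q: "q > 1"
    and step: "\<And>l. l \<ge> 1 \<Longrightarrow> a l \<le> c_const q * a (Suc l) + d_const l q * a 0"
  shows "(a 0 powr q + (\<Sum>l=1..Suc k. a l powr q)) powr (1 / q) \<le> tau_const (Suc k) q * (a 0 + a (Suc k))"
proof (induction k)
  case 0
  show ?case using powr_sum_le[of "a 0" "a 1" q] a q by (simp add: tau_const_def)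
next
  case (Suc k)
  define s where "s = (a 0 powr q + (\<Sum>l=1..Suc k. a l powr q)) powr (1 / q)"
  define m where "m = max (d_const (Suc k) q) (c_const q)"
  define t where "t = tau_const (Suc k) q"
  have t1: "t \<ge> 1"
    unfolding t_def tau_const_def
    by (intro prod_ge_1) (simp add: d_const_def le_max_iff_disj)
  have t_Suc: "tau_const (Suc (Suc k)) q = t * (1 + m)" by (simp add: t_def tau_const_def m_def)
  have sq: "s powr q = a 0 powr q + (\<Sum>l=1..Suc k. a l powr q)"
    unfolding s_def using q by (simp add: powr_powr sum_nonneg add_nonneg_nonneg)
  have "(a 0 powr q + (\<Sum>l=1..Suc (Suc k). a l powr q)) powr (1 / q) = (s powr q + a (Suc (Suc k)) powr q) powr (1 / q)"
    unfolding sq by (simp add: add.assoc)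
  also have "\<dots> \<le> s + a (Suc (Suc k))" using a q by (intro powr_sum_le) (auto simp: s_def)
  also have "\<dots> \<le> t * (a 0 + a (Suc k)) + a (Suc (Suc k))" using Suc.IH by (simp add: s_def t_def)
  also have "\<dots> \<le> t * (a 0 + (m * a (Suc (Suc k)) + m * a 0)) + t * a (Suc (Suc k))"
  proof (intro add_mono mult_left_mono)
    have "a (Suc k) \<le> c_const q * a (Suc (Suc k)) + d_const (Suc k) q * a 0" by (rule step) simp
    also have "\<dots> \<le> m * a (Suc (Suc k)) + m * a 0"
      using a by (intro add_mono mult_right_mono) (auto simp: m_def)
    finally show "a (Suc k) \<le> m * a (Suc (Suc k)) + m * a 0" .
    show "a (Suc (Suc k)) \<le> t * a (Suc (Suc k))" using mult_right_mono[OF t1 a[of "Suc (Suc k)"]] by simp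
  qed (use t1 in auto)
  also have "\<dots> = t * (1 + m) * (a 0 + a (Suc (Suc k)))" by (simp add: algebra_simps)
  finally show ?case by (simp only: t_Suc)
qed

lemma graph_norm_lower_bound:
  fixes a :: "nat \<Rightarrow> real"
  assumes a: "\<And>l. a l \<ge> 0" and q: "q > 1" and k: "k \<ge> 1"
  shows "2 powr (1 / q - 1) * (a 0 + a k) \<le> (a 0 powr q + (\<Sum>l=1..k. a l powr q)) powr (1 / q)"
proof -
  have "(a 0 + a k) powr q = 2 powr q * (1 / 2 * a 0 + 1 / 2 * a k) powr q"
  proof -
    have "a 0 + a k = 2 * (1 / 2 * a 0 + 1 / 2 * a k)" by simp
    then show ?thesis using a powr_mult[of 2 "1 / 2 * a 0 + 1 / 2 * a k" q] by simp
  qed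
  also have "\<dots> \<le> 2 powr q * (1 / 2 * a 0 powr q + 1 / 2 * a k powr q)"
    using a q by (intro mult_left_mono powr_convex_nonneg) auto
  also have "\<dots> = 2 powr (q - 1) * (a 0 powr q + a k powr q)"
    by (simp add: powr_diff field_simps)
  also have "a k powr q \<le> (\<Sum>l=1..k. a l powr q)"
    using k by (intro member_le_sum) auto
  finally have "(a 0 + a k) powr q \<le> 2 powr (q - 1) * (a 0 powr q + (\<Sum>l=1..k. a l powr q))" by simp
  then have "((a 0 + a k) powr q) powr (1 / q) \<le> (2 powr (q - 1) * (a 0 powr q + (\<Sum>l=1..k. a l powr q))) powr (1 / q)"
    using q by (intro powr_mono2) auto
  also have "\<dots> = 2 powr (1 - 1 / q) * (a 0 powr q + (\<Sum>l=1..k. a l powr q)) powr (1 / q)"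
  proof -
    have "(q - 1) * (1 / q) = 1 - 1 / q" using q by (simp add: field_simps)
    then show ?thesis
      by (subst powr_mult) (simp_all only: powr_powr)
  qed
  finally have "a 0 + a k \<le> 2 powr (1 - 1 / q) * (a 0 powr q + (\<Sum>l=1..k. a l powr q)) powr (1 / q)"
    using a q by (simp add: powr_powr)
  then have "2 powr (1 / q - 1) * (a 0 + a k) \<le> 2 powr (1 / q - 1) * (2 powr (1 - 1 / q) * (a 0 powr q + (\<Sum>l=1..k. a l powr q)) powr (1 / q))"
    by (rule mult_left_mono) simp
  also have "\<dots> = (a 0 powr q + (\<Sum>l=1..k. a l powr q)) powr (1 / q)"
    by (simp add: mult.assoc[symmetric] powr_add[symmetric])
  finally show ?thesis .
qed

section \<open>Gaussian families\<close>

text \<open>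
  The degenerate and the nondegenerate case of \<open>centered_gaussian\<close> under one description,
  by the variance.
\<close>

lemma (in prob_space) centered_gaussian_char:
  assumes "centered_gaussian X"
  shows "integrable M (\<lambda>\<omega>. (X \<omega>)\<^sup>2)"
    and "(CLINT \<omega>|M. iexp (X \<omega>)) = of_real (exp (- expectation (\<lambda>\<omega>. (X \<omega>)\<^sup>2) / 2))"
    and "expectation (\<lambda>\<omega>. (X \<omega>)\<^sup>2) = 0 \<Longrightarrow> AE \<omega> in M. X \<omega> = 0"
proof -
  have X[measurable]: "random_variable borel X" using assms by (simp add: centered_gaussian_def)
  have "integrable M (\<lambda>\<omega>. (X \<omega>)\<^sup>2) \<and> (CLINT \<omega>|M. iexp (X \<omega>)) = of_real (exp (- expectation (\<lambda>\<omega>. (X \<omega>)\<^sup>2) / 2))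
     \<and> (expectation (\<lambda>\<omega>. (X \<omega>)\<^sup>2) = 0 \<longrightarrow> (AE \<omega> in M. X \<omega> = 0))"
  proof (cases "AE \<omega> in M. X \<omega> = 0")
    case True
    have "integrable M (\<lambda>\<omega>. (X \<omega>)\<^sup>2) = integrable M (\<lambda>\<omega>. 0 :: real)"
      using True by (intro integrable_cong_AE) auto
    moreover have "expectation (\<lambda>\<omega>. (X \<omega>)\<^sup>2) = expectation (\<lambda>\<omega>. 0)"
      using True by (intro integral_cong_AE) auto
    moreover have "(CLINT \<omega>|M. iexp (X \<omega>)) = (CLINT \<omega>|M. 1)"
      using True by (intro integral_cong_AE) auto
    ultimately show ?thesis using True prob_space by simp
  next
    case False
    then obtain \<sigma> where \<sigma>: "\<sigma> > 0" and D: "distributed M lborel X (normal_density 0 \<sigma>)"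
      using assms by (auto simp: centered_gaussian_def)
    have i: "integrable M (\<lambda>\<omega>. (X \<omega>)\<^sup>2)"
      using integrable_normal_moment[OF \<sigma>, of 0 2] distributed_integrable[OF D, of "\<lambda>x. x\<^sup>2"] by simp
    have v: "expectation (\<lambda>\<omega>. (X \<omega>)\<^sup>2) = \<sigma>\<^sup>2"
      using integral_normal_moment_even[OF \<sigma>, of 0 1] distributed_integral[OF D, of "\<lambda>x. x\<^sup>2"]
      by (simp add: fact_numeral)
    have "distributed M lborel (\<lambda>\<omega>. (X \<omega> - 0) / \<sigma>) std_normal_density"
      using D normal_standard_normal_convert[OF \<sigma>, of X 0] by simp
    then have "distr M lborel (\<lambda>\<omega>. X \<omega> / \<sigma>) = std_normal_distribution"
      by (simp add: distributed_distr_eq_density)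
    moreover have "distr M lborel (\<lambda>\<omega>. X \<omega> / \<sigma>) = distr M borel (\<lambda>\<omega>. X \<omega> / \<sigma>)"
      by (rule distr_cong) auto
    ultimately have law: "distr M borel (\<lambda>\<omega>. X \<omega> / \<sigma>) = std_normal_distribution" by simp
    have "(CLINT \<omega>|M. iexp (X \<omega>)) = (CLINT \<omega>|M. iexp (\<sigma> * (X \<omega> / \<sigma>)))" using \<sigma> by simp
    also have "\<dots> = (CLINT t|distr M borel (\<lambda>\<omega>. X \<omega> / \<sigma>). iexp (\<sigma> * t))"
      by (rule integral_distr[symmetric]) auto
    also have "\<dots> = of_real (exp (- (\<sigma>\<^sup>2) / 2))"
      unfolding law using char_std_normal_distribution by (simp add: char_def fun_eq_iff)
    finally show ?thesis using i v \<sigma> by simp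
  qed
  then show "integrable M (\<lambda>\<omega>. (X \<omega>)\<^sup>2)"
    "(CLINT \<omega>|M. iexp (X \<omega>)) = of_real (exp (- expectation (\<lambda>\<omega>. (X \<omega>)\<^sup>2) / 2))"
    "expectation (\<lambda>\<omega>. (X \<omega>)\<^sup>2) = 0 \<Longrightarrow> AE \<omega> in M. X \<omega> = 0" by auto
qed

context isonormal_process
begin

lemma W_gaussian: "centered_gaussian (W h)"
  using gaussian_family[of "{h}" "\<lambda>_. 1"] by simp

lemma W_measurable [measurable]: "random_variable borel (W h)"
  using W_gaussian by (simp add: centered_gaussian_def)

lemma W_product_integrable: "integrable M (\<lambda>\<omega>. W h \<omega> * W g \<omega>)"
proof (rule Bochner_Integration.integrable_bound)
  show "integrable M (\<lambda>\<omega>. (W h \<omega>)\<^sup>2 + (W g \<omega>)\<^sup>2)"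
    by (intro Bochner_Integration.integrable_add centered_gaussian_char(1) W_gaussian)
  have "\<bar>a * b\<bar> \<le> a\<^sup>2 + b\<^sup>2" for a b :: real
    using sum_squares_bound[of a b] sum_squares_bound[of "-a" b] by (simp add: abs_le_iff)
  then show "AE \<omega> in M. norm (W h \<omega> * W g \<omega>) \<le> norm ((W h \<omega>)\<^sup>2 + (W g \<omega>)\<^sup>2)"
    by simp
qed simp

lemma W_sum_variance:
  assumes "finite A"
  shows "expectation (\<lambda>\<omega>. (\<Sum>h\<in>A. c h * W h \<omega>)\<^sup>2) = (norm (\<Sum>h\<in>A. c h *\<^sub>R h))\<^sup>2"
proof -
  have "expectation (\<lambda>\<omega>. (\<Sum>h\<in>A. c h * W h \<omega>)\<^sup>2) = expectation (\<lambda>\<omega>. \<Sum>h\<in>A. \<Sum>g\<in>A. c h * c g * (W h \<omega> * W g \<omega>))"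
    by (simp add: power2_eq_square sum_product mult_ac)
  also have "\<dots> = (\<Sum>h\<in>A. \<Sum>g\<in>A. c h * c g * (h \<bullet> g))"
    by (simp add: Bochner_Integration.integral_sum Bochner_Integration.integrable_sum W_product_integrable covariance)
  also have "\<dots> = (norm (\<Sum>h\<in>A. c h *\<^sub>R h))\<^sup>2"
    by (simp add: power2_norm_eq_inner inner_sum_left inner_sum_right sum_distrib_left inner_commute mult_ac)
  finally show ?thesis .
qed

text \<open>
  The difference of the two sides is a centered Gaussian variable of variance \<open>0\<close>. This is why
  the change of basis in \<open>H\<close> holds almost surely only.
\<close>

lemma W_linear:
  assumes "finite A" "x = (\<Sum>g\<in>A. c g *\<^sub>R g)"
  shows "AE \<omega> in M. W x \<omega> = (\<Sum>g\<in>A. c g * W g \<omega>)"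
proof -
  \<comment> \<open>\<open>x\<close> may itself belong to \<open>A\<close>; the coefficients of the difference are then added.\<close>
  define d where "d g = (if g = x then 1 else 0) - (if g \<in> A then c g else 0)" for g
  have fin: "finite (insert x A)" using assms by simp
  have split: "(\<Sum>g\<in>insert x A. d g *\<^sub>R (k g :: 'b::real_vector)) = k x - (\<Sum>g\<in>A. c g *\<^sub>R k g)" for k
  proof -
    have "(\<Sum>g\<in>insert x A. d g *\<^sub>R k g) = (\<Sum>g\<in>insert x A. (if g = x then k g else 0)) - (\<Sum>g\<in>insert x A. (if g \<in> A then c g *\<^sub>R k g else 0))"
      unfolding sum_subtractf[symmetric] by (intro sum.cong refl) (auto simp: d_def scaleR_diff_left)
    also have "(\<Sum>g\<in>insert x A. (if g = x then k g else 0)) = k x" using fin by (simp add: sum.delta)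
    also have "(\<Sum>g\<in>insert x A. (if g \<in> A then c g *\<^sub>R k g else 0)) = (\<Sum>g\<in>A. c g *\<^sub>R k g)"
      by (rule sum.mono_neutral_cong_right[OF fin]) auto
    finally show ?thesis .
  qed
  have "expectation (\<lambda>\<omega>. (\<Sum>g\<in>insert x A. d g * W g \<omega>)\<^sup>2) = 0"
    using W_sum_variance[OF fin, of d] split[of "\<lambda>g. g"] assms(2) by simp
  then have "AE \<omega> in M. (\<Sum>g\<in>insert x A. d g * W g \<omega>) = 0"
    by (rule centered_gaussian_char(3)[OF gaussian_family[OF fin]])
  moreover have "(\<Sum>g\<in>insert x A. d g * W g \<omega>) = W x \<omega> - (\<Sum>g\<in>A. c g * W g \<omega>)" for \<omega>
    using split[of "\<lambda>g. W g \<omega>"] by simp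
  ultimately show ?thesis by simp
qed

lemma W_orthonormal_char:
  fixes e :: "nat \<Rightarrow> 'h"
  assumes e: "\<And>k l. k < n \<Longrightarrow> l < n \<Longrightarrow> e k \<bullet> e l = (if k = l then 1 else 0)"
  shows "(CLINT \<omega>|M. iexp (\<Sum>k<n. c k * W (e k) \<omega>)) = of_real (exp (- (\<Sum>k<n. (c k)\<^sup>2) / 2))"
proof -
  have inj: "inj_on e {..<n}"
  proof (rule inj_onI)
    fix k l assume kl: "k \<in> {..<n}" "l \<in> {..<n}" "e k = e l"
    then show "k = l" using e[of k l] e[of k k] by (auto split: if_splits)
  qed
  define d where "d = (\<lambda>g. c (the_inv_into {..<n} e g))"
  have d: "d (e k) = c k" if "k < n" for k
    unfolding d_def using that by (simp add: the_inv_into_f_f[OF inj])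
  have sum: "(\<Sum>k<n. c k * W (e k) \<omega>) = (\<Sum>g\<in>e ` {..<n}. d g * W g \<omega>)" for \<omega>
    by (subst sum.reindex[OF inj]) (simp add: d)
  have "(norm (\<Sum>g\<in>e ` {..<n}. d g *\<^sub>R g))\<^sup>2 = (norm (\<Sum>k<n. c k *\<^sub>R e k))\<^sup>2"
    by (subst sum.reindex[OF inj]) (simp add: d)
  also have "\<dots> = (\<Sum>k<n. \<Sum>l<n. c k * (c l * (e k \<bullet> e l)))"
    by (simp add: power2_norm_eq_inner inner_sum_left inner_sum_right sum_distrib_left inner_commute mult_ac)
  also have "\<dots> = (\<Sum>k<n. \<Sum>l<n. if l = k then c k * c k else 0)"
    by (intro sum.cong refl) (auto simp: e)
  also have "\<dots> = (\<Sum>k<n. (c k)\<^sup>2)" by (intro sum.cong refl) (simp add: power2_eq_square)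
  finally have "(norm (\<Sum>g\<in>e ` {..<n}. d g *\<^sub>R g))\<^sup>2 = (\<Sum>k<n. (c k)\<^sup>2)" .
  then have "(CLINT \<omega>|M. iexp (\<Sum>g\<in>e ` {..<n}. d g * W g \<omega>)) = of_real (exp (- (\<Sum>k<n. (c k)\<^sup>2) / 2))"
    using centered_gaussian_char(2)[OF gaussian_family[OF finite_imageI[OF finite_lessThan], of d e n]]
    by (simp only: W_sum_variance[OF finite_imageI[OF finite_lessThan]])
  then show ?thesis by (simp only: sum)
qed

end

section \<open>Jets of smooth functions and linear changes of variables\<close>

lemma depends_on_first_pdiff:
  assumes "depends_on_first m f" shows "depends_on_first m (pdiff i f)"
  unfolding depends_on_first_def
proof (intro allI impI)
  fix x y :: "nat \<Rightarrow> real" assume xy: "\<forall>j<m. x j = y j"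
  have eq: "f (x(i := t)) = f (y(i := t))" for t
    using assms xy unfolding depends_on_first_def by simp
  show "pdiff i f x = pdiff i f y"
  proof (cases "i < m")
    case True
    then show ?thesis using xy by (simp add: pdiff_def eq)
  next
    case False
    have "f (z(i := t)) = f z" for z t
      using assms False unfolding depends_on_first_def by simp
    then show ?thesis by (simp add: pdiff_def)
  qed
qed

lemma jet_pdiffs:
  assumes f: "smooth_poly_growth m f" shows "jet m (\<lambda>is. pdiffs is f)"
  unfolding jet_def
proof (intro allI impI)
  fix "is" :: "nat list" assume iss: "set is \<subseteq> {..<m}"
  have dep: "depends_on_first m (pdiffs js f)" for js
    using f by (induction js) (auto simp: pdiffs_def smooth_poly_growth_def intro: depends_on_first_pdiff)
  have cont: "continuous_on UNIV (pdiffs js f)" if "set js \<subseteq> {..<m}" for js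
    using f that unfolding smooth_poly_growth_def by blast
  have tame: "tame m (pdiffs js f)" if "set js \<subseteq> {..<m}" for js
    using f that dep[of js] borel_measurable_continuous_onI[OF cont[OF that]]
    unfolding tame_def smooth_poly_growth_def by blast
  show "C1_partials m (pdiffs is f) (\<lambda>i. pdiffs (i # is) f)"
    unfolding C1_partials_def
  proof (intro conjI allI impI)
    fix i x assume i: "i < m"
    show "tame m (pdiffs (i # is) f)" "continuous_on UNIV (pdiffs (i # is) f)"
      using i iss by (auto intro!: tame cont)
    have "(\<lambda>t. pdiffs is f (x(i := t))) differentiable (at (x i))"
      using f iss i unfolding smooth_poly_growth_def by blast
    then show "((\<lambda>t. pdiffs is f (x(i := t))) has_real_derivative pdiffs (i # is) f x) (at (x i))"
      by (simp add: DERIV_deriv_iff_real_differentiable[symmetric] pdiffs_def pdiff_def)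
  qed (use iss in \<open>auto intro!: tame cont\<close>)
qed

lemma C1_partials_cong:
  assumes "C1_partials n f f'" "f = g" "\<And>i. i < n \<Longrightarrow> f' i = g' i"
  shows "C1_partials n g g'"
  using assms unfolding C1_partials_def by auto

lemma C1_partials_cmult:
  assumes "C1_partials n f f'" shows "C1_partials n (\<lambda>x. c * f x) (\<lambda>i x. c * f' i x)"
  using assms unfolding C1_partials_def
  by (auto intro!: tame_cmult continuous_on_mult_left DERIV_cmult)

lemma C1_partials_sum:
  assumes "\<And>j. j \<in> I \<Longrightarrow> C1_partials n (f j) (f' j)"
  shows "C1_partials n (\<lambda>x. \<Sum>j\<in>I. f j x) (\<lambda>i x. \<Sum>j\<in>I. f' j i x)"
  using assms unfolding C1_partials_def
  by (auto intro!: tame_sum continuous_on_sum DERIV_sum)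

lemma C1_partials_linear:
  fixes a :: "nat \<Rightarrow> nat \<Rightarrow> real" and n :: nat
  assumes f: "C1_partials m f f'"
  defines "L \<equiv> \<lambda>x i. \<Sum>k<n. a i k * x k"
  shows "C1_partials n (\<lambda>x. f (L x)) (\<lambda>k x. \<Sum>i<m. a i k * f' i (L x))"
proof -
  define K where "K = (\<Sum>i<m. \<Sum>k<n. \<bar>a i k\<bar>)"
  have bound: "\<bar>L x i\<bar> \<le> K * (1 + L2_set x {..<n})" if "i < m" for x i
  proof -
    have "\<bar>L x i\<bar> \<le> (\<Sum>k<n. \<bar>a i k\<bar> * (1 + L2_set x {..<n}))"
      unfolding L_def
      by (rule order_trans[OF sum_abs], rule sum_mono)
         (auto simp: abs_mult intro!: mult_left_mono abs_coordinate_le_L2_set)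
    also have "\<dots> = (\<Sum>k<n. \<bar>a i k\<bar>) * (1 + L2_set x {..<n})" by (rule sum_distrib_right[symmetric])
    also have "\<dots> \<le> K * (1 + L2_set x {..<n})"
      unfolding K_def using that
      by (intro mult_right_mono member_le_sum[of i "{..<m}" "\<lambda>i. \<Sum>k<n. \<bar>a i k\<bar>"]) (auto intro: sum_nonneg)
    finally show ?thesis .
  qed
  have K0: "K \<ge> 0" unfolding K_def by (intro sum_nonneg) auto
  have cL: "continuous_on UNIV L"
    unfolding L_def
    by (intro continuous_on_coordinatewise_then_product continuous_on_sum continuous_on_mult continuous_on_const continuous_on_product_coordinates)
  have tL: "tame n (\<lambda>x. g (L x))" if "tame m g" for g
  proof (rule tame_compose[OF that _ K0])
    show "L \<in> borel_measurable borel" by (rule borel_measurable_continuous_onI[OF cL])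
    show "\<bar>L x i\<bar> \<le> K * (1 + L2_set x {..<n})" if "i < m" for x i by (rule bound[OF that])
    show "L x i = L y i" if "\<forall>j<n. x j = y j" for x y i
      unfolding L_def using that by (intro sum.cong) auto
  qed
  show ?thesis
    unfolding C1_partials_def
  proof (intro conjI allI impI)
    show "tame n (\<lambda>x. f (L x))" by (rule tL[OF C1_partialsD(1)[OF f]])
    show "continuous_on UNIV (\<lambda>x. f (L x))"
      by (rule continuous_on_compose2[OF C1_partialsD(2)[OF f] cL]) auto
    fix k assume k: "k < n"
    show "tame n (\<lambda>x. \<Sum>i<m. a i k * f' i (L x))"
      by (rule tame_sum, rule tame_cmult, rule tL, rule C1_partialsD(3)[OF f]) simp
    show "continuous_on UNIV (\<lambda>x. \<Sum>i<m. a i k * f' i (L x))"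
      by (intro continuous_on_sum continuous_on_mult continuous_on_const
          continuous_on_compose2[OF C1_partialsD(4)[OF f] cL]) auto
    fix x
    have L: "L (x(k := t)) i = L (x(k := 0)) i + a i k * t" for t i
    proof -
      have "L (x(k := t)) i = (\<Sum>l<n. a i l * (x(k := 0)) l + (if l = k then a i k * t else 0))"
        unfolding L_def by (intro sum.cong) auto
      then show ?thesis using k by (simp add: L_def sum.distrib)
    qed
    have "((\<lambda>t. f (L (x(k := t)))) has_real_derivative (\<Sum>i<m. f' i (L (x(k := x k))) * a i k)) (at (x k))"
      by (rule C1_partials_chain[OF f]) (subst L, auto intro!: derivative_eq_intros)
    then show "((\<lambda>t. f (L (x(k := t)))) has_real_derivative (\<Sum>i<m. a i k * f' i (L x))) (at (x k))"
      by (simp add: mult.commute)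
  qed
qed

lemma tensor_kernel_Cons: "tensor_kernel (h # hs) (g # gs) = (h \<bullet> g) * tensor_kernel hs gs"
  by (simp add: tensor_kernel_def prod.lessThan_Suc_shift del: prod.lessThan_Suc)

lemma tensor_kernel_Nil [simp]: "tensor_kernel [] [] = 1"
  by (simp add: tensor_kernel_def)

text \<open>
  The iterated derivatives of \<open>x \<mapsto> f(L x)\<close>, where \<open>L\<close> expresses the variables \<open>W(h\<^sub>i)\<close> through the
  \<open>W(e\<^sub>k)\<close>. By the chain rule the coefficient of the derivative along \<open>is\<close> is a product of inner products
  \<open>h\<^sub>i \<bullet> e\<^sub>k\<close>, which is a value of \<open>tensor_kernel\<close>.
\<close>

definition pulled_back_jet ::
    "(nat \<Rightarrow> 'h::real_inner) \<Rightarrow> nat \<Rightarrow> (nat \<Rightarrow> 'h) \<Rightarrow> nat \<Rightarrow> ((nat \<Rightarrow> real) \<Rightarrow> real) \<Rightarrow> nat list \<Rightarrow> (nat \<Rightarrow> real) \<Rightarrow> real" where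
  "pulled_back_jet e n h m f es x = (\<Sum>is\<in>ilists m (length es).
     tensor_kernel (map h is) (map e es) * pdiffs is f (\<lambda>i. \<Sum>k<n. (h i \<bullet> e k) * x k))"

lemma jet_pulled_back:
  assumes f: "smooth_poly_growth m f"
  shows "jet n (pulled_back_jet e n h m f)"
  unfolding jet_def
proof (intro allI impI)
  fix es assume "set es \<subseteq> {..<n}"
  let ?L = "\<lambda>x i. \<Sum>k<n. (h i \<bullet> e k) * x k"
  let ?K = "\<lambda>is. tensor_kernel (map h is) (map e es)"
  have "C1_partials n (\<lambda>x. \<Sum>is\<in>ilists m (length es). ?K is * pdiffs is f (?L x))
     (\<lambda>k x. \<Sum>is\<in>ilists m (length es). ?K is * (\<Sum>i<m. (h i \<bullet> e k) * pdiffs (i # is) f (?L x)))"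
    by (rule C1_partials_sum, rule C1_partials_cmult, rule C1_partials_linear, rule jetD[OF jet_pdiffs[OF f]])
       (auto simp: ilists_def)
  then show "C1_partials n (pulled_back_jet e n h m f es) (\<lambda>k. pulled_back_jet e n h m f (k # es))"
    by (rule C1_partials_cong)
       (simp_all add: fun_eq_iff pulled_back_jet_def sum_ilists_Suc tensor_kernel_Cons sum_distrib_left mult_ac)
qed

section \<open>Expansion of tensors in orthonormal bases\<close>

lemma tensor_kernel_length: "length hs \<noteq> length gs \<Longrightarrow> tensor_kernel hs gs = 0"
  by (simp add: tensor_kernel_def)

lemma tensor_kernel_expand:
  assumes "\<And>i. i \<in> set is \<Longrightarrow> h i = (\<Sum>k<n. (h i \<bullet> e k) *\<^sub>R e k)"
  shows "tensor_kernel (map h is) gs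
    = (\<Sum>es\<in>ilists n (length is). tensor_kernel (map h is) (map e es) * tensor_kernel (map e es) gs)"
  using assms
proof (induction "is" arbitrary: gs)
  case Nil
  show ?case by simp
next
  case (Cons i "is")
  show ?case
  proof (cases gs)
    case Nil
    have "tensor_kernel (map e es) gs = 0" if "es \<in> ilists n (length (i # is))" for es
      by (rule tensor_kernel_length) (use that Nil in \<open>auto simp: ilists_def\<close>)
    then show ?thesis using Nil by (simp add: tensor_kernel_length)
  next
    case (Cons g gs')
    have "h i \<bullet> g = (\<Sum>k<n. (h i \<bullet> e k) *\<^sub>R e k) \<bullet> g" using Cons.prems[of i] by simp
    then have hg: "h i \<bullet> g = (\<Sum>k<n. (h i \<bullet> e k) * (e k \<bullet> g))" by (simp add: inner_sum_left)
    have "tensor_kernel (map h (i # is)) gs = (h i \<bullet> g) * tensor_kernel (map h is) gs'"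
      by (simp add: Cons tensor_kernel_Cons)
    also have "\<dots> = (\<Sum>k<n. (h i \<bullet> e k) * (e k \<bullet> g)) *
        (\<Sum>es\<in>ilists n (length is). tensor_kernel (map h is) (map e es) * tensor_kernel (map e es) gs')"
      using Cons.IH[of gs'] Cons.prems by (simp only: hg) simp
    also have "\<dots> = (\<Sum>es\<in>ilists n (length is). \<Sum>k<n. (h i \<bullet> e k) * (e k \<bullet> g) *
         (tensor_kernel (map h is) (map e es) * tensor_kernel (map e es) gs'))"
      unfolding sum_product by (rule sum.swap)
    also have "\<dots> = (\<Sum>es\<in>ilists n (length (i # is)). tensor_kernel (map h (i # is)) (map e es) * tensor_kernel (map e es) gs)"
      by (simp add: sum_ilists_Suc Cons tensor_kernel_Cons mult_ac)
    finally show ?thesis .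
  qed
qed

lemma Rep_tensor_sum: "Rep_tensor (\<Sum>i\<in>I. f i) gs = (\<Sum>i\<in>I. Rep_tensor (f i) gs)"
  by (induction I rule: infinite_finite_induct) (simp_all add: zero_tensor.rep_eq plus_tensor.rep_eq)

lemma tens_expand:
  assumes h: "\<And>i. i \<in> set is \<Longrightarrow> h i = (\<Sum>k<n. (h i \<bullet> e k) *\<^sub>R e k)"
    and v: "v = (\<Sum>b\<in>B. (v \<bullet> b) *\<^sub>R b)"
  shows "tens (map h is) v = (\<Sum>b\<in>B. \<Sum>es\<in>ilists n (length is).
    (tensor_kernel (map h is) (map e es) * (v \<bullet> b)) *\<^sub>R tens (map e es) b)"
proof (rule Rep_tensor_inject[THEN iffD1], rule ext)
  fix gs
  let ?k = "\<lambda>es. tensor_kernel (map h is) (map e es) * tensor_kernel (map e es) gs"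
  have "Rep_tensor (\<Sum>b\<in>B. \<Sum>es\<in>ilists n (length is).
      (tensor_kernel (map h is) (map e es) * (v \<bullet> b)) *\<^sub>R tens (map e es) b) gs
     = (\<Sum>b\<in>B. \<Sum>es\<in>ilists n (length is). ?k es *\<^sub>R ((v \<bullet> b) *\<^sub>R b))"
    by (simp add: Rep_tensor_sum scaleR_tensor.rep_eq tens.rep_eq mult_ac)
  also have "\<dots> = (\<Sum>b\<in>B. tensor_kernel (map h is) gs *\<^sub>R ((v \<bullet> b) *\<^sub>R b))"
    unfolding scaleR_sum_left[symmetric] using tensor_kernel_expand[where h=h and n=n and e=e and gs=gs, OF h] by simp
  also have "\<dots> = tensor_kernel (map h is) gs *\<^sub>R v"
    unfolding scaleR_sum_right[symmetric] by (simp only: v[symmetric])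
  finally show "Rep_tensor (tens (map h is) v) gs = Rep_tensor (\<Sum>b\<in>B. \<Sum>es\<in>ilists n (length is).
      (tensor_kernel (map h is) (map e es) * (v \<bullet> b)) *\<^sub>R tens (map e es) b) gs"
    by (simp add: tens.rep_eq)
qed

lemma norm_orthonormal_sum:
  fixes t :: "'i \<Rightarrow> 'x::real_inner"
  assumes "finite P" and "\<And>p p'. p \<in> P \<Longrightarrow> p' \<in> P \<Longrightarrow> t p \<bullet> t p' = (if p = p' then 1 else 0)"
  shows "norm (\<Sum>p\<in>P. c p *\<^sub>R t p) = L2_set c P"
proof -
  have "(\<Sum>p\<in>P. c p *\<^sub>R t p) \<bullet> (\<Sum>p\<in>P. c p *\<^sub>R t p) = (\<Sum>p\<in>P. \<Sum>p'\<in>P. c p * (c p' * (t p \<bullet> t p')))"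
    by (simp add: inner_sum_left inner_sum_right sum_distrib_left inner_commute mult_ac)
  also have "\<dots> = (\<Sum>p\<in>P. \<Sum>p'\<in>P. if p' = p then c p * c p else 0)"
    by (intro sum.cong refl) (auto simp: assms(2))
  also have "\<dots> = (\<Sum>p\<in>P. (c p)\<^sup>2)"
    using assms(1) by (intro sum.cong refl) (simp add: power2_eq_square)
  finally show ?thesis by (simp add: norm_eq_sqrt_inner L2_set_def)
qed

lemma tens_orthonormal:
  assumes e: "\<And>k l. k < n \<Longrightarrow> l < n \<Longrightarrow> e k \<bullet> e l = (if k = l then 1 else 0)"
    and B: "\<forall>b\<in>B. \<forall>b'\<in>B. b \<bullet> b' = (if b = b' then 1 else 0)"
    and "b \<in> B" "b' \<in> B" "es \<in> ilists n l" "es' \<in> ilists n l"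
  shows "tens (map e es) b \<bullet> tens (map e es') b' = (if (b, es) = (b', es') then 1 else 0)"
proof -
  have len: "length es = l" "length es' = l" and sub: "set es \<subseteq> {..<n}" "set es' \<subseteq> {..<n}"
    using assms(5,6) by (auto simp: ilists_def)
  have ee: "e (es ! p) \<bullet> e (es' ! p) = (if es ! p = es' ! p then 1 else 0)" if "p < l" for p
  proof (rule e)
    have "es ! p \<in> set es" "es' ! p \<in> set es'" using that len by simp_all
    then show "es ! p < n" "es' ! p < n" using sub by auto
  qed
  have "(\<Prod>p<l. e (es ! p) \<bullet> e (es' ! p)) = (if es = es' then 1 else 0)"
  proof (cases "es = es'")
    case True
    then show ?thesis using ee by simp
  next
    case False
    then obtain p where p: "p < l" "es ! p \<noteq> es' ! p" using len by (metis nth_equalityI)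
    then have "(\<Prod>p<l. e (es ! p) \<bullet> e (es' ! p)) = 0"
      by (intro prod_zero bexI[of _ p]) (auto simp: ee)
    then show ?thesis using False by simp
  qed
  then show ?thesis using assms(3,4) B len by (auto simp: inner_tens)
qed

text \<open>
  Expanding the norm into real coefficients avoids measurability of tensor-valued functions.
\<close>

lemma borel_measurable_norm_sum:
  fixes t :: "'i \<Rightarrow> 'x::real_inner"
  assumes "\<And>p. p \<in> P \<Longrightarrow> c p \<in> borel_measurable M"
  shows "(\<lambda>\<omega>. norm (\<Sum>p\<in>P. c p \<omega> *\<^sub>R t p)) \<in> borel_measurable M"
proof -
  have "norm (\<Sum>p\<in>P. c p \<omega> *\<^sub>R t p) = sqrt (\<Sum>p\<in>P. \<Sum>p'\<in>P. c p \<omega> * (c p' \<omega> * (t p \<bullet> t p')))" for \<omega>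
    by (simp add: norm_eq_sqrt_inner inner_sum_left inner_sum_right sum_distrib_left inner_commute mult_ac)
  moreover have "(\<lambda>\<omega>. sqrt (\<Sum>p\<in>P. \<Sum>p'\<in>P. c p \<omega> * (c p' \<omega> * (t p \<bullet> t p')))) \<in> borel_measurable M"
    using assms by (intro borel_measurable_sqrt[THEN measurable_compose[rotated]] borel_measurable_sum borel_measurable_times) auto
  ultimately show ?thesis by simp
qed

section \<open>Reduction to Gaussian space\<close>

context isonormal_process
begin

lemma Lq_norm_transfer:
  fixes Y :: "'a \<Rightarrow> 'x::real_normed_vector"
  assumes e: "\<And>k l. k < n \<Longrightarrow> l < n \<Longrightarrow> e k \<bullet> e l = (if k = l then 1 else 0)"
    and G: "tame n G" and q: "q > 0"
    and Y: "(\<lambda>\<omega>. norm (Y \<omega>)) \<in> borel_measurable M"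
    and eq: "AE \<omega> in M. norm (Y \<omega>) = \<bar>G (\<lambda>k. W (e k) \<omega>)\<bar>"
  shows "Lq_norm M q Y = Lq_norm gauss q G"
proof -
  have tG: "tame n (\<lambda>x. \<bar>G x\<bar> powr q)" using q by (intro tame_abs_powr G) auto
  then have G': "(\<lambda>x. \<bar>G x\<bar> powr q) \<in> borel_measurable borel" "depends_on_first n (\<lambda>x. \<bar>G x\<bar> powr q)"
    by (auto simp: tame_def)
  have "(\<integral>\<omega>. norm (Y \<omega>) powr q \<partial>M) = (\<integral>\<omega>. \<bar>G (\<lambda>k. W (e k) \<omega>)\<bar> powr q \<partial>M)"
  proof (rule integral_cong_AE)
    show "(\<lambda>\<omega>. norm (Y \<omega>) powr q) \<in> borel_measurable M" using Y by simp
    show "(\<lambda>\<omega>. \<bar>G (\<lambda>k. W (e k) \<omega>)\<bar> powr q) \<in> borel_measurable M"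
      by (rule random_variable_depends_on_first[where Z="\<lambda>k. W (e k)", OF _ G']) simp
    show "AE \<omega> in M. norm (Y \<omega>) powr q = \<bar>G (\<lambda>k. W (e k) \<omega>)\<bar> powr q"
      using eq by eventually_elim simp
  qed
  also have "\<dots> = (\<integral>x. \<bar>G x\<bar> powr q \<partial>gauss)"
    by (rule gaussian_expectation[where Z="\<lambda>k. W (e k)", OF _ G' W_orthonormal_char[OF e]]) auto
  finally show ?thesis by (simp add: Lq_norm_def)
qed

text \<open>
  The linear relations between the \<open>W(h\<^sub>i)\<close> and the \<open>W(e\<^sub>k)\<close> hold simultaneously outside one null
  set, since there are finitely many. On its complement the derivative of order \<open>l\<close> is a combination of the
  orthonormal tensors \<open>tens (map e es) b\<close>, and its norm is the Euclidean norm of the coefficients.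
\<close>

lemma smooth_on_gaussian_space:
  fixes F :: "'a \<Rightarrow> 'v::real_inner"
  assumes "smooth_with_derivatives M W F D"
  obtains n and B :: "'v set" and u where
    "finite B" "\<And>b. b \<in> B \<Longrightarrow> jet n (u b)"
    "\<And>q. q > 0 \<Longrightarrow> Lq_norm M q F = Lq_norm gauss q (\<lambda>x. L2_set (\<lambda>b. u b [] x) B)"
    "\<And>q l. q > 0 \<Longrightarrow> l \<ge> 1 \<Longrightarrow>
      Lq_norm M q (D l) = Lq_norm gauss q (\<lambda>x. L2_set (\<lambda>(b, es). u b es x) (B \<times> ilists n l))"
proof -
  obtain J :: nat and m h f v where f: "\<And>j. j < J \<Longrightarrow> smooth_poly_growth (m j) (f j)"
    and F: "\<And>\<omega>. \<omega> \<in> space M \<Longrightarrow> F \<omega> = (\<Sum>j<J. f j (\<lambda>i. W (h j i) \<omega>) *\<^sub>R v j)"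
    and D: "\<And>l \<omega>. l \<ge> 1 \<Longrightarrow> \<omega> \<in> space M \<Longrightarrow> D l \<omega> = (\<Sum>j<J. cyl_derivative W (m j) (h j) (f j) (v j) l \<omega>)"
    using assms unfolding smooth_with_derivatives_def by blast
  have "finite (\<Union>j\<in>{..<J}. h j ` {..<m j})" by simp
  from finite_parseval[OF this] obtain E where EE: "finite E \<and> (\<forall>e\<in>E. \<forall>e'\<in>E. e \<bullet> e' = (if e = e' then 1 else 0)) \<and>
    (\<forall>x\<in>(\<Union>j\<in>{..<J}. h j ` {..<m j}). x = (\<Sum>e\<in>E. (x \<bullet> e) *\<^sub>R e))" ..
  have E: "finite E" "\<forall>e\<in>E. \<forall>e'\<in>E. e \<bullet> e' = (if e = e' then 1 else 0)"
    "\<forall>x\<in>(\<Union>j\<in>{..<J}. h j ` {..<m j}). x = (\<Sum>e\<in>E. (x \<bullet> e) *\<^sub>R e)"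
    by (rule conjunct1[OF EE], rule conjunct1[OF conjunct2[OF EE]], rule conjunct2[OF conjunct2[OF EE]])
  have "finite (v ` {..<J})" by simp
  from finite_parseval[OF this] obtain B where BB: "finite B \<and> (\<forall>e\<in>B. \<forall>e'\<in>B. e \<bullet> e' = (if e = e' then 1 else 0)) \<and>
    (\<forall>x\<in>v ` {..<J}. x = (\<Sum>e\<in>B. (x \<bullet> e) *\<^sub>R e))" ..
  have B: "finite B" "\<forall>e\<in>B. \<forall>e'\<in>B. e \<bullet> e' = (if e = e' then 1 else 0)"
    "\<forall>x\<in>v ` {..<J}. x = (\<Sum>e\<in>B. (x \<bullet> e) *\<^sub>R e)"
    by (rule conjunct1[OF BB], rule conjunct1[OF conjunct2[OF BB]], rule conjunct2[OF conjunct2[OF BB]])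
  define n where "n = card E"
  obtain e where bij: "bij_betw e {..<n} E"
    using ex_bij_betw_nat_finite[OF E(1)] by (auto simp: n_def atLeast0LessThan)
  have e: "e k \<bullet> e l = (if k = l then 1 else 0)" if "k < n" "l < n" for k l
  proof -
    have "e k \<in> E" "e l \<in> E" by (rule bspec[OF bij_betwE[OF bij]], use that in simp)+
    moreover have "e k = e l \<longleftrightarrow> k = l"
      using bij_betw_imp_inj_on[OF bij] that by (auto simp: inj_on_eq_iff)
    ultimately show ?thesis using E(2) by simp
  qed
  have sumE: "(\<Sum>g\<in>E. k g) = (\<Sum>i<n. k (e i))" for k :: "'h \<Rightarrow> 'z::comm_monoid_add"
    by (rule sum.reindex_bij_betw[OF bij, symmetric])
  have hE: "h j i = (\<Sum>g\<in>E. (h j i \<bullet> g) *\<^sub>R g)" if "j < J" "i < m j" for i j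
    by (rule bspec[OF E(3)]) (use that in auto)
  have he: "h j i = (\<Sum>k<n. (h j i \<bullet> e k) *\<^sub>R e k)" if "j < J" "i < m j" for i j
    using hE[OF that] unfolding sumE .
  have vB: "v j = (\<Sum>b\<in>B. (v j \<bullet> b) *\<^sub>R b)" if "j < J" for j
    by (rule bspec[OF B(3)]) (use that in auto)
  define u where "u b es x = (\<Sum>j<J. (v j \<bullet> b) * pulled_back_jet e n (h j) (m j) (f j) es x)" for b es x
  have u: "jet n (u b)" for b
    unfolding jet_def
  proof (intro allI impI)
    fix es assume es: "set es \<subseteq> {..<n}"
    have "C1_partials n (\<lambda>x. \<Sum>j<J. (v j \<bullet> b) * pulled_back_jet e n (h j) (m j) (f j) es x)
      (\<lambda>k x. \<Sum>j<J. (v j \<bullet> b) * pulled_back_jet e n (h j) (m j) (f j) (k # es) x)"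
      by (rule C1_partials_sum, rule C1_partials_cmult, rule jetD[OF jet_pulled_back[OF f] es]) simp
    then show "C1_partials n (u b es) (\<lambda>k. u b (k # es))"
      by (rule C1_partials_cong) (simp_all add: fun_eq_iff u_def)
  qed
  define lin where "lin j x i = (\<Sum>k<n. (h j i \<bullet> e k) * x k)" for j i and x :: "nat \<Rightarrow> real"
  define Z where "Z \<omega> = (\<lambda>k. W (e k) \<omega>)" for \<omega>
  have AE_lin: "AE \<omega> in M. \<forall>p\<in>(SIGMA j:{..<J}. {..<m j}). W (h (fst p) (snd p)) \<omega> = lin (fst p) (Z \<omega>) (snd p)"
  proof (rule AE_finite_allI)
    fix p assume "p \<in> (SIGMA j:{..<J}. {..<m j})"
    then obtain j i where p: "p = (j, i)" "j < J" "i < m j" by auto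
    have "AE \<omega> in M. W (h j i) \<omega> = (\<Sum>g\<in>E. (h j i \<bullet> g) * W g \<omega>)"
      by (rule W_linear[OF E(1) hE[OF p(2,3)]])
    then show "AE \<omega> in M. W (h (fst p) (snd p)) \<omega> = lin (fst p) (Z \<omega>) (snd p)"
      by (simp add: p(1) lin_def Z_def sumE)
  qed simp
  have pd_tame: "tame (m j) (pdiffs js (f j))" if "j < J" "set js \<subseteq> {..<m j}" for j js
    by (rule jet_tame[OF jet_pdiffs[OF f[OF that(1)]] that(2)])
  have pd_meas: "(\<lambda>\<omega>. pdiffs js (f j) (\<lambda>i. W (h j i) \<omega>)) \<in> borel_measurable M" if "j < J" "set js \<subseteq> {..<m j}" for j js
    by (rule random_variable_depends_on_first[where Z="\<lambda>i. W (h j i)" and n="m j"])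
       (use pd_tame[OF that] in \<open>auto simp: tame_def\<close>)
  have f_meas: "(\<lambda>\<omega>. f j (\<lambda>i. W (h j i) \<omega>)) \<in> borel_measurable M" if "j < J" for j
  proof -
    have "set [] \<subseteq> {..<m j}" by simp
    from pd_meas[OF that this] show ?thesis by (simp add: pdiffs_def)
  qed
  have pd_eq: "pdiffs js (f j) (\<lambda>i. W (h j i) \<omega>) = pdiffs js (f j) (lin j (Z \<omega>))"
    if "\<forall>p\<in>(SIGMA j:{..<J}. {..<m j}). W (h (fst p) (snd p)) \<omega> = lin (fst p) (Z \<omega>) (snd p)"
      "j < J" "set js \<subseteq> {..<m j}" for j js \<omega>
  proof (rule tame_cong[OF pd_tame[OF that(2,3)]], intro allI impI)
    fix i assume "i < m j"
    then have "(j, i) \<in> (SIGMA j:{..<J}. {..<m j})" using that(2) by simp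
    from bspec[OF that(1) this] show "W (h j i) \<omega> = lin j (Z \<omega>) i" by simp
  qed
  have f_eq: "f j (\<lambda>i. W (h j i) \<omega>) = f j (lin j (Z \<omega>))"
    if "\<forall>p\<in>(SIGMA j:{..<J}. {..<m j}). W (h (fst p) (snd p)) \<omega> = lin (fst p) (Z \<omega>) (snd p)" "j < J" for j \<omega>
  proof -
    have "set [] \<subseteq> {..<m j}" by simp
    from pd_eq[OF that this] show ?thesis by (simp add: pdiffs_def)
  qed
  have normF: "Lq_norm M q F = Lq_norm gauss q (\<lambda>x. L2_set (\<lambda>b. u b [] x) B)" if q: "q > 0" for q
  proof (rule Lq_norm_transfer[where n=n and e=e, OF e _ q])
    show "tame n (\<lambda>x. L2_set (\<lambda>b. u b [] x) B)"
      by (rule tame_L2_set, rule jet_tame[OF u]) simp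
    have "(\<lambda>\<omega>. norm (\<Sum>j<J. f j (\<lambda>i. W (h j i) \<omega>) *\<^sub>R v j)) \<in> borel_measurable M"
      by (rule borel_measurable_norm_sum) (use f_meas in simp)
    then show "(\<lambda>\<omega>. norm (F \<omega>)) \<in> borel_measurable M"
      by (rule measurable_cong[THEN iffD1, rotated]) (simp add: F)
    show "AE \<omega> in M. norm (F \<omega>) = \<bar>L2_set (\<lambda>b. u b [] (\<lambda>k. W (e k) \<omega>)) B\<bar>"
      using AE_lin AE_space
    proof eventually_elim
      fix \<omega> assume lin: "\<forall>p\<in>(SIGMA j:{..<J}. {..<m j}). W (h (fst p) (snd p)) \<omega> = lin (fst p) (Z \<omega>) (snd p)"
        and \<omega>: "\<omega> \<in> space M"
      have "F \<omega> = (\<Sum>j<J. f j (lin j (Z \<omega>)) *\<^sub>R v j)"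
        unfolding F[OF \<omega>] by (intro sum.cong refl) (simp add: f_eq[OF lin])
      also have "\<dots> = (\<Sum>j<J. \<Sum>b\<in>B. (f j (lin j (Z \<omega>)) * (v j \<bullet> b)) *\<^sub>R b)"
      proof (rule sum.cong[OF refl])
        fix j assume "j \<in> {..<J}"
        then have "f j (lin j (Z \<omega>)) *\<^sub>R v j = f j (lin j (Z \<omega>)) *\<^sub>R (\<Sum>b\<in>B. (v j \<bullet> b) *\<^sub>R b)"
          using vB[of j] by simp
        then show "f j (lin j (Z \<omega>)) *\<^sub>R v j = (\<Sum>b\<in>B. (f j (lin j (Z \<omega>)) * (v j \<bullet> b)) *\<^sub>R b)"
          by (simp add: scaleR_sum_right)
      qed
      also have "\<dots> = (\<Sum>b\<in>B. \<Sum>j<J. (f j (lin j (Z \<omega>)) * (v j \<bullet> b)) *\<^sub>R b)" by (rule sum.swap)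
      also have "\<dots> = (\<Sum>b\<in>B. u b [] (Z \<omega>) *\<^sub>R b)"
        by (simp add: u_def pulled_back_jet_def pdiffs_def lin_def[abs_def] scaleR_sum_left mult.commute)
      finally show "norm (F \<omega>) = \<bar>L2_set (\<lambda>b. u b [] (\<lambda>k. W (e k) \<omega>)) B\<bar>"
        using norm_orthonormal_sum[of B "\<lambda>b. b" "\<lambda>b. u b [] (Z \<omega>)"] B(1,2) by (simp add: Z_def)
    qed
  qed auto
  have normD: "Lq_norm M q (D l) = Lq_norm gauss q (\<lambda>x. L2_set (\<lambda>(b, es). u b es x) (B \<times> ilists n l))"
    if q: "q > 0" and l: "l \<ge> 1" for q l
  proof (rule Lq_norm_transfer[where n=n and e=e, OF e _ q])
    have D': "D l \<omega> = (\<Sum>j<J. \<Sum>is\<in>ilists (m j) l. pdiffs is (f j) (\<lambda>i. W (h j i) \<omega>) *\<^sub>R tens (map (h j) is) (v j))"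
      if "\<omega> \<in> space M" for \<omega>
      using D[OF l that] by (simp add: cyl_derivative_def ilists_def)
    show "tame n (\<lambda>x. L2_set (\<lambda>(b, es). u b es x) (B \<times> ilists n l))"
      unfolding case_prod_unfold by (rule tame_L2_set, rule jet_tame[OF u]) (auto simp: ilists_def)
    have "(\<lambda>\<omega>. norm (\<Sum>p\<in>(SIGMA j:{..<J}. ilists (m j) l). pdiffs (snd p) (f (fst p)) (\<lambda>i. W (h (fst p) i) \<omega>) *\<^sub>R tens (map (h (fst p)) (snd p)) (v (fst p)))) \<in> borel_measurable M"
      by (rule borel_measurable_norm_sum) (auto intro!: pd_meas simp: ilists_def)
    then show "(\<lambda>\<omega>. norm (D l \<omega>)) \<in> borel_measurable M"
      by (rule measurable_cong[THEN iffD1, rotated]) (simp add: D' sum.Sigma case_prod_unfold)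
    show "AE \<omega> in M. norm (D l \<omega>) = \<bar>L2_set (\<lambda>(b, es). u b es (\<lambda>k. W (e k) \<omega>)) (B \<times> ilists n l)\<bar>"
      using AE_lin AE_space
    proof eventually_elim
      fix \<omega> assume lin: "\<forall>p\<in>(SIGMA j:{..<J}. {..<m j}). W (h (fst p) (snd p)) \<omega> = lin (fst p) (Z \<omega>) (snd p)"
        and \<omega>: "\<omega> \<in> space M"
      define T where "T j is b es = (pdiffs is (f j) (lin j (Z \<omega>)) * (tensor_kernel (map (h j) is) (map e es) * (v j \<bullet> b))) *\<^sub>R tens (map e es) b"
        for j "is" b es
      have "D l \<omega> = (\<Sum>j<J. \<Sum>is\<in>ilists (m j) l. \<Sum>b\<in>B. \<Sum>es\<in>ilists n l. T j is b es)"
        unfolding D'[OF \<omega>]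
      proof (intro sum.cong refl)
        fix j "is" assume "j \<in> {..<J}" "is \<in> ilists (m j) l"
        then have j: "j < J" "length is = l" "set is \<subseteq> {..<m j}" by (auto simp: ilists_def)
        have "tens (map (h j) is) (v j) = (\<Sum>b\<in>B. \<Sum>es\<in>ilists n (length is).
            (tensor_kernel (map (h j) is) (map e es) * (v j \<bullet> b)) *\<^sub>R tens (map e es) b)"
          by (rule tens_expand[OF he vB]) (use j in auto)
        then show "pdiffs is (f j) (\<lambda>i. W (h j i) \<omega>) *\<^sub>R tens (map (h j) is) (v j) = (\<Sum>b\<in>B. \<Sum>es\<in>ilists n l. T j is b es)"
          unfolding pd_eq[OF lin j(1,3)] by (simp add: T_def j(2) scaleR_sum_right)
      qed
      also have "\<dots> = (\<Sum>j<J. \<Sum>b\<in>B. \<Sum>is\<in>ilists (m j) l. \<Sum>es\<in>ilists n l. T j is b es)"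
        by (rule sum.cong[OF refl], rule sum.swap)
      also have "\<dots> = (\<Sum>b\<in>B. \<Sum>j<J. \<Sum>is\<in>ilists (m j) l. \<Sum>es\<in>ilists n l. T j is b es)" by (rule sum.swap)
      also have "\<dots> = (\<Sum>b\<in>B. \<Sum>j<J. \<Sum>es\<in>ilists n l. \<Sum>is\<in>ilists (m j) l. T j is b es)"
        by (rule sum.cong[OF refl], rule sum.cong[OF refl], rule sum.swap)
      also have "\<dots> = (\<Sum>b\<in>B. \<Sum>es\<in>ilists n l. \<Sum>j<J. \<Sum>is\<in>ilists (m j) l. T j is b es)"
        by (rule sum.cong[OF refl], rule sum.swap)
      also have "\<dots> = (\<Sum>b\<in>B. \<Sum>es\<in>ilists n l. u b es (Z \<omega>) *\<^sub>R tens (map e es) b)"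
      proof (intro sum.cong refl)
        fix b es assume "es \<in> ilists n l"
        then have "length es = l" by (simp add: ilists_def)
        then show "(\<Sum>j<J. \<Sum>is\<in>ilists (m j) l. T j is b es) = u b es (Z \<omega>) *\<^sub>R tens (map e es) b"
          by (simp add: T_def u_def pulled_back_jet_def lin_def[abs_def] scaleR_sum_left sum_distrib_left mult_ac)
      qed
      also have "\<dots> = (\<Sum>p\<in>B \<times> ilists n l. u (fst p) (snd p) (Z \<omega>) *\<^sub>R tens (map e (snd p)) (fst p))"
        by (simp add: sum.cartesian_product case_prod_unfold)
      finally have "norm (D l \<omega>) = norm (\<Sum>p\<in>B \<times> ilists n l. u (fst p) (snd p) (Z \<omega>) *\<^sub>R tens (map e (snd p)) (fst p))"
        by simp
      also have "\<dots> = L2_set (\<lambda>p. u (fst p) (snd p) (Z \<omega>)) (B \<times> ilists n l)"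
      proof (rule norm_orthonormal_sum)
        fix p p' assume "p \<in> B \<times> ilists n l" "p' \<in> B \<times> ilists n l"
        then show "tens (map e (snd p)) (fst p) \<bullet> tens (map e (snd p')) (fst p') = (if p = p' then 1 else 0)"
          using tens_orthonormal[OF e B(2), of n "fst p" "fst p'" "snd p" l "snd p'"] by (simp add: mem_Times_iff)
      qed (simp add: B(1))
      finally show "norm (D l \<omega>) = \<bar>L2_set (\<lambda>(b, es). u b es (\<lambda>k. W (e k) \<omega>)) (B \<times> ilists n l)\<bar>"
        by (simp add: Z_def case_prod_unfold)
    qed
  qed auto
  show thesis by (rule that[OF B(1) u normF normD])
qed

end

section \<open>Equivalence of the graph norm and the Sobolev norm\<close>

theorem theorem2p1:
  fixes M :: "'a measure"
    and W :: "'h::{real_inner, polish_space} \<Rightarrow> 'a \<Rightarrow> real"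
    and F :: "'a \<Rightarrow> 'v::{real_inner, polish_space}"
    and D :: "nat \<Rightarrow> 'a \<Rightarrow> ('h, 'v) tensor"
    and k :: nat and q :: real
  assumes "isonormal_process M W"
    and "k \<ge> 2" and "q > 1"
    and "smooth_with_derivatives M W F D"
  shows "2 powr (1 / q - 1) * graph_norm M k q F D \<le> sobolev_norm M k q F D
      \<and> sobolev_norm M k q F D \<le> tau_const k q * graph_norm M k q F D"
proof -
  interpret isonormal_process M W by (rule assms(1))
  show ?thesis
  proof (rule smooth_on_gaussian_space[OF assms(4)])
    fix n and B :: "'v set" and u
    assume B: "finite B" and u: "\<And>b. b \<in> B \<Longrightarrow> jet n (u b)"
      and F: "\<And>q. q > 0 \<Longrightarrow> Lq_norm M q F = Lq_norm gauss q (\<lambda>x. L2_set (\<lambda>b. u b [] x) B)"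
      and D: "\<And>q l. q > 0 \<Longrightarrow> l \<ge> 1 \<Longrightarrow>
        Lq_norm M q (D l) = Lq_norm gauss q (\<lambda>x. L2_set (\<lambda>(b, es). u b es x) (B \<times> ilists n l))"
    define a where "a l = (if l = 0 then Lq_norm M q F else Lq_norm M q (D l))" for l
    have a0: "a l \<ge> 0" for l by (simp add: a_def)
    have q: "q > 0" using assms(3) by simp
    have step: "a l \<le> c_const q * a (Suc l) + d_const l q * a 0" if "l \<ge> 1" for l
      using jet_norm_interpolation[where l=l, OF B u assms(3)] that by (simp add: a_def F[OF q] D[OF q])
    have sob: "sobolev_norm M k q F D = (a 0 powr q + (\<Sum>l=1..k. a l powr q)) powr (1 / q)"
      by (simp add: sobolev_norm_def a_def)
    have graph: "graph_norm M k q F D = a 0 + a k"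
      using assms(2) by (simp add: graph_norm_def a_def)
    have "2 powr (1 / q - 1) * (a 0 + a k) \<le> (a 0 powr q + (\<Sum>l=1..k. a l powr q)) powr (1 / q)"
      using assms(2,3) a0 by (intro graph_norm_lower_bound) auto
    moreover have "(a 0 powr q + (\<Sum>l=1..k. a l powr q)) powr (1 / q) \<le> tau_const k q * (a 0 + a k)"
      using interpolation_chain[of a q "k - 1", OF a0 assms(3) step] assms(2) by simp
    ultimately show ?thesis unfolding sob graph by blast
  qed
qed

end
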